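(* Let $k$ be a field and let $A$ be a Frobenius $k$-algebra with semisimple Nakayama automorphism $\mathfrak N$. Then the BV-algebras $(HH^\bullet(A),\cup,[\ ,\ ],\partial B_{\mathfrak N}^*\partial^{-1})$ and $(H^\bullet(A,A_{\mathfrak N}^* ),\cup_*,[\ ,\ ]_*,\Delta)$, where $\Delta=Z_*\,\partial\, B_{\mathfrak N}^*\,\overline{\mathfrak C}$, are isomorphic.
   Context: Conventions. $\otimes=\otimes_k$; algebras are associative and unital; $(-)^*=\mathrm{Hom}_k(-,k)$. For an $A$-bimodule $M$, $H^\bullet(A,M)$ (resp. $H_\bullet(A,M)$) is Hochschild cohomology (resp. homology), computed by the standard complexes $C^n(A,M)=\mathrm{Hom}_k(A^{\otimes n},M)$ (resp. $M\otimes A^{\otimes n}$); $HH^\bullet(A)=H^\bullet(A,A)$. A Frobenius algebra is a finite-dimensional $k$-algebra $A$ with a non-degenerate associative ($\langle ab,c\rangle=\langle a,bc\rangle$) bilinear form $\langle-,-\rangle:A\times A\to k$. Its Nakayama automorphism is the algebra automorphism $\mathfrak N:A\to A$ with $\langle a,-\rangle=\langle-,\mathfrak N(a)\rangle$ for all $a\in A$. It is semisimple if it is diagonalizable over the algebraic closure of $k$. $A_{\mathfrak N}$ is the $A$-bimodule with underlying space $A$ and actions $axb=a\,x\,\mathfrak N(b)$ (products in $A$ on the right-hand side). $A_{\mathfrak N}^*$ has the bimodule structure $(afb)(c)=f(bc\,\mathfrak N(a))$. The map $Z:A\to A_{\mathfrak N}^*$, $Z(a)=\langle a,-\rangle$,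 is an isomorphism of $A$-bimodules, and $Z_*:HH^\bullet(A)\to H^\bullet(A,A_{\mathfrak N}^* )$ is the isomorphism induced by composition with $Z$. Cup products and brackets. If $M$ is an $A$-bimodule with an associative $k$-algebra structure, $(f\cup g)(a_1\otimes\cdots\otimes a_{n+m})=f(a_1\otimes\cdots\otimes a_n)g(a_{n+1}\otimes\cdots\otimes a_{n+m})$. For $f\in C^n(A,M)$, $h\in C^m(A,A)$, $$(f\,\bar\circ\,h)(a_1\otimes\cdots\otimes a_{n+m-1})=\sum_{i=1}^n(-1)^{(i-1)(m-1)}f(a_1\otimes\cdots\otimes a_{i-1}\otimes h(a_i\otimes\cdots\otimes a_{i+m-1})\otimes a_{i+m}\otimes\cdots\otimes a_{n+m-1}).$$ On $HH^\bullet(A)$: $\cup$ is the cup product for $M=A$ and $[f,g]=f\,\bar\circ\,g-(-1)^{(n-1)(m-1)}g\,\bar\circ\,f$. On $H^\bullet(A,A_{\mathfrak N}^* )$: $A_{\mathfrak N}^*$ carries the multiplication $f\cdot g=Z(Z^{-1}(f)Z^{-1}(g))$, $\cup_*$ is the corresponding cup product, and $[f,g]_*=f\,\bar\circ\,(Z^{-1}\circ g)-(-1)^{(n-1)(m-1)}g\,\bar\circ\,(Z^{-1}\circ f)$. Operators. $B_{\mathfrak N}:H_\bullet(A,A_{\mathfrak N})\to H_{\bullet+1}(A,A_{\mathfrak N})$ sends $[a_0\otimes a_1\otimes\cdots\otimes a_n]$ to $$\Big[\sum_{i=0}^n(-1)^{in}\,1\otimes a_i\otimes\cdots\otimes a_n\otimes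 a_0\otimes\mathfrak N(a_1)\otimes\cdots\otimes\mathfrak N(a_{i-1})\Big],$$ and $B_{\mathfrak N}^*$ is its $k$-dual. $\partial:H_\bullet(A,A_{\mathfrak N})^*\to HH^\bullet(A)$ is the isomorphism with inverse $\partial^{-1}([f])=(-1)^{|f|}\langle-,f\rangle$, i.e. $\partial^{-1}([f])([a_0\otimes\cdots\otimes a_n])=(-1)^n\langle a_0,f(a_1\otimes\cdots\otimes a_n)\rangle$. $\overline{\mathfrak C}:H^n(A,A_{\mathfrak N}^* )\to H_n(A,A_{\mathfrak N})^*$ is the isomorphism $\overline{\mathfrak C}([f])([x\otimes a_1\otimes\cdots\otimes a_n])=(-1)^nf(a_1\otimes\cdots\otimes a_n)(x)$. It is known (Lambre–Zhou–Zimmermann) that, when $\mathfrak N$ is semisimple, $HH^\bullet(A)$ is a BV-algebra with BV-operator $\partial B_{\mathfrak N}^*\partial^{-1}$. A Gerstenhaber algebra is $(\mathcal H^\bullet,\cup,[\ ,\ ])$ with $\mathcal H^\bullet$ a graded $k$-module, $\cup$ a graded commutative associative product of degree $0$, and $[\ ,\ ]:\mathcal H^n\times\mathcal H^m\to\mathcal H^{n+m-1}$ a graded Lie bracket with $[f,g]=-(-1)^{(|f|-1)(|g|-1)}[g,f]$, $[f,[g,h]]=[[f,g],h]+(-1)^{(|f|-1)(|g|-1)}[g,[f,h]]$, $[f,g\cup h]=[f,g]\cup h+(-1)^{(|f|-1)|g|}g\cup[f,h]$. A BV-algebra is a Gerstenhaber algebra with a morphism $\Delta:\mathcal H^{\bullet+1}\to\mathcal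 H^\bullet$ with $\Delta^2=0$ and $[f,g]=(-1)^{|f|}(\Delta(f\cup g)-\Delta(f)\cup g-(-1)^{|f|}f\cup\Delta(g))$. An isomorphism of BV-algebras is a graded $k$-linear isomorphism compatible with the products, the brackets and the BV-operators.
   Formalization: ∂⁻¹ uses ⟨f(a₁..aₙ),a₀⟩, since ⟨a₀,f⟩ is not well defined on homology if 𝔑≠id; B_𝔑 has i=0 term 1⊗a₀⊗𝔑(a₁)⊗..⊗𝔑(aₙ), on 𝔑-invariant cycles; as the printed signs break the Poisson rule, the BV axioms are only shown to hold for one side iff for the other. *)

theory Defs
  imports
    "HOL-Library.Function_Algebras"
    "HOL-Library.Poly_Mapping"
    "HOL-Algebra.Algebraic_Closure_Type"
    "Jordan_Normal_Form.Matrix"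
begin

definition sgnpow :: "int \<Rightarrow> 'm::ab_group_add \<Rightarrow> 'm" where
  "sgnpow e x = (if even e then x else - x)"  (* (-1)^e x *)

definition rep :: "'x set \<Rightarrow> 'x" where
  "rep U = (SOME x. x \<in> U)"


subsection \<open>Gerstenhaber and BV-algebras\<close>

text \<open>
  Gradings are indexed by all integers, so that the bracket (degree \<open>-1\<close>) and the
  BV-operator (degree \<open>-1\<close>) need no special treatment in degree \<open>0\<close>. The operations carry
  the degrees of their arguments, and only their values on the carriers matter.

  Sign pitfall: with the usual unsigned cup product and the bracket
  \<open>[f, g] = f \<circ> g - (-1)\<^sup>(\<^sup>n\<^sup>-\<^sup>1\<^sup>)\<^sup>(\<^sup>m\<^sup>-\<^sup>1\<^sup>) g \<circ> f\<close>, both used below, Gerstenhaber's Poisson rule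
  for Hochschild cohomology takes the form
  \<open>[f \<union> g, h] = [f, h] \<union> g + (-1)\<^sup>|\<^sup>f\<^sup>|\<^sup>(\<^sup>|\<^sup>h\<^sup>|\<^sup>-\<^sup>1\<^sup>) f \<union> [g, h]\<close>, which is the rule \<open>poisson\<close> for the
  opposite bracket.
\<close>

record ('k, 'h) bv_structure =
  gr :: "int \<Rightarrow> 'h set"
  gzero :: "int \<Rightarrow> 'h"
  gadd :: "int \<Rightarrow> 'h \<Rightarrow> 'h \<Rightarrow> 'h"
  gscale :: "int \<Rightarrow> 'k \<Rightarrow> 'h \<Rightarrow> 'h"
  cup :: "int \<Rightarrow> int \<Rightarrow> 'h \<Rightarrow> 'h \<Rightarrow> 'h"
  bracket :: "int \<Rightarrow> int \<Rightarrow> 'h \<Rightarrow> 'h \<Rightarrow> 'h"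
  bvop :: "int \<Rightarrow> 'h \<Rightarrow> 'h"

definition gsgn :: "('k::field, 'h) bv_structure \<Rightarrow> int \<Rightarrow> int \<Rightarrow> 'h \<Rightarrow> 'h" where
  "gsgn S n e x = gscale S n (if even e then 1 else - 1) x"

locale graded_vector_space =
  fixes S :: "('k::field, 'h) bv_structure"
  assumes zero_closed: "gzero S n \<in> gr S n"
    and add_closed: "x \<in> gr S n \<Longrightarrow> y \<in> gr S n \<Longrightarrow> gadd S n x y \<in> gr S n"
    and scale_closed: "x \<in> gr S n \<Longrightarrow> gscale S n c x \<in> gr S n"
    and add_assoc: "x \<in> gr S n \<Longrightarrow> y \<in> gr S n \<Longrightarrow> z \<in> gr S n \<Longrightarrow>
      gadd S n (gadd S n x y) z = gadd S n x (gadd S n y z)"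
    and add_commute: "x \<in> gr S n \<Longrightarrow> y \<in> gr S n \<Longrightarrow> gadd S n x y = gadd S n y x"
    and add_zero: "x \<in> gr S n \<Longrightarrow> gadd S n (gzero S n) x = x"
    and add_neg: "x \<in> gr S n \<Longrightarrow> gadd S n (gscale S n (- 1) x) x = gzero S n"
    and scale_add_right: "x \<in> gr S n \<Longrightarrow> y \<in> gr S n \<Longrightarrow>
      gscale S n c (gadd S n x y) = gadd S n (gscale S n c x) (gscale S n c y)"
    and scale_add_left: "x \<in> gr S n \<Longrightarrow>
      gscale S n (c + d) x = gadd S n (gscale S n c x) (gscale S n d x)"
    and scale_scale: "x \<in> gr S n \<Longrightarrow> gscale S n c (gscale S n d x) = gscale S n (c * d) x"
    and scale_one: "x \<in> gr S n \<Longrightarrow> gscale S n 1 x = x"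

locale gerstenhaber_algebra = graded_vector_space S
  for S :: "('k::field, 'h) bv_structure" +
  assumes cup_closed: "f \<in> gr S n \<Longrightarrow> g \<in> gr S m \<Longrightarrow> cup S n m f g \<in> gr S (n + m)"
    and cup_add_left: "f \<in> gr S n \<Longrightarrow> f' \<in> gr S n \<Longrightarrow> g \<in> gr S m \<Longrightarrow>
      cup S n m (gadd S n f f') g = gadd S (n + m) (cup S n m f g) (cup S n m f' g)"
    and cup_add_right: "f \<in> gr S n \<Longrightarrow> g \<in> gr S m \<Longrightarrow> g' \<in> gr S m \<Longrightarrow>
      cup S n m f (gadd S m g g') = gadd S (n + m) (cup S n m f g) (cup S n m f g')"
    and cup_scale_left: "f \<in> gr S n \<Longrightarrow> g \<in> gr S m \<Longrightarrow>
      cup S n m (gscale S n c f) g = gscale S (n + m) c (cup S n m f g)"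
    and cup_scale_right: "f \<in> gr S n \<Longrightarrow> g \<in> gr S m \<Longrightarrow>
      cup S n m f (gscale S m c g) = gscale S (n + m) c (cup S n m f g)"
    and cup_assoc: "f \<in> gr S n \<Longrightarrow> g \<in> gr S m \<Longrightarrow> h \<in> gr S l \<Longrightarrow>
      cup S (n + m) l (cup S n m f g) h = cup S n (m + l) f (cup S m l g h)"
    and cup_commute: "f \<in> gr S n \<Longrightarrow> g \<in> gr S m \<Longrightarrow>
      cup S n m f g = gsgn S (n + m) (n * m) (cup S m n g f)"
    and bracket_closed: "f \<in> gr S n \<Longrightarrow> g \<in> gr S m \<Longrightarrow> bracket S n m f g \<in> gr S (n + m - 1)"
    and bracket_add_left: "f \<in> gr S n \<Longrightarrow> f' \<in> gr S n \<Longrightarrow> g \<in> gr S m \<Longrightarrow>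
      bracket S n m (gadd S n f f') g
        = gadd S (n + m - 1) (bracket S n m f g) (bracket S n m f' g)"
    and bracket_add_right: "f \<in> gr S n \<Longrightarrow> g \<in> gr S m \<Longrightarrow> g' \<in> gr S m \<Longrightarrow>
      bracket S n m f (gadd S m g g')
        = gadd S (n + m - 1) (bracket S n m f g) (bracket S n m f g')"
    and bracket_scale_left: "f \<in> gr S n \<Longrightarrow> g \<in> gr S m \<Longrightarrow>
      bracket S n m (gscale S n c f) g = gscale S (n + m - 1) c (bracket S n m f g)"
    and bracket_scale_right: "f \<in> gr S n \<Longrightarrow> g \<in> gr S m \<Longrightarrow>
      bracket S n m f (gscale S m c g) = gscale S (n + m - 1) c (bracket S n m f g)"
    and bracket_antisym: "f \<in> gr S n \<Longrightarrow> g \<in> gr S m \<Longrightarrow>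
      bracket S n m f g = gsgn S (n + m - 1) ((n - 1) * (m - 1) + 1) (bracket S m n g f)"
    and jacobi: "f \<in> gr S n \<Longrightarrow> g \<in> gr S m \<Longrightarrow> h \<in> gr S l \<Longrightarrow>
      bracket S n (m + l - 1) f (bracket S m l g h)
        = gadd S (n + m + l - 2)
            (bracket S (n + m - 1) l (bracket S n m f g) h)
            (gsgn S (n + m + l - 2) ((n - 1) * (m - 1))
              (bracket S m (n + l - 1) g (bracket S n l f h)))"
    and poisson: "f \<in> gr S n \<Longrightarrow> g \<in> gr S m \<Longrightarrow> h \<in> gr S l \<Longrightarrow>
      bracket S n (m + l) f (cup S m l g h)
        = gadd S (n + m + l - 1)
            (cup S (n + m - 1) l (bracket S n m f g) h)
            (gsgn S (n + m + l - 1) ((n - 1) * m)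
              (cup S m (n + l - 1) g (bracket S n l f h)))"

locale bv_algebra = gerstenhaber_algebra S
  for S :: "('k::field, 'h) bv_structure" +
  assumes bvop_closed: "f \<in> gr S n \<Longrightarrow> bvop S n f \<in> gr S (n - 1)"
    and bvop_add: "f \<in> gr S n \<Longrightarrow> g \<in> gr S n \<Longrightarrow>
      bvop S n (gadd S n f g) = gadd S (n - 1) (bvop S n f) (bvop S n g)"
    and bvop_scale: "f \<in> gr S n \<Longrightarrow> bvop S n (gscale S n c f) = gscale S (n - 1) c (bvop S n f)"
    and bvop_square: "f \<in> gr S n \<Longrightarrow> bvop S (n - 1) (bvop S n f) = gzero S (n - 2)"
    and bv_bracket: "f \<in> gr S n \<Longrightarrow> g \<in> gr S m \<Longrightarrow>
      bracket S n m f g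
        = gsgn S (n + m - 1) n
            (gadd S (n + m - 1)
              (bvop S (n + m) (cup S n m f g))
              (gadd S (n + m - 1)
                (gsgn S (n + m - 1) 1 (cup S (n - 1) m (bvop S n f) g))
                (gsgn S (n + m - 1) (n + 1) (cup S n (m - 1) f (bvop S m g)))))"

definition bv_isomorphism ::
  "(int \<Rightarrow> 'h \<Rightarrow> 'g) \<Rightarrow> ('k::field, 'h) bv_structure \<Rightarrow> ('k, 'g) bv_structure \<Rightarrow> bool" where
  "bv_isomorphism \<phi> S T \<longleftrightarrow>
    (\<forall>n. bij_betw (\<phi> n) (gr S n) (gr T n)) \<and>
    (\<forall>n. \<forall>x\<in>gr S n. \<forall>y\<in>gr S n. \<phi> n (gadd S n x y) = gadd T n (\<phi> n x) (\<phi> n y)) \<and>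
    (\<forall>n c. \<forall>x\<in>gr S n. \<phi> n (gscale S n c x) = gscale T n c (\<phi> n x)) \<and>
    (\<forall>n m. \<forall>x\<in>gr S n. \<forall>y\<in>gr S m. \<phi> (n + m) (cup S n m x y) = cup T n m (\<phi> n x) (\<phi> m y)) \<and>
    (\<forall>n m. \<forall>x\<in>gr S n. \<forall>y\<in>gr S m.
      \<phi> (n + m - 1) (bracket S n m x y) = bracket T n m (\<phi> n x) (\<phi> m y)) \<and>
    (\<forall>n. \<forall>x\<in>gr S n. \<phi> (n - 1) (bvop S n x) = bvop T n (\<phi> n x))"

definition bv_isomorphic :: "('k::field, 'h) bv_structure \<Rightarrow> ('k, 'g) bv_structure \<Rightarrow> bool" where
  "bv_isomorphic S T \<longleftrightarrow> (\<exists>\<phi>. bv_isomorphism \<phi> S T)"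


subsection \<open>Hochschild cohomology and homology\<close>

text \<open>The sort \<open>{ring, monoid_mult}\<close> is \<open>ring_1\<close> without \<open>0 \<noteq> 1\<close>.\<close>

locale k_algebra = vector_space scale
  for scale :: "'k::field \<Rightarrow> 'a::{ring,monoid_mult} \<Rightarrow> 'a" +
  assumes scale_mult_left: "scale c a * b = scale c (a * b)"
    and scale_mult_right: "a * scale c b = scale c (a * b)"

record ('k, 'a, 'm) bimodule =
  bcarrier :: "'m set"
  bscale :: "'k \<Rightarrow> 'm \<Rightarrow> 'm"
  lact :: "'a \<Rightarrow> 'm \<Rightarrow> 'm"
  ract :: "'m \<Rightarrow> 'a \<Rightarrow> 'm"

text \<open>Formal \<open>k\<close>-linear combinations of generators \<open>(m, [a\<^sub>1, \<dots>, a\<^sub>n])\<close>.\<close>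

type_synonym ('k, 'a, 'm) fchain = "('m \<times> 'a list) \<Rightarrow>\<^sub>0 'k"

abbreviation gen :: "'m \<Rightarrow> 'a list \<Rightarrow> ('k::field, 'a, 'm) fchain" where
  "gen m xs \<equiv> Poly_Mapping.single (m, xs) 1"

definition fscale :: "'k::field \<Rightarrow> ('g \<Rightarrow>\<^sub>0 'k) \<Rightarrow> ('g \<Rightarrow>\<^sub>0 'k)" where
  "fscale c z = Poly_Mapping.map ((*) c) z"

definition lin_ext :: "('g \<Rightarrow> ('h \<Rightarrow>\<^sub>0 'k)) \<Rightarrow> ('g \<Rightarrow>\<^sub>0 'k::field) \<Rightarrow> ('h \<Rightarrow>\<^sub>0 'k)" where
  "lin_ext F z = (\<Sum>g\<in>Poly_Mapping.keys z. fscale (Poly_Mapping.lookup z g) (F g))"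

context k_algebra
begin

text \<open>
  A linear map \<open>A\<^sup>\<otimes>\<^sup>n \<rightarrow> M\<close> is encoded as the corresponding multilinear map on lists of length
  \<open>n\<close>, extended by \<open>0\<close> to lists of other lengths; for \<open>n < 0\<close> only the zero map remains.
\<close>

definition cochains :: "('k, 'a, 'm::ab_group_add) bimodule \<Rightarrow> int \<Rightarrow> ('a list \<Rightarrow> 'm) set" where
  "cochains M n = {f.
    (\<forall>xs. f xs \<in> bcarrier M) \<and>
    (\<forall>xs. int (length xs) \<noteq> n \<longrightarrow> f xs = 0) \<and>
    (\<forall>xs ys a b. f (xs @ (a + b) # ys) = f (xs @ a # ys) + f (xs @ b # ys)) \<and>
    (\<forall>xs ys c a. f (xs @ scale c a # ys) = bscale M c (f (xs @ a # ys)))}"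

definition coboundary ::
  "('k, 'a, 'm::ab_group_add) bimodule \<Rightarrow> ('a list \<Rightarrow> 'm) \<Rightarrow> ('a list \<Rightarrow> 'm)" where
  "coboundary M f xs =
    (if xs = [] then 0
     else lact M (hd xs) (f (tl xs))
        + (\<Sum>i<length xs - 1.
             sgnpow (int i + 1) (f (take i xs @ (xs ! i * xs ! Suc i) # drop (i + 2) xs)))
        + sgnpow (int (length xs)) (ract M (f (butlast xs)) (last xs)))"

definition cocycles :: "('k, 'a, 'm::ab_group_add) bimodule \<Rightarrow> int \<Rightarrow> ('a list \<Rightarrow> 'm) set" where
  "cocycles M n = {f \<in> cochains M n. coboundary M f = 0}"

definition coh_class ::
  "('k, 'a, 'm::ab_group_add) bimodule \<Rightarrow> int \<Rightarrow> ('a list \<Rightarrow> 'm) \<Rightarrow> ('a list \<Rightarrow> 'm) set" where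
  "coh_class M n f = {g \<in> cochains M n. g - f \<in> coboundary M ` cochains M (n - 1)}"

definition cohomology ::
  "('k, 'a, 'm::ab_group_add) bimodule \<Rightarrow> int \<Rightarrow> ('a list \<Rightarrow> 'm) set set" where
  "cohomology M n = coh_class M n ` cocycles M n"

definition coh_zero ::
  "('k, 'a, 'm::ab_group_add) bimodule \<Rightarrow> int \<Rightarrow> ('a list \<Rightarrow> 'm) set" where
  "coh_zero M n = coh_class M n 0"

definition coh_add ::
  "('k, 'a, 'm::ab_group_add) bimodule \<Rightarrow> int
    \<Rightarrow> ('a list \<Rightarrow> 'm) set \<Rightarrow> ('a list \<Rightarrow> 'm) set \<Rightarrow> ('a list \<Rightarrow> 'm) set" where
  "coh_add M n U V = coh_class M n (rep U + rep V)"

definition coh_scale ::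
  "('k, 'a, 'm::ab_group_add) bimodule \<Rightarrow> int
    \<Rightarrow> 'k \<Rightarrow> ('a list \<Rightarrow> 'm) set \<Rightarrow> ('a list \<Rightarrow> 'm) set" where
  "coh_scale M n c U = coh_class M n (\<lambda>xs. bscale M c (rep U xs))"

text \<open>The first argument of \<open>cup_cochain\<close> is the multiplication of \<open>M\<close>.\<close>

definition cup_cochain ::
  "('m \<Rightarrow> 'm \<Rightarrow> 'm) \<Rightarrow> int \<Rightarrow> ('a list \<Rightarrow> 'm::ab_group_add) \<Rightarrow> ('a list \<Rightarrow> 'm)
    \<Rightarrow> ('a list \<Rightarrow> 'm)" where
  "cup_cochain mul n f g xs = mul (f (take (nat n) xs)) (g (drop (nat n) xs))"

definition circ ::
  "int \<Rightarrow> int \<Rightarrow> ('a list \<Rightarrow> 'm::ab_group_add) \<Rightarrow> ('a list \<Rightarrow> 'a) \<Rightarrow> ('a list \<Rightarrow> 'm)" where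
  "circ n m f h xs =
    (if int (length xs) = n + m - 1
     then \<Sum>i\<in>{1..nat n}. sgnpow ((int i - 1) * (m - 1))
       (f (take (i - 1) xs @ h (take (nat m) (drop (i - 1) xs)) # drop (i - 1 + nat m) xs))
     else 0)"

text \<open>
  \<open>M \<otimes> A\<^sup>\<otimes>\<^sup>n\<close> is presented by generators and relations: it is the quotient of \<open>chains M n\<close> by
  \<open>tensor_null M n\<close>. Homology classes are taken directly in \<open>chains M n\<close>, so cycles are the
  chains whose boundary vanishes in the tensor product, and \<open>boundaries\<close> contains
  \<open>tensor_null\<close>.
\<close>

definition chains :: "('k, 'a, 'm::ab_group_add) bimodule \<Rightarrow> int \<Rightarrow> ('k, 'a, 'm) fchain set" where
  "chains M n = {z. \<forall>(m, xs)\<in>Poly_Mapping.keys z. m \<in> bcarrier M \<and> int (length xs) = n}"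

definition tensor_relations ::
  "('k, 'a, 'm::ab_group_add) bimodule \<Rightarrow> ('k, 'a, 'm) fchain set" where
  "tensor_relations M =
     {gen (m + m') xs - gen m xs - gen m' xs | m m' xs. m \<in> bcarrier M \<and> m' \<in> bcarrier M} \<union>
     {gen (bscale M c m) xs - fscale c (gen m xs) | c m xs. m \<in> bcarrier M} \<union>
     {gen m (xs @ (a + b) # ys) - gen m (xs @ a # ys) - gen m (xs @ b # ys) | m xs a b ys.
        m \<in> bcarrier M} \<union>
     {gen m (xs @ scale c a # ys) - fscale c (gen m (xs @ a # ys)) | m xs c a ys.
        m \<in> bcarrier M}"

definition tensor_null ::
  "('k, 'a, 'm::ab_group_add) bimodule \<Rightarrow> int \<Rightarrow> ('k, 'a, 'm) fchain set" where
  "tensor_null M n = Modules.module.span fscale (tensor_relations M \<inter> chains M n)"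

definition bdry_gen ::
  "('k, 'a, 'm::ab_group_add) bimodule \<Rightarrow> 'm \<times> 'a list \<Rightarrow> ('k, 'a, 'm) fchain" where
  "bdry_gen M = (\<lambda>(m, xs).
    if xs = [] then 0
    else gen (ract M m (hd xs)) (tl xs)
       + (\<Sum>i<length xs - 1.
            sgnpow (int i + 1) (gen m (take i xs @ (xs ! i * xs ! Suc i) # drop (i + 2) xs)))
       + sgnpow (int (length xs)) (gen (lact M (last xs) m) (butlast xs)))"

definition cycles :: "('k, 'a, 'm::ab_group_add) bimodule \<Rightarrow> int \<Rightarrow> ('k, 'a, 'm) fchain set" where
  "cycles M n = {z \<in> chains M n. lin_ext (bdry_gen M) z \<in> tensor_null M (n - 1)}"

definition boundaries ::
  "('k, 'a, 'm::ab_group_add) bimodule \<Rightarrow> int \<Rightarrow> ('k, 'a, 'm) fchain set" where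
  "boundaries M n =
    {lin_ext (bdry_gen M) w + r | w r. w \<in> chains M (n + 1) \<and> r \<in> tensor_null M n}"

definition hom_class ::
  "('k, 'a, 'm::ab_group_add) bimodule \<Rightarrow> int \<Rightarrow> ('k, 'a, 'm) fchain \<Rightarrow> ('k, 'a, 'm) fchain set" where
  "hom_class M n z = {w \<in> chains M n. w - z \<in> boundaries M n}"

definition homology ::
  "('k, 'a, 'm::ab_group_add) bimodule \<Rightarrow> int \<Rightarrow> ('k, 'a, 'm) fchain set set" where
  "homology M n = hom_class M n ` cycles M n"

end


subsection \<open>Frobenius algebras\<close>

locale frobenius_algebra = k_algebra scale
  for scale :: "'k::field \<Rightarrow> 'a::{ring,monoid_mult} \<Rightarrow> 'a" +
  fixes form :: "'a \<Rightarrow> 'a \<Rightarrow> 'k"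
  assumes finite_dim: "\<exists>B. finite B \<and> span B = UNIV"
    and form_linear_left: "Vector_Spaces.linear scale (*) (\<lambda>a. form a b)"
    and form_linear_right: "Vector_Spaces.linear scale (*) (\<lambda>b. form a b)"
    and form_assoc: "form (a * b) c = form a (b * c)"
    and nondegenerate_left: "(\<And>b. form a b = 0) \<Longrightarrow> a = 0"
    and nondegenerate_right: "(\<And>a. form a b = 0) \<Longrightarrow> b = 0"
begin

definition nakayama :: "'a \<Rightarrow> 'a" where
  "nakayama a = (THE c. \<forall>b. form a b = form b c)"

definition matrix_wrt :: "'a list \<Rightarrow> ('a \<Rightarrow> 'a) \<Rightarrow> 'k mat" where
  "matrix_wrt es f =
    mat (length es) (length es) (\<lambda>(i, j). representation (set es) (f (es ! j)) (es ! i))"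

definition nakayama_semisimple :: bool where
  "nakayama_semisimple \<longleftrightarrow>
    (\<exists>es D. distinct es \<and> independent (set es) \<and> span (set es) = UNIV \<and>
       diagonal_mat D \<and> similar_mat (map_mat to_ac (matrix_wrt es nakayama)) D)"

definition regular :: "('k, 'a, 'a) bimodule" where
  "regular = \<lparr>bcarrier = UNIV, bscale = scale, lact = (*), ract = (*)\<rparr>"

definition twisted :: "('k, 'a, 'a) bimodule" where  (* A_N *)
  "twisted = \<lparr>bcarrier = UNIV, bscale = scale, lact = (*), ract = (\<lambda>x b. x * nakayama b)\<rparr>"

definition twisted_dual :: "('k, 'a, 'a \<Rightarrow> 'k) bimodule" where  (* the dual of A_N *)
  "twisted_dual =
    \<lparr>bcarrier = {\<phi>. Vector_Spaces.linear scale (*) \<phi>},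
     bscale = (\<lambda>c \<phi> x. c * \<phi> x),
     lact = (\<lambda>a \<phi> c. \<phi> (c * nakayama a)),
     ract = (\<lambda>\<phi> b c. \<phi> (b * c))\<rparr>"

definition Z :: "'a \<Rightarrow> 'a \<Rightarrow> 'k" where
  "Z a = form a"

definition Zinv :: "('a \<Rightarrow> 'k) \<Rightarrow> 'a" where
  "Zinv = inv_into UNIV Z"

definition dual_mult :: "('a \<Rightarrow> 'k) \<Rightarrow> ('a \<Rightarrow> 'k) \<Rightarrow> ('a \<Rightarrow> 'k)" where
  "dual_mult \<phi> \<psi> = Z (Zinv \<phi> * Zinv \<psi>)"

definition Z_star :: "int \<Rightarrow> ('a list \<Rightarrow> 'a) set \<Rightarrow> ('a list \<Rightarrow> 'a \<Rightarrow> 'k) set" where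
  "Z_star n U = coh_class twisted_dual n (Z \<circ> rep U)"


text \<open>
  In the sum defining the operator the indices are cyclic modulo \<open>n + 1\<close>: the summand
  \<open>i = 0\<close> is \<open>1 \<otimes> a\<^sub>0 \<otimes> N(a\<^sub>1) \<otimes> \<dots> \<otimes> N(a\<^sub>n)\<close>.

  For nontrivial \<open>N\<close> this formula maps a cycle to a cycle only if the cycle is invariant under
  \<open>N \<otimes> \<dots> \<otimes> N\<close>. If \<open>N\<close> is semisimple then every homology class contains an invariant cycle,
  and two invariant representatives have homologous images; the operator on homology is
  therefore computed on an invariant representative.
\<close>

definition twist_chain :: "('k, 'a, 'a) fchain \<Rightarrow> ('k, 'a, 'a) fchain" where
  "twist_chain = lin_ext (\<lambda>(a, xs). gen (nakayama a) (map nakayama xs))"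

definition connes_gen :: "'a \<times> 'a list \<Rightarrow> ('k, 'a, 'a) fchain" where
  "connes_gen = (\<lambda>(a, xs). \<Sum>i\<in>{0..length xs}.
    sgnpow (int i * int (length xs))
      (if i = 0 then gen 1 (a # map nakayama xs)
       else gen 1 (drop (i - 1) xs @ a # map nakayama (take (i - 1) xs))))"

definition connes ::
  "int \<Rightarrow> ('k, 'a, 'a) fchain set \<Rightarrow> ('k, 'a, 'a) fchain set" where
  "connes n U = hom_class twisted (n + 1)
    (lin_ext connes_gen
      (SOME z. z \<in> U \<and> z \<in> cycles twisted n \<and> twist_chain z - z \<in> tensor_null twisted n))"

text \<open>Functionals on \<open>homology twisted n\<close> are extended by \<open>0\<close> outside this set.\<close>

definition connes_dual ::
  "int \<Rightarrow> (('k, 'a, 'a) fchain set \<Rightarrow> 'k) \<Rightarrow> (('k, 'a, 'a) fchain set \<Rightarrow> 'k)" where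
  "connes_dual n \<phi> = (\<lambda>V. if V \<in> homology twisted n then \<phi> (connes n V) else 0)"


definition pair_chain :: "('a list \<Rightarrow> 'a \<Rightarrow> 'k) \<Rightarrow> ('k, 'a, 'a) fchain \<Rightarrow> 'k" where
  "pair_chain F z = (\<Sum>(x, xs)\<in>Poly_Mapping.keys z. Poly_Mapping.lookup z (x, xs) * F xs x)"

definition C_bar ::
  "int \<Rightarrow> ('a list \<Rightarrow> 'a \<Rightarrow> 'k) set \<Rightarrow> (('k, 'a, 'a) fchain set \<Rightarrow> 'k)" where
  "C_bar n U = (\<lambda>V. if V \<in> homology twisted n
    then sgnpow n (pair_chain (rep U) (rep V)) else 0)"

text \<open>
  The pairing between \<open>a\<^sub>0 \<in> A\<^sub>N\<close> and \<open>f(a\<^sub>1, \<dots>, a\<^sub>n) \<in> A\<close> is \<open>\<langle>f(a\<^sub>1, \<dots>, a\<^sub>n), a\<^sub>0\<rangle>\<close>, with the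
  value of \<open>f\<close> on the left, since it is \<open>a \<mapsto> \<langle>a, -\<rangle>\<close> that is a bimodule map to the dual of
  \<open>A\<^sub>N\<close>. In the other order the argument from \<open>A\<^sub>N\<close> has to be untwisted first:
  \<open>\<langle>N\<^sup>-\<^sup>1(a\<^sub>0), f(a\<^sub>1, \<dots>, a\<^sub>n)\<rangle>\<close> is the same scalar, whereas \<open>\<langle>a\<^sub>0, f(a\<^sub>1, \<dots>, a\<^sub>n)\<rangle>\<close> does not
  vanish on boundaries when \<open>N\<close> is not the identity.
\<close>

definition del_inv ::
  "int \<Rightarrow> ('a list \<Rightarrow> 'a) set \<Rightarrow> (('k, 'a, 'a) fchain set \<Rightarrow> 'k)" where
  "del_inv n U = (\<lambda>V. if V \<in> homology twisted n
    then sgnpow n (pair_chain (\<lambda>xs x. form (rep U xs) x) (rep V)) else 0)"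

definition del ::
  "int \<Rightarrow> (('k, 'a, 'a) fchain set \<Rightarrow> 'k) \<Rightarrow> ('a list \<Rightarrow> 'a) set" where
  "del n = inv_into (cohomology regular n) (del_inv n)"


definition HH_bv :: "('k, ('a list \<Rightarrow> 'a) set) bv_structure" where
  "HH_bv = \<lparr>
    gr = cohomology regular,
    gzero = coh_zero regular,
    gadd = coh_add regular,
    gscale = coh_scale regular,
    cup = (\<lambda>n m U V. coh_class regular (n + m) (cup_cochain (*) n (rep U) (rep V))),
    bracket = (\<lambda>n m U V. coh_class regular (n + m - 1)
      (circ n m (rep U) (rep V) - sgnpow ((n - 1) * (m - 1)) (circ m n (rep V) (rep U)))),
    bvop = (\<lambda>n U. del (n - 1) (connes_dual (n - 1) (del_inv n U)))\<rparr>"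

definition H_dual_bv :: "('k, ('a list \<Rightarrow> 'a \<Rightarrow> 'k) set) bv_structure" where
  "H_dual_bv = \<lparr>
    gr = cohomology twisted_dual,
    gzero = coh_zero twisted_dual,
    gadd = coh_add twisted_dual,
    gscale = coh_scale twisted_dual,
    cup = (\<lambda>n m U V. coh_class twisted_dual (n + m) (cup_cochain dual_mult n (rep U) (rep V))),
    bracket = (\<lambda>n m U V. coh_class twisted_dual (n + m - 1)
      (circ n m (rep U) (Zinv \<circ> rep V)
        - sgnpow ((n - 1) * (m - 1)) (circ m n (rep V) (Zinv \<circ> rep U)))),
    bvop = (\<lambda>n U. Z_star (n - 1) (del (n - 1) (connes_dual (n - 1) (C_bar n U))))\<rparr>"

end

end

theory Submission
  imports Defs
begin

text \<open>
  Composition with the bimodule isomorphism \<open>Z\<close> is an isomorphism of Hochschild complexes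
  (\<open>coboundary_Z\<close>), and product, bracket and BV-operator on the target are those of
  Hochschild cohomology transported along it. What has to be proved is that this survives the
  passage to classes. All operations are computed on chosen representatives, and the
  representative chosen in \<open>Z_star n U\<close> is \<open>Z \<circ> f\<close> for some \<open>f \<in> U\<close>, in general not the one chosen
  in \<open>U\<close>. So \<open>Z_star\<close> is an isomorphism because the operations do not depend on representatives.

  For the cup product this is the Leibniz rule (\<open>delta_cupr\<close>). For the bracket it is Gerstenhaber's
  formula for the coboundary of \<open>f \<circ> g\<close> (\<open>circ_delta\<close>): its cup product terms cancel in the graded
  commutator, so the differential is a derivation of the bracket (\<open>delta_gbracket\<close>). Both rest on
  one operator on functions of lists, the signed sum over all ways to apply a cochain to a
  block of consecutive entries. It is a derivation for concatenation (\<open>insertion_split\<close>), and its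
  graded commutator with the operator that multiplies neighbouring entries is again such an
  operator (\<open>insertion_merging_commute\<close>). For the BV-operators it suffices that a cocycle and a
  cycle are paired by their classes (\<open>C_bar_Z_star\<close>).

  The axioms of a BV-algebra are carried from one side of an isomorphism to the other, in the
  backward direction provided that the operations of Hochschild cohomology stay inside it. For the
  BV-operator this is the substantial point, since its value is a preimage under \<open>del_inv\<close> and the
  functional in question must be shown to come from a cocycle. Write \<open>T\<close> for \<open>N \<otimes> \<dots> \<otimes> N\<close>, where
  \<open>N\<close> is the Nakayama automorphism, and \<open>b\<close>, \<open>B\<close> for the boundary and the Connes operator. Then
  \<open>b B + B b = T - 1\<close> (\<open>connes_star_homotopy\<close>, in dual form). Over the algebraic closure \<open>T\<close> is
  diagonalizable along with \<open>N\<close>, so there is a polynomial \<open>r\<close> over \<open>k\<close> for which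
  \<open>P = 1 - (T - 1) r(T)\<close> takes values in the invariants of \<open>T\<close> (\<open>twist_splitting\<close>). By the homotopy
  formula \<open>P\<close> acts as the identity on homology and cohomology. Hence every homology class contains
  an invariant cycle, every cocycle \<open>F\<close> is cohomologous to an invariant one, and for an invariant
  cocycle \<open>F'\<close> the functional \<open>F' \<circ> B\<close> is a cocycle (\<open>bv_operator_closed\<close>).
\<close>

section \<open>Transport of BV-structures along isomorphisms\<close>

text \<open>
  Each element of \<open>T\<close> is the image of one of \<open>S\<close>, so each axiom of \<open>T\<close> is the image of the same axiom
  of \<open>S\<close>. The zeros are treated separately since \<open>bv_isomorphism\<close> does not mention them.
\<close>
lemma bv_algebra_transport:
  assumes iso: "bv_isomorphism \<phi> S T" and zero: "\<And>n. \<phi> n (gzero S n) = gzero T n"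
    and S: "bv_algebra S"
  shows "bv_algebra T"
proof -
  interpret S: bv_algebra S by fact
  have \<phi>_in: "\<phi> n x \<in> gr T n" if "x \<in> gr S n" for n x
    using iso that unfolding bv_isomorphism_def bij_betw_def by blast
  have ex: "\<exists>x\<in>gr S n. y = \<phi> n x" if "y \<in> gr T n" for n y
    using iso that unfolding bv_isomorphism_def bij_betw_def by blast
  have ad: "gadd T n (\<phi> n x) (\<phi> n y) = \<phi> n (gadd S n x y)"
    if "x \<in> gr S n" "y \<in> gr S n" for n x y
    using iso that unfolding bv_isomorphism_def by metis
  have sc: "gscale T n c (\<phi> n x) = \<phi> n (gscale S n c x)" if "x \<in> gr S n" for n c x
    using iso that unfolding bv_isomorphism_def by metis
  \<comment> \<open>The degree \<open>p\<close> is a variable of its own, because nested operations produce the same degree in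
    different arithmetic forms.\<close>
  have cp: "cup T n m (\<phi> n x) (\<phi> m y) = \<phi> p (cup S n m x y)"
    if "x \<in> gr S n" "y \<in> gr S m" "p = n + m" for n m p x y
    using iso that unfolding bv_isomorphism_def by metis
  have bk: "bracket T n m (\<phi> n x) (\<phi> m y) = \<phi> p (bracket S n m x y)"
    if "x \<in> gr S n" "y \<in> gr S m" "p = n + m - 1" for n m p x y
    using iso that unfolding bv_isomorphism_def by metis
  have op: "bvop T n (\<phi> n x) = \<phi> p (bvop S n x)" if "x \<in> gr S n" "p = n - 1" for n p x
    using iso that unfolding bv_isomorphism_def by metis
  have sg: "gsgn T n e (\<phi> n x) = \<phi> n (gsgn S n e x)" if "x \<in> gr S n" for n e x
    unfolding gsgn_def by (rule sc[OF that])
  have cpS: "cup S n m x y \<in> gr S p" if "x \<in> gr S n" "y \<in> gr S m" "p = n + m" for n m p x y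
    using S.cup_closed that by blast
  have bkS: "bracket S n m x y \<in> gr S p" if "x \<in> gr S n" "y \<in> gr S m" "p = n + m - 1" for n m p x y
    using S.bracket_closed that by blast
  have opS: "bvop S n x \<in> gr S p" if "x \<in> gr S n" "p = n - 1" for n p x
    using S.bvop_closed that by blast
  have sgS: "gsgn S n e x \<in> gr S n" if "x \<in> gr S n" for n e x
    unfolding gsgn_def by (rule S.scale_closed[OF that])
  note S_closed = S.zero_closed S.add_closed S.scale_closed S.cup_closed S.bracket_closed S.bvop_closed sgS
  note ops = zero[symmetric] ad sc sg
  show ?thesis
  proof (unfold_locales, goal_cases)
    case 1 show ?case using \<phi>_in[OF S.zero_closed] by (simp add: zero)
  next
    case (2 x n y) then show ?case by (auto dest!: ex simp: ops S_closed intro!: \<phi>_in)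
  next
    case (3 x n c) then show ?case by (auto dest!: ex simp: ops S_closed intro!: \<phi>_in)
  next
    case (4 x n y z) then show ?case by (auto dest!: ex simp: ops S_closed S.add_assoc)
  next
    case (5 x n y) then show ?case by (auto dest!: ex simp: ops S_closed) (metis S.add_commute)
  next
    case (6 x n) then show ?case by (auto dest!: ex simp: ops S_closed S.add_zero)
  next
    case (7 x n) then show ?case by (auto dest!: ex simp: ops S_closed S.add_neg)
  next
    case (8 x n y c) then show ?case by (auto dest!: ex simp: ops S_closed S.scale_add_right)
  next
    case (9 x n c d) then show ?case by (auto dest!: ex simp: ops S_closed S.scale_add_left)
  next
    case (10 x n c d) then show ?case by (auto dest!: ex simp: ops S_closed S.scale_scale)
  next
    case (11 x n) then show ?case by (auto dest!: ex simp: ops S_closed S.scale_one)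
  next
    case (12 f n g m) then show ?case by (auto dest!: ex simp: cp S_closed intro!: \<phi>_in)
  next
    case (13 f n f' g m) then show ?case by (auto dest!: ex simp: cp ops S_closed S.cup_add_left)
  next
    case (14 f n g m g') then show ?case by (auto dest!: ex simp: cp ops S_closed S.cup_add_right)
  next
    case (15 f n g m c) then show ?case by (auto dest!: ex simp: cp ops S_closed S.cup_scale_left)
  next
    case (16 f n g m c) then show ?case by (auto dest!: ex simp: cp ops S_closed S.cup_scale_right)
  next
    case (17 f n g m h l)
    then obtain x y z where x: "x \<in> gr S n" "f = \<phi> n x" and y: "y \<in> gr S m" "g = \<phi> m y"
      and z: "z \<in> gr S l" "h = \<phi> l z" using ex by metis
    have "cup T (n + m) l (\<phi> (n + m) (cup S n m x y)) (\<phi> l z) = \<phi> (n + m + l) (cup S (n + m) l (cup S n m x y) z)"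
      "cup T n (m + l) (\<phi> n x) (\<phi> (m + l) (cup S m l y z)) = \<phi> (n + m + l) (cup S n (m + l) x (cup S m l y z))"
      using x y z by (auto intro!: cp S.cup_closed)
    then show ?case using x y z by (simp add: cp S.cup_assoc)
  next
    case (18 f n g m)
    then obtain x y where x: "x \<in> gr S n" "f = \<phi> n x" and y: "y \<in> gr S m" "g = \<phi> m y"
      using ex by metis
    have "cup T m n (\<phi> m y) (\<phi> n x) = \<phi> (n + m) (cup S m n y x)"
      using x y by (intro cp) auto
    moreover have "cup S m n y x \<in> gr S (n + m)" using x y by (intro cpS) auto
    ultimately show ?case using x y S.cup_commute[OF x(1) y(1)] by (simp add: cp sg)
  next
    case (19 f n g m) then show ?case by (auto dest!: ex simp: bk S_closed intro!: \<phi>_in)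
  next
    case (20 f n f' g m) then show ?case by (auto dest!: ex simp: bk ops S_closed S.bracket_add_left)
  next
    case (21 f n g m g') then show ?case by (auto dest!: ex simp: bk ops S_closed S.bracket_add_right)
  next
    case (22 f n g m c) then show ?case by (auto dest!: ex simp: bk ops S_closed S.bracket_scale_left)
  next
    case (23 f n g m c) then show ?case by (auto dest!: ex simp: bk ops S_closed S.bracket_scale_right)
  next
    case (24 f n g m)
    then obtain x y where x: "x \<in> gr S n" "f = \<phi> n x" and y: "y \<in> gr S m" "g = \<phi> m y"
      using ex by metis
    have "bracket T m n (\<phi> m y) (\<phi> n x) = \<phi> (n + m - 1) (bracket S m n y x)"
      using x y by (intro bk) auto
    moreover have "bracket S m n y x \<in> gr S (n + m - 1)" using x y by (intro bkS) auto
    ultimately show ?case using x y S.bracket_antisym[OF x(1) y(1)] by (simp add: bk sg)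
  next
    case (25 f n g m h l)
    then obtain x y z where x: "x \<in> gr S n" "f = \<phi> n x" and y: "y \<in> gr S m" "g = \<phi> m y"
      and z: "z \<in> gr S l" "h = \<phi> l z" using ex by metis
    let ?p = "n + m + l - 2"
    have 1: "bracket T n (m + l - 1) (\<phi> n x) (\<phi> (m + l - 1) (bracket S m l y z)) = \<phi> ?p (bracket S n (m + l - 1) x (bracket S m l y z))"
      "bracket T (n + m - 1) l (\<phi> (n + m - 1) (bracket S n m x y)) (\<phi> l z) = \<phi> ?p (bracket S (n + m - 1) l (bracket S n m x y) z)"
      "bracket T m (n + l - 1) (\<phi> m y) (\<phi> (n + l - 1) (bracket S n l x z)) = \<phi> ?p (bracket S m (n + l - 1) y (bracket S n l x z))"
      using x y z by (auto intro!: bk S.bracket_closed)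
    have "bracket S (n + m - 1) l (bracket S n m x y) z \<in> gr S ?p" "bracket S m (n + l - 1) y (bracket S n l x z) \<in> gr S ?p"
      using x y z by (auto intro!: bkS S.bracket_closed)
    then show ?case using x y z 1 S.jacobi[OF x(1) y(1) z(1)] by (simp add: bk ops S_closed)
  next
    case (26 f n g m h l)
    then obtain x y z where x: "x \<in> gr S n" "f = \<phi> n x" and y: "y \<in> gr S m" "g = \<phi> m y"
      and z: "z \<in> gr S l" "h = \<phi> l z" using ex by metis
    let ?p = "n + m + l - 1"
    have 1: "bracket T n (m + l) (\<phi> n x) (\<phi> (m + l) (cup S m l y z)) = \<phi> ?p (bracket S n (m + l) x (cup S m l y z))"
      using x y z by (auto intro!: bk S.cup_closed)
    have 2: "cup T (n + m - 1) l (\<phi> (n + m - 1) (bracket S n m x y)) (\<phi> l z) = \<phi> ?p (cup S (n + m - 1) l (bracket S n m x y) z)"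
      "cup T m (n + l - 1) (\<phi> m y) (\<phi> (n + l - 1) (bracket S n l x z)) = \<phi> ?p (cup S m (n + l - 1) y (bracket S n l x z))"
      using x y z by (auto intro!: cp S.bracket_closed)
    have "cup S (n + m - 1) l (bracket S n m x y) z \<in> gr S ?p" "cup S m (n + l - 1) y (bracket S n l x z) \<in> gr S ?p"
      using x y z by (auto intro!: cpS S.bracket_closed)
    then show ?case using x y z 1 2 S.poisson[OF x(1) y(1) z(1)] by (simp add: bk cp ops S_closed)
  next
    case (27 f n) then show ?case by (auto dest!: ex simp: op S_closed intro!: \<phi>_in)
  next
    case (28 f n g) then show ?case by (auto dest!: ex simp: op ops S_closed S.bvop_add)
  next
    case (29 f n c) then show ?case by (auto dest!: ex simp: op ops S_closed S.bvop_scale)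
  next
    case (30 f n)
    then obtain x where x: "x \<in> gr S n" "f = \<phi> n x" using ex by metis
    have "bvop T (n - 1) (\<phi> (n - 1) (bvop S n x)) = \<phi> (n - 2) (bvop S (n - 1) (bvop S n x))"
      using x by (intro op S.bvop_closed) auto
    then show ?case using x S.bvop_square[OF x(1)] by (simp add: op zero)
  next
    case (31 f n g m)
    then obtain x y where x: "x \<in> gr S n" "f = \<phi> n x" and y: "y \<in> gr S m" "g = \<phi> m y"
      using ex by metis
    let ?p = "n + m - 1"
    have 1: "bvop T (n + m) (\<phi> (n + m) (cup S n m x y)) = \<phi> ?p (bvop S (n + m) (cup S n m x y))"
      using x y by (auto intro!: op S.cup_closed)
    have 2: "cup T (n - 1) m (\<phi> (n - 1) (bvop S n x)) (\<phi> m y) = \<phi> ?p (cup S (n - 1) m (bvop S n x) y)"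
      "cup T n (m - 1) (\<phi> n x) (\<phi> (m - 1) (bvop S m y)) = \<phi> ?p (cup S n (m - 1) x (bvop S m y))"
      using x y by (auto intro!: cp S.bvop_closed)
    have "bvop S (n + m) (cup S n m x y) \<in> gr S ?p"
      "cup S (n - 1) m (bvop S n x) y \<in> gr S ?p" "cup S n (m - 1) x (bvop S m y) \<in> gr S ?p"
      using x y by (auto intro!: cpS opS S.bvop_closed S.cup_closed)
    then show ?case using x y 1 2 S.bv_bracket[OF x(1) y(1)] by (simp add: bk cp op ops S_closed)
  qed
qed

text \<open>
  A \<open>bv_isomorphism\<close> relates the operations only on the carriers. If an operation of \<open>S\<close> led out of
  its carrier, the inverse bijection could not recover its value; this is why closure of \<open>S\<close> is
  required.
\<close>
lemma bv_isomorphism_inverse: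
  assumes iso: "bv_isomorphism \<phi> S T"
    and closed:
      "\<And>n x y. x \<in> gr S n \<Longrightarrow> y \<in> gr S n \<Longrightarrow> gadd S n x y \<in> gr S n"
      "\<And>n c x. x \<in> gr S n \<Longrightarrow> gscale S n c x \<in> gr S n"
      "\<And>n m x y. x \<in> gr S n \<Longrightarrow> y \<in> gr S m \<Longrightarrow> cup S n m x y \<in> gr S (n + m)"
      "\<And>n m x y. x \<in> gr S n \<Longrightarrow> y \<in> gr S m \<Longrightarrow> bracket S n m x y \<in> gr S (n + m - 1)"
      "\<And>n x. x \<in> gr S n \<Longrightarrow> bvop S n x \<in> gr S (n - 1)"
  shows "bv_isomorphism (\<lambda>n. inv_into (gr S n) (\<phi> n)) T S"
proof -
  let ?\<psi> = "\<lambda>n. inv_into (gr S n) (\<phi> n)"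
  have bij: "bij_betw (\<phi> n) (gr S n) (gr T n)" for n
    using iso by (simp add: bv_isomorphism_def)
  have ex: "\<exists>x\<in>gr S n. y = \<phi> n x" if "y \<in> gr T n" for n y
    using bij[of n] that unfolding bij_betw_def by blast
  have inv: "?\<psi> n (\<phi> n x) = x" if "x \<in> gr S n" for n x
    using bij[of n] that by (simp add: bij_betw_def)
  have "bij_betw (?\<psi> n) (gr T n) (gr S n)" for n
    by (rule bij_betw_inv_into[OF bij])
  moreover have "?\<psi> n (gadd T n x y) = gadd S n (?\<psi> n x) (?\<psi> n y)" if xy: "x \<in> gr T n" "y \<in> gr T n" for n x y
  proof -
    obtain x' y' where *: "x' \<in> gr S n" "y' \<in> gr S n" "x = \<phi> n x'" "y = \<phi> n y'" using ex xy by metis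
    then have "gadd T n x y = \<phi> n (gadd S n x' y')" using iso by (simp add: bv_isomorphism_def)
    then show ?thesis using * by (simp add: inv closed)
  qed
  moreover have "?\<psi> n (gscale T n c x) = gscale S n c (?\<psi> n x)" if xy: "x \<in> gr T n" for n x c
  proof -
    obtain x' where *: "x' \<in> gr S n" "x = \<phi> n x'" using ex xy by metis
    then have "gscale T n c x = \<phi> n (gscale S n c x')" using iso by (simp add: bv_isomorphism_def)
    then show ?thesis using * by (simp add: inv closed)
  qed
  moreover have "?\<psi> (n + m) (cup T n m x y) = cup S n m (?\<psi> n x) (?\<psi> m y)" if xy: "x \<in> gr T n" "y \<in> gr T m" for n m x y
  proof -
    obtain x' y' where *: "x' \<in> gr S n" "y' \<in> gr S m" "x = \<phi> n x'" "y = \<phi> m y'" using ex xy by metis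
    then have "cup T n m x y = \<phi> (n + m) (cup S n m x' y')" using iso by (simp add: bv_isomorphism_def)
    then show ?thesis using * by (simp add: inv closed)
  qed
  moreover have "?\<psi> (n + m - 1) (bracket T n m x y) = bracket S n m (?\<psi> n x) (?\<psi> m y)" if xy: "x \<in> gr T n" "y \<in> gr T m" for n m x y
  proof -
    obtain x' y' where *: "x' \<in> gr S n" "y' \<in> gr S m" "x = \<phi> n x'" "y = \<phi> m y'" using ex xy by metis
    then have "bracket T n m x y = \<phi> (n + m - 1) (bracket S n m x' y')" using iso by (simp add: bv_isomorphism_def)
    then show ?thesis using * by (simp add: inv closed)
  qed
  moreover have "?\<psi> (n - 1) (bvop T n x) = bvop S n (?\<psi> n x)" if xy: "x \<in> gr T n" for n x
  proof -
    obtain x' where *: "x' \<in> gr S n" "x = \<phi> n x'" using ex xy by metis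
    then have "bvop T n x = \<phi> (n - 1) (bvop S n x')" using iso by (simp add: bv_isomorphism_def)
    then show ?thesis using * by (simp add: inv closed)
  qed
  ultimately show ?thesis by (simp add: bv_isomorphism_def)
qed

lemma bv_algebra_iff_isomorphic:
  assumes iso: "bv_isomorphism \<phi> S T" and zero: "\<And>n. \<phi> n (gzero S n) = gzero T n"
    and closed:
      "\<And>n. gzero S n \<in> gr S n"
      "\<And>n x y. x \<in> gr S n \<Longrightarrow> y \<in> gr S n \<Longrightarrow> gadd S n x y \<in> gr S n"
      "\<And>n c x. x \<in> gr S n \<Longrightarrow> gscale S n c x \<in> gr S n"
      "\<And>n m x y. x \<in> gr S n \<Longrightarrow> y \<in> gr S m \<Longrightarrow> cup S n m x y \<in> gr S (n + m)"
      "\<And>n m x y. x \<in> gr S n \<Longrightarrow> y \<in> gr S m \<Longrightarrow> bracket S n m x y \<in> gr S (n + m - 1)"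
      "\<And>n x. x \<in> gr S n \<Longrightarrow> bvop S n x \<in> gr S (n - 1)"
  shows "bv_algebra S \<longleftrightarrow> bv_algebra T"
proof
  assume "bv_algebra S"
  then show "bv_algebra T" by (rule bv_algebra_transport[OF iso zero])
next
  assume T: "bv_algebra T"
  have "inv_into (gr S n) (\<phi> n) (gzero T n) = gzero S n" for n
    using iso closed(1)[of n] unfolding zero[symmetric] bv_isomorphism_def bij_betw_def by (simp add: inv_into_f_f)
  moreover have "bv_isomorphism (\<lambda>n. inv_into (gr S n) (\<phi> n)) T S"
    using iso closed(2-) by (rule bv_isomorphism_inverse)
  ultimately show "bv_algebra S"
    using bv_algebra_transport[OF _ _ T] by blast
qed

section \<open>Inserting a cochain into a function of lists\<close>

lemma sgnpow_simps [simp]: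
  "sgnpow e (0::'m::ab_group_add) = 0"
  "sgnpow 0 (x::'m::ab_group_add) = x"
  "sgnpow 1 (x::'m::ab_group_add) = - x"
  "sgnpow (- 1) (x::'m::ab_group_add) = - x"
  by (simp_all add: sgnpow_def)

lemma sgnpow_hom:
  assumes "\<And>x y. T (x + y) = T x + T y"
  shows "T (sgnpow e x) = sgnpow e (T (x::'m::ab_group_add) :: 'n::ab_group_add)"
proof -
  interpret additive T by (rule additive.intro) (rule assms)
  show ?thesis by (simp add: sgnpow_def minus)
qed

lemma sgnpow_mult [simp]:
  "sgnpow e a * b = sgnpow e (a * b)" "a * sgnpow e b = sgnpow e (a * (b::'a::ring))"
  by (simp_all add: sgnpow_def)

lemma sgnpow_add_right: "sgnpow e (a + b) = sgnpow e a + sgnpow e (b::'m::ab_group_add)"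
  and sgnpow_minus: "sgnpow e (- b) = - sgnpow e (b::'m::ab_group_add)"
  and sgnpow_diff: "sgnpow e (a - b) = sgnpow e a - sgnpow e (b::'m::ab_group_add)"
  by (simp_all add: sgnpow_def)

lemma sgnpow_sgnpow: "sgnpow d (sgnpow e x) = sgnpow (d + e) (x::'m::ab_group_add)"
  by (auto simp: sgnpow_def)

lemma sgnpow_cong_even: "even (d - e) \<Longrightarrow> sgnpow d x = sgnpow e (x::'m::ab_group_add)"
  by (auto simp: sgnpow_def)

lemma sgnpow_fun: "sgnpow e f x = sgnpow e (f x :: 'm::ab_group_add)"
  by (simp add: sgnpow_def)

lemma sgnpow_twice [simp]: "sgnpow e (sgnpow e x) = (x::'m::ab_group_add)"
  by (simp add: sgnpow_def)

text \<open>
  \<open>insertion m g \<Phi>\<close> is \<open>\<Phi> \<circ> g\<close> in Gerstenhaber's sense: the sum over all blocks of \<open>m\<close> consecutive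
  entries, with the block replaced by its value under \<open>g\<close> and the sign \<open>(-1)\<^bsup>i (m - 1)\<^esup>\<close> if \<open>i\<close>
  entries precede it (\<open>insertion_eq_sum\<close>). The recursion separates the block at the front from the
  others, which makes identities between iterated insertions provable by induction on the
  list, with \<open>\<Phi>\<close> varying.
\<close>
primrec insertion :: "nat \<Rightarrow> ('a list \<Rightarrow> 'a) \<Rightarrow> ('a list \<Rightarrow> 'm::ab_group_add) \<Rightarrow> 'a list \<Rightarrow> 'm" where
  "insertion m g \<Phi> [] = (if m = 0 then \<Phi> [g []] else 0)"
| "insertion m g \<Phi> (x # xs) =
     (if m \<le> length (x # xs) then \<Phi> (g (take m (x # xs)) # drop m (x # xs)) else 0)
     + sgnpow (int m - 1) (insertion m g (\<lambda>ys. \<Phi> (x # ys)) xs)"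

lemma insertion_hom:
  assumes T: "\<And>x y. T (x + y) = T x + T y"
  shows "insertion m g (\<lambda>ys. T (\<Phi> ys)) xs = T (insertion m g \<Phi> xs)"
proof -
  interpret additive T by (rule additive.intro) (rule T)
  show ?thesis
    by (induction xs arbitrary: \<Phi>) (auto simp: zero T sgnpow_hom[of T, OF T])
qed

lemma insertion_add: "insertion m g (\<lambda>ys. \<Phi> ys + \<Psi> ys) xs = insertion m g \<Phi> xs + insertion m g \<Psi> xs"
  by (induction xs arbitrary: \<Phi> \<Psi>) (auto simp: sgnpow_def)

lemma insertion_zero [simp]: "insertion m g (\<lambda>ys. 0) xs = 0"
  by (induction xs) auto

lemma insertion_minus: "insertion m g (\<lambda>ys. - \<Phi> ys) xs = - insertion m g \<Phi> xs"
  by (rule insertion_hom) simp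

lemma insertion_diff: "insertion m g (\<lambda>ys. \<Phi> ys - \<Psi> ys) xs = insertion m g \<Phi> xs - insertion m g \<Psi> xs"
  using insertion_add[of m g \<Phi> "\<lambda>ys. - \<Psi> ys" xs] by (simp add: insertion_minus)

lemma insertion_sgnpow: "insertion m g (\<lambda>ys. sgnpow e (\<Phi> ys)) xs = sgnpow e (insertion m g \<Phi> xs)"
  by (rule insertion_hom) (simp add: sgnpow_def)

lemma insertion_short: "length xs < m \<Longrightarrow> insertion m g \<Phi> xs = 0"
  by (induction xs arbitrary: \<Phi>) auto

lemma insertion_eq_sum:
  fixes \<Phi> :: "'a list \<Rightarrow> 'm::ab_group_add"
  shows
  "insertion m g \<Phi> xs = (\<Sum>i<length xs + 1 - m. sgnpow (int i * (int m - 1))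
      (\<Phi> (take i xs @ g (take m (drop i xs)) # drop (i + m) xs)))"
proof (induction xs arbitrary: \<Phi>)
  case Nil
  then show ?case by (cases m) auto
next
  case (Cons x xs)
  show ?case
  proof (cases "m \<le> length (x # xs)")
    case True
    have *: "sgnpow (int m - 1) (\<Sum>i\<in>A. h i :: 'm) = (\<Sum>i\<in>A. sgnpow (int m - 1) (h i))" for h A
      by (simp add: sgnpow_def sum_negf)
    have **: "sgnpow (int m - 1) (sgnpow (int i * (int m - 1)) y)
        = sgnpow (int (Suc i) * (int m - 1)) (y :: 'm)" for i y
      by (auto simp: sgnpow_def)
    have "length (x # xs) + 1 - m = Suc (length xs + 1 - m)"
      using True by simp
    then show ?thesis
      using True by (simp add: Cons.IH sum.lessThan_Suc_shift * ** del: sum.lessThan_Suc)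
  next
    case False
    then show ?thesis by (simp add: insertion_short)
  qed
qed

lemma insertion_length:
  assumes "\<And>ys. length ys \<noteq> n \<Longrightarrow> f ys = 0" and "length xs + 1 \<noteq> n + m"
  shows "insertion m g f xs = 0"
  unfolding insertion_eq_sum
proof (intro sum.neutral ballI)
  fix i assume "i \<in> {..<length xs + 1 - m}"
  then have "f (take i xs @ g (take m (drop i xs)) # drop (i + m) xs) = 0"
    using assms(2) by (intro assms(1)) auto
  then show "sgnpow (int i * (int m - 1)) (f (take i xs @ g (take m (drop i xs)) # drop (i + m) xs)) = 0"
    by simp
qed

text \<open>
  Insertion is a graded derivation for concatenation. If the first \<open>n\<close> entries are consumed by \<open>f\<close>
  and the rest by \<open>\<Psi>\<close>, the new block lies either in the part of \<open>f\<close> or in the part of \<open>\<Psi>\<close>. A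
  block that straddles the boundary does not occur, because the splitting takes place after the
  block has been replaced by a single entry. For \<open>\<Psi> a ys = a * h ys\<close> this is the derivation
  property for the cup product; \<open>\<Psi> a ys = \<Phi> (a # ys)\<close> occurs in \<open>insertion_merging_commute\<close>.
\<close>
lemma insertion_split:
  fixes \<Psi> :: "'b::ab_group_add \<Rightarrow> 'a list \<Rightarrow> 'm::ab_group_add"
  assumes supp: "\<And>ys. length ys \<noteq> n \<Longrightarrow> f ys = 0"
    and add: "\<And>a b ys. \<Psi> (a + b) ys = \<Psi> a ys + \<Psi> b ys"
  shows "insertion m g (\<lambda>ys. \<Psi> (f (take n ys)) (drop n ys)) xs =
     \<Psi> (insertion m g f (take (n + m - 1) xs)) (drop (n + m - 1) xs)
     + sgnpow (int n * (int m - 1)) (insertion m g (\<Psi> (f (take n xs))) (drop n xs))"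
  using supp
proof (induction xs arbitrary: n f)
  case Nil
  have z: "\<Psi> 0 ys = 0" for ys using add[of 0 0 ys] by simp
  show ?case using Nil[of "[g []]"] Nil[of "[]"] by (cases n) (auto simp: z)
next
  case (Cons x xs)
  have z: "\<Psi> 0 ys = 0" for ys using add[of 0 0 ys] by simp
  have sg: "\<Psi> (sgnpow e a) ys = sgnpow e (\<Psi> a ys)" for e a ys
    by (rule sgnpow_hom) (rule add)
  show ?case
  proof (cases n)
    case 0
    have "insertion m g f (take (m - 1) (x # xs)) = 0"
    proof (cases m)
      case 0
      with \<open>n = 0\<close> show ?thesis using Cons.prems[of "[g []]"] by simp
    next
      case (Suc l)
      then show ?thesis by (intro insertion_short) simp
    qed
    then show ?thesis using 0 by (simp add: z)
  next
    case (Suc k)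
    let ?fx = "\<lambda>ys. f (x # ys)"
    have supp': "\<And>ys. length ys \<noteq> k \<Longrightarrow> ?fx ys = 0"
      using Cons.prems Suc by simp
    have IH: "insertion m g (\<lambda>ys. \<Psi> (?fx (take k ys)) (drop k ys)) xs =
       \<Psi> (insertion m g ?fx (take (k + m - 1) xs)) (drop (k + m - 1) xs)
       + sgnpow (int k * (int m - 1)) (insertion m g (\<Psi> (?fx (take k xs))) (drop k xs))"
      by (rule Cons.IH[OF supp'])
    have ss: "sgnpow (int m - 1) (sgnpow (int k * (int m - 1)) y)
        = sgnpow (int (Suc k) * (int m - 1)) (y :: 'm)" for y
      by (auto simp: sgnpow_def)
    have sa: "sgnpow e (a + b) = sgnpow e a + sgnpow e (b :: 'm)" for e a b
      by (simp add: sgnpow_def)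
    show ?thesis
    proof (cases "k + m")
      case 0
      then show ?thesis using Suc supp'[of "[g []]"]
        by (simp add: IH[simplified] z add)
    next
      case (Suc p)
      have tk: "take m (take (k + m) (x # xs)) = take m (x # xs)"
        "drop m (take (k + m) (x # xs)) = take k (drop m (x # xs))"
        "drop k (drop m (x # xs)) = drop (k + m) (x # xs)"
        "m \<le> length (take (k + m) (x # xs)) \<longleftrightarrow> m \<le> length (x # xs)"
        by (auto simp: min_def add.commute drop_take)
      have 1: "take (k + m) (x # xs) = x # take (k + m - 1) xs" "drop (k + m) (x # xs) = drop (k + m - 1) xs"
        using Suc by simp_all
      have 2: "insertion m g f (take (k + m) (x # xs)) =
        (if m \<le> length (x # xs) then f (g (take m (x # xs)) # take k (drop m (x # xs))) else 0)
         + sgnpow (int m - 1) (insertion m g ?fx (take (k + m - 1) xs))"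
        using tk unfolding 1 by simp
      show ?thesis
        unfolding \<open>n = Suc k\<close> using 2 tk(3)
        by (simp add: IH ss sa sg add z 1(2) del: drop_drop)
    qed
  qed
qed

section \<open>The Hochschild differential in terms of insertions\<close>

definition mult2 :: "'a list \<Rightarrow> 'a::{ring,monoid_mult}" where
  "mult2 xs = (if length xs = 2 then hd xs * last xs else 0)"

abbreviation merging :: "('a list \<Rightarrow> 'm::ab_group_add) \<Rightarrow> 'a::{ring,monoid_mult} list \<Rightarrow> 'm" where
  "merging \<equiv> insertion 2 mult2"

lemma merging_simps [simp]:
  "merging \<Phi> [] = 0" "merging \<Phi> [x] = 0"
  "merging \<Phi> (x # y # ys) = \<Phi> (x * y # ys) - merging (\<lambda>zs. \<Phi> (x # zs)) (y # ys)"
  by (simp_all add: mult2_def)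

declare insertion.simps(2)[simp del]

text \<open>
  Two merges at distance at least two cancel in pairs, and two adjacent ones by associativity.
\<close>
lemma merging_merging:
  fixes \<Phi> :: "'a::{ring,monoid_mult} list \<Rightarrow> 'm::ab_group_add"
  shows "merging (merging \<Phi>) xs = 0"
proof (induction "length xs" arbitrary: xs \<Phi> rule: less_induct)
  case less
  show ?case
  proof (cases xs)
    case Nil then show ?thesis by simp
  next
    case (Cons x ys)
    show ?thesis
    proof (cases ys)
      case Nil then show ?thesis using Cons by simp
    next
      case C2: (Cons y zs)
      have *: "(\<lambda>ws. merging \<Phi> (x # ws)) = (\<lambda>ws. (case ws of [] \<Rightarrow> 0 | w # ws' \<Rightarrow> \<Phi> (x * w # ws'))
         - merging (\<lambda>us. \<Phi> (x # us)) ws)"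
        by (rule ext) (auto split: list.split)
      have "merging (merging (\<lambda>us. \<Phi> (x # us))) (y # zs) = 0"
        by (rule less) (simp add: Cons C2)
      then show ?thesis
        using Cons C2 by (cases zs) (auto simp: * insertion_diff mult.assoc)
    qed
  qed
qed

text \<open>
  The Hochschild differential with coefficients in the algebra itself (\<open>coboundary_regular\<close>), with
  its inner terms collected into one insertion of the multiplication.
\<close>
definition delta :: "('a list \<Rightarrow> 'a) \<Rightarrow> 'a list \<Rightarrow> 'a::{ring,monoid_mult}" where
  "delta f xs = (if xs = [] then 0
     else hd xs * f (tl xs) - merging f xs + sgnpow (int (length xs)) (f (butlast xs) * last xs))"

text \<open>
  The graded commutator of inserting \<open>g\<close> and merging neighbours. Terms in which the merged pair is
  disjoint from the block of \<open>g\<close> occur twice and cancel. Left over are the merges of the value of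
  \<open>g\<close> with the entry before or after it and the merges inside the block, and these are precisely
  the terms of \<open>delta g\<close>. The induction removes the first entry \<open>x\<close>; the facts \<open>c2\<close> to \<open>c7\<close> compute
  the contributions in which \<open>x\<close> is merged or belongs to the block.
\<close>
lemma insertion_merging_commute:
  fixes \<Phi> :: "'a::{ring,monoid_mult} list \<Rightarrow> 'm::ab_group_add"
  assumes supp: "\<And>ys. length ys \<noteq> m \<Longrightarrow> g ys = 0"
    and add: "\<And>us a b vs. \<Phi> (us @ (a + b) # vs) = \<Phi> (us @ a # vs) + \<Phi> (us @ b # vs)"
  shows "insertion m g (merging \<Phi>) xs - sgnpow (int m - 1) (merging (insertion m g \<Phi>) xs)
     = sgnpow (int m - 1) (insertion (Suc m) (delta g) \<Phi> xs)"
  using add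
proof (induction xs arbitrary: \<Phi>)
  case Nil
  then show ?case by (cases m) auto
next
  case (Cons x xs)
  let ?e = "sgnpow (int m - 1)"
  let ?P = "\<lambda>zs. \<Phi> (x # zs)"
  have ss: "sgnpow (int m - 1) (sgnpow (int m - 1) y) = (y :: 'm)" for y
    by (auto simp: sgnpow_def)
  have sa: "sgnpow e (a + b) = sgnpow e a + sgnpow e (b :: 'm)"
    "sgnpow e (a - b) = sgnpow e a - sgnpow e (b :: 'm)"
    "sgnpow e (- b) = - sgnpow e (b :: 'm)" for e a b
    by (simp_all add: sgnpow_def)
  have add1: "\<Phi> ((a + b) # vs) = \<Phi> (a # vs) + \<Phi> (b # vs)" for a b vs
    using Cons.prems[of "[]"] by simp
  have add0: "\<Phi> (0 # vs) = 0" for vs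
    using add1[of 0 0] by simp
  have addm: "\<Phi> ((- a) # vs) = - \<Phi> (a # vs)" for a vs
    using add1[of a "- a" vs] add0 by (simp add: eq_neg_iff_add_eq_0 add.commute)
  have addd: "\<Phi> ((a - b) # vs) = \<Phi> (a # vs) - \<Phi> (b # vs)" for a b vs
    using add1[of a "- b" vs] addm by simp
  have adds: "\<Phi> (sgnpow e a # vs) = sgnpow e (\<Phi> (a # vs))" for e a vs
    by (simp add: sgnpow_def addm)
  have IH: "insertion m g (merging ?P) xs - ?e (merging (insertion m g ?P) xs) = ?e (insertion (Suc m) (delta g) ?P xs)"
    by (rule Cons.IH) (use Cons.prems[of "x # us" for us] in simp)
  define v where "v = take m (x # xs)"
  define w where "w = drop m (x # xs)"
  let ?C = "\<lambda>ys. case ys of [] \<Rightarrow> 0 | y # ys' \<Rightarrow> \<Phi> (x * y # ys')"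
  have c1: "(\<lambda>ys. merging \<Phi> (x # ys)) = (\<lambda>ys. ?C ys - merging ?P ys)"
    by (rule ext) (auto split: list.split)
  have c2: "insertion m g ?C xs = (if m \<le> length xs then \<Phi> (x * g (take m xs) # drop m xs) else 0)
     + ?e (case xs of [] \<Rightarrow> 0 | y # ys \<Rightarrow> insertion m g (\<lambda>zs. \<Phi> (x * y # zs)) ys)"
    by (cases xs) (auto simp: insertion.simps(2))
  \<comment> \<open>\<open>?H\<close> is the term of \<open>insertion m g \<Phi>\<close> whose block begins with \<open>x\<close>, as a function of the rest.\<close>
  let ?H = "\<lambda>ys. if m \<le> Suc (length ys) then \<Phi> (g (take m (x # ys)) # drop m (x # ys)) else 0"
  have c3: "(\<lambda>ys. insertion m g \<Phi> (x # ys)) = (\<lambda>ys. ?H ys + ?e (insertion m g ?P ys))"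
    by (rule ext) (simp add: insertion.simps(2))
  have c4: "merging (insertion m g \<Phi>) (x # xs) =
     (case xs of [] \<Rightarrow> 0 | y # ys \<Rightarrow>
        (if m \<le> length xs then \<Phi> (g (take m (x * y # ys)) # drop m (x * y # ys)) else 0)
        + ?e (insertion m g (\<lambda>zs. \<Phi> (x * y # zs)) ys))
     - merging ?H xs - ?e (merging (insertion m g ?P) xs)"
    by (cases xs) (auto simp: c3 insertion_add insertion_sgnpow insertion.simps(2)[of m])
  have c5: "insertion m g (merging \<Phi>) (x # xs) =
     (if m \<le> Suc (length xs) then merging \<Phi> (g v # w) else 0)
     + ?e ((if m \<le> length xs then \<Phi> (x * g (take m xs) # drop m xs) else 0)
     + ?e (case xs of [] \<Rightarrow> 0 | y # ys \<Rightarrow> insertion m g (\<lambda>zs. \<Phi> (x * y # zs)) ys)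
     - insertion m g (merging ?P) xs)"
    by (simp add: insertion.simps(2)[of m] c1 insertion_diff c2 v_def w_def)
  have c6: "merging ?H xs = (if m \<le> length xs then
        (case xs of [] \<Rightarrow> 0 | y # ys \<Rightarrow> \<Phi> (g (take m (x * y # ys)) # drop m (x * y # ys)))
        - \<Phi> (merging g (take (Suc m) (x # xs)) # drop m xs) else 0)
     + ?e (if m \<le> Suc (length xs) then merging (\<lambda>zs. \<Phi> (g v # zs)) w else 0)"
  proof (cases m)
    case 0
    then show ?thesis
      by (cases xs) (auto simp: v_def w_def add0)
  next
    case (Suc l)
    have H: "?H = (\<lambda>ys. \<Phi> (g (x # take l ys) # drop l ys))"
      using supp Suc by (auto simp: add0)
    have "merging ?H xs = \<Phi> (merging (\<lambda>ys. g (x # ys)) (take (Suc l) xs) # drop (Suc l) xs)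
       + sgnpow (int l) (merging (\<lambda>zs. \<Phi> (g (x # take l xs) # zs)) (drop l xs))"
      unfolding H
      using insertion_split[of l "\<lambda>ys. g (x # ys)" "\<lambda>a zs. \<Phi> (a # zs)" 2 mult2 xs] supp Suc
      by (simp add: add1)
    moreover have "merging g (take (Suc m) (x # xs)) = (case xs of [] \<Rightarrow> 0 | y # ys \<Rightarrow> g (take m (x * y # ys)))
       - merging (\<lambda>ys. g (x # ys)) (take m xs)"
      using Suc by (cases xs) auto
    moreover have "merging (\<lambda>ys. g (x # ys)) (take m xs) = 0" if "\<not> m \<le> length xs"
      using that Suc supp by (intro insertion_length[of l]) auto
    moreover have "\<Phi> (g (x # take l xs) # zs) = 0" if "\<not> m \<le> Suc (length xs)" for zs
      using supp Suc that by (simp add: add0)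
    ultimately show ?thesis
      using Suc by (cases xs) (auto simp: v_def w_def addd add0)
  qed
  have c7: "insertion (Suc m) (delta g) \<Phi> (x # xs) =
     (if m \<le> length xs then \<Phi> (x * g (take m xs) # drop m xs)
         - \<Phi> (merging g (take (Suc m) (x # xs)) # drop m xs)
         + ?e (\<Phi> (g v * hd w # tl w)) else 0)
     - ?e (insertion (Suc m) (delta g) ?P xs)"
  proof -
    have "delta g (take (Suc m) (x # xs)) = x * g (take m xs) - merging g (take (Suc m) (x # xs)) + ?e (g v * hd w)"
      if "m \<le> length xs"
    proof -
      have "take (Suc m) (x # xs) = v @ [hd w]"
        using that by (simp only: v_def w_def) (simp add: take_hd_drop del: take_Suc_Cons)
      moreover have "length v = m" using that by (simp add: v_def)
      ultimately have T: "butlast (take (Suc m) (x # xs)) = v" "last (take (Suc m) (x # xs)) = hd w"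
        "length (take (Suc m) (x # xs)) = Suc m"
        by simp_all
      have T': "hd (take (Suc m) (x # xs)) = x" "tl (take (Suc m) (x # xs)) = take m xs"
        "take (Suc m) (x # xs) \<noteq> []"
        by simp_all
      show ?thesis
        unfolding delta_def T T'(1,2) using T'(3) by (auto simp: sgnpow_def)
    qed
    moreover have "tl w = drop m xs" if "m \<le> length xs"
      using that by (cases m) (auto simp: w_def tl_drop drop_Suc)
    ultimately show ?thesis
      by (auto simp: insertion.simps(2)[of "Suc m"] add1 addd adds sgnpow_def[of "int m"] sgnpow_def[of "int m - 1"])
  qed
  have c8: "merging \<Phi> (g v # w) = (if w = [] then 0 else \<Phi> (g v * hd w # tl w)) - merging (\<lambda>zs. \<Phi> (g v # zs)) w"
    by (cases w) auto
  have c9: "w = [] \<longleftrightarrow> \<not> m \<le> length xs" by (auto simp: w_def)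
  show ?case
    using IH c9 unfolding c4 c5 c6 c7 c8
    by (cases xs) (auto simp: sa ss algebra_simps)
qed

text \<open>
  The two outer terms of the Hochschild differential. With the inner terms they make up \<open>delta\<close>
  (\<open>delta_eq\<close>), and each of them is a cup product with the identity cochain, so that insertions
  interact with them through the derivation property.
\<close>
definition left_end :: "('a list \<Rightarrow> 'a) \<Rightarrow> 'a list \<Rightarrow> 'a::{ring,monoid_mult}" where
  "left_end f xs = (if xs = [] then 0 else hd xs * f (tl xs))"

definition right_end :: "('a list \<Rightarrow> 'a) \<Rightarrow> 'a list \<Rightarrow> 'a::{ring,monoid_mult}" where
  "right_end f xs = (if xs = [] then 0 else sgnpow (int (length xs)) (f (butlast xs) * last xs))"

definition juxt :: "nat \<Rightarrow> ('a list \<Rightarrow> 'a) \<Rightarrow> ('a list \<Rightarrow> 'a) \<Rightarrow> 'a list \<Rightarrow> 'a::{ring,monoid_mult}" where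
  "juxt n f h xs = f (take n xs) * h (drop n xs)"

lemma delta_eq: "delta f xs = left_end f xs - merging f xs + right_end f xs"
  by (simp add: delta_def left_end_def right_end_def)

lemma insertion_left_end:
  assumes "\<And>ys. length ys \<noteq> m \<Longrightarrow> g ys = 0"
  shows "insertion m g (left_end f) xs = juxt m g f xs + sgnpow (int m - 1) (left_end (insertion m g f) xs)"
proof (cases xs)
  case Nil
  then show ?thesis using assms[of "[]"] by (cases m) (auto simp: juxt_def left_end_def)
next
  case (Cons x ys)
  have "insertion m g (\<lambda>zs. x * f zs) ys = x * insertion m g f ys"
    by (rule insertion_hom) (simp add: distrib_left)
  then show ?thesis using assms[of "take m xs"] Cons
    by (auto simp: juxt_def left_end_def insertion.simps(2))
qed

lemma insertion_const_mult:
  fixes a :: "'a::{ring,monoid_mult}"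
  assumes "\<And>ys. length ys \<noteq> m \<Longrightarrow> g ys = 0"
  shows "insertion m g (\<lambda>ys. if length ys = 1 then a * hd ys else 0) zs = a * g zs"
proof (cases zs)
  case Nil
  then show ?thesis using assms[of "[]"] by (cases m) auto
next
  case (Cons z ws)
  have "insertion m g (\<lambda>ys. if length (z # ys) = 1 then a * hd (z # ys) else 0) ws = 0"
    by (simp add: insertion_eq_sum)
  then show ?thesis using Cons assms[of zs]
    by (auto simp: insertion.simps(2))
qed

lemma right_end_eq:
  assumes "\<And>ys. length ys \<noteq> n \<Longrightarrow> f ys = 0"
  shows "right_end f ys = sgnpow (int n + 1)
     (if length (drop n ys) = 1 then f (take n ys) * hd (drop n ys) else 0)"
proof (cases "length ys = Suc n")
  case True
  then have "butlast ys = take n ys" "last ys = hd (drop n ys)" "ys \<noteq> []"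
    by (auto simp: butlast_conv_take last_conv_nth hd_drop_conv_nth simp flip: length_greater_0_conv)
  then show ?thesis using True by (simp add: right_end_def algebra_simps)
next
  case False
  then have "ys = [] \<or> f (butlast ys) = 0"
    using assms[of "butlast ys"] by (cases ys) auto
  then show ?thesis using False by (auto simp: right_end_def)
qed

lemma insertion_right_end:
  assumes f: "\<And>ys. length ys \<noteq> n \<Longrightarrow> f ys = 0" and g: "\<And>ys. length ys \<noteq> m \<Longrightarrow> g ys = 0"
  shows "insertion m g (right_end f) xs = sgnpow (int m - 1) (right_end (insertion m g f) xs)
     + sgnpow (int n * int m + 1) (juxt n f g xs)"
proof -
  let ?\<Psi> = "\<lambda>a ys. if length ys = 1 then a * hd ys else (0::'a)"
  have "right_end f = (\<lambda>ys. sgnpow (int n + 1) (?\<Psi> (f (take n ys)) (drop n ys)))"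
    by (rule ext) (rule right_end_eq[OF f])
  then have "insertion m g (right_end f) xs = sgnpow (int n + 1) (insertion m g (\<lambda>ys. ?\<Psi> (f (take n ys)) (drop n ys)) xs)"
    by (simp only: insertion_sgnpow)
  also have "insertion m g (\<lambda>ys. ?\<Psi> (f (take n ys)) (drop n ys)) xs =
     ?\<Psi> (insertion m g f (take (n + m - 1) xs)) (drop (n + m - 1) xs)
     + sgnpow (int n * (int m - 1)) (insertion m g (?\<Psi> (f (take n xs))) (drop n xs))"
    by (rule insertion_split) (auto simp: f distrib_right)
  also have "insertion m g (?\<Psi> (f (take n xs))) (drop n xs) = juxt n f g xs"
    unfolding juxt_def by (rule insertion_const_mult) (rule g)
  also have "sgnpow (int n + 1) (?\<Psi> (insertion m g f (take (n + m - 1) xs)) (drop (n + m - 1) xs))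
      = sgnpow (int m - 1) (right_end (insertion m g f) xs)"
  proof (cases "n + m = 0")
    case True
    then have "insertion m g f ys = 0" for ys
      using f by (intro insertion_length[of n]) auto
    then show ?thesis by (simp add: right_end_def)
  next
    case False
    have "right_end (insertion m g f) xs = sgnpow (int (n + m - 1) + 1) (?\<Psi> (insertion m g f (take (n + m - 1) xs)) (drop (n + m - 1) xs))"
      using False by (intro right_end_eq insertion_length[of n f] f) auto
    moreover have "sgnpow (int n + 1) y = sgnpow (int m - 1 + (int (n + m - 1) + 1)) y" for y :: 'a
      using False by (intro sgnpow_cong_even) auto
    ultimately show ?thesis by (simp add: sgnpow_sgnpow)
  qed
  moreover have "sgnpow (int n + 1 + int n * (int m - 1)) y = sgnpow (int n * int m + 1) y" for y :: 'a
    by (intro sgnpow_cong_even) (auto simp: algebra_simps)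
  ultimately show ?thesis
    by (simp only: sgnpow_add_right sgnpow_sgnpow)
qed

text \<open>
  Gerstenhaber's formula. Inserting \<open>g\<close> into the outer terms of \<open>delta f\<close> reproduces the outer terms
  of \<open>delta (f \<circ> g)\<close> and one cup product for each end; inserting it into the inner terms is
  governed by \<open>insertion_merging_commute\<close>.
\<close>
lemma insertion_delta:
  assumes f: "\<And>ys. length ys \<noteq> n \<Longrightarrow> f ys = 0" and g: "\<And>ys. length ys \<noteq> m \<Longrightarrow> g ys = 0"
    and add: "\<And>us a b vs. f (us @ (a + b) # vs) = f (us @ a # vs) + f (us @ b # vs)"
  shows "insertion m g (delta f) xs + sgnpow (int m - 1) (insertion (Suc m) (delta g) f xs)
     = sgnpow (int m - 1) (delta (insertion m g f) xs) + juxt m g f xs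
       - sgnpow (int n * int m) (juxt n f g xs)"
proof -
  have "insertion m g (delta f) xs = insertion m g (left_end f) xs - insertion m g (merging f) xs + insertion m g (right_end f) xs"
    unfolding delta_eq[abs_def] by (simp only: insertion_add insertion_diff)
  also have "insertion m g (merging f) xs = sgnpow (int m - 1) (merging (insertion m g f) xs)
     + sgnpow (int m - 1) (insertion (Suc m) (delta g) f xs)"
    using insertion_merging_commute[of m g f xs, OF g add] by (simp add: algebra_simps)
  finally show ?thesis
    using insertion_left_end[of m g f xs, OF g] insertion_right_end[of n f m g xs, OF f g] unfolding delta_eq[of "insertion m g f"]
    by (simp add: sgnpow_add_right sgnpow_diff) (simp add: sgnpow_def)
qed

lemma delta_length:
  assumes "\<And>ys. length ys \<noteq> n \<Longrightarrow> f ys = 0" "length xs \<noteq> Suc n"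
  shows "delta f xs = 0"
  using assms(1)[of "tl xs"] assms(1)[of "butlast xs"] assms(2) insertion_length[of n f xs 2 mult2, OF assms(1)]
  by (cases xs) (auto simp: delta_def)

lemma delta_mult2: "delta mult2 xs = 0"
proof (cases "length xs = 3")
  case True
  then obtain x y z where "xs = [x, y, z]"
    by (auto simp: numeral_eq_Suc length_Suc_conv)
  then show ?thesis by (simp add: delta_def mult2_def sgnpow_def mult.assoc)
next
  case False
  then show ?thesis by (intro delta_length[of 2]) (auto simp: mult2_def)
qed

text \<open>
  Gerstenhaber's formula for \<open>g = mult2\<close>, which is a cocycle by associativity, moves the merging operator past the
  differential; the outer terms then cancel against each other.
\<close>
lemma delta_delta:
  assumes f: "\<And>ys. length ys \<noteq> n \<Longrightarrow> f ys = 0"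
    and add: "\<And>us a b vs. f (us @ (a + b) # vs) = f (us @ a # vs) + f (us @ b # vs)"
  shows "delta (delta f) xs = 0"
proof -
  have f0: "f (us @ 0 # vs) = 0" for us vs using add[of us 0 0 vs] by simp
  have z: "insertion (Suc 2) (delta mult2) f xs = 0"
    by (simp add: insertion_eq_sum delta_mult2 f0)
  have 1: "merging (delta f) xs = - delta (merging f) xs + juxt 2 mult2 f xs - juxt n f mult2 xs"
    using insertion_delta[of n f 2 mult2 xs, OF f _ add] z by (simp add: mult2_def sgnpow_def)
  have 2: "left_end (left_end f) xs = juxt 2 mult2 f xs"
  proof (cases "length xs \<ge> 2")
    case True
    then obtain x y zs where "xs = x # y # zs"
      by (cases xs; cases "tl xs") auto
    then show ?thesis by (simp add: left_end_def juxt_def mult2_def mult.assoc)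
  next
    case False
    then show ?thesis by (cases xs; cases "tl xs") (auto simp: left_end_def juxt_def mult2_def)
  qed
  have 3: "right_end (right_end f) xs = - juxt n f mult2 xs"
  proof (cases "length xs = n + 2")
    case True
    have ne: "xs \<noteq> []" "butlast xs \<noteq> []" using True by (auto simp flip: length_greater_0_conv)
    have d: "drop n xs = [last (butlast xs), last xs]"
      using True ne by (intro nth_equalityI) (auto simp: last_conv_nth nth_butlast nth_Cons less_2_cases_iff split: nat.split)
    have "butlast (butlast xs) = take n xs"
      using True by (simp add: butlast_conv_take)
    then show ?thesis
      using ne True by (simp add: right_end_def juxt_def mult2_def d mult.assoc) (simp add: sgnpow_def)
  next
    case False
    have "f (butlast (butlast xs)) = 0 \<or> xs = [] \<or> butlast xs = []"
      using False f[of "butlast (butlast xs)"] by (cases xs rule: rev_cases; cases "butlast xs" rule: rev_cases) (auto simp: butlast_append)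
    then show ?thesis
      using False f[of "take n xs"] by (auto simp: right_end_def juxt_def mult2_def)
  qed
  have 4: "left_end (right_end f) xs + right_end (left_end f) xs = 0"
    by (cases xs; cases "tl xs" rule: rev_cases) (auto simp: left_end_def right_end_def sgnpow_def mult.assoc)
  have l: "left_end (delta f) xs = left_end (left_end f) xs - left_end (merging f) xs + left_end (right_end f) xs"
    by (simp add: left_end_def[where xs = xs] delta_eq[of f] algebra_simps)
  have r: "right_end (delta f) xs = right_end (left_end f) xs - right_end (merging f) xs + right_end (right_end f) xs"
    by (simp add: right_end_def[where xs = xs] delta_eq[of f] algebra_simps sgnpow_def)
  show ?thesis
    unfolding delta_eq[of "delta f"] 1 l r delta_eq[of "merging f"] merging_merging 2 3
    using 4 by (simp add: algebra_simps)
qed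

lemma delta_juxt:
  assumes f: "\<And>ys. length ys \<noteq> n \<Longrightarrow> f ys = 0"
  shows "delta (juxt n f h) xs = juxt (Suc n) (delta f) h xs + sgnpow (int n) (juxt n f (delta h) xs)"
proof -
  have 1: "merging (juxt n f h) xs = juxt (Suc n) (merging f) h xs + sgnpow (int n) (juxt n f (merging h) xs)"
  proof -
    have "merging (\<lambda>ys. f (take n ys) * h (drop n ys)) xs
        = merging f (take (n + 2 - 1) xs) * h (drop (n + 2 - 1) xs)
          + sgnpow (int n * (int 2 - 1)) (merging (\<lambda>ys. f (take n xs) * h ys) (drop n xs))"
      by (rule insertion_split[of n f "\<lambda>a ys. a * h ys"]) (auto simp: f distrib_right)
    moreover have "merging (\<lambda>ys. f (take n xs) * h ys) (drop n xs) = f (take n xs) * merging h (drop n xs)"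
      by (rule insertion_hom) (simp add: distrib_left)
    ultimately show ?thesis by (simp add: juxt_def[abs_def])
  qed
  have 2: "left_end (juxt n f h) xs = juxt (Suc n) (left_end f) h xs"
    by (cases xs) (auto simp: left_end_def juxt_def mult.assoc)
  have 3: "right_end (juxt n f h) xs = sgnpow (int n) (juxt n f (right_end h) xs)"
  proof (cases "length xs > n")
    case True
    then have "drop n xs \<noteq> []" "xs \<noteq> []" "take n (butlast xs) = take n xs" "drop n (butlast xs) = butlast (drop n xs)"
      by (auto simp: butlast_conv_take min_def drop_take)
    then show ?thesis using True
      by (simp add: right_end_def juxt_def mult.assoc sgnpow_sgnpow of_nat_diff)
  next
    case False
    then have "xs = [] \<or> f (take n (butlast xs)) = 0"
      by (cases xs) (auto intro!: f)
    then show ?thesis using False by (auto simp: right_end_def juxt_def)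
  qed
  have 4: "juxt (Suc n) (right_end f) h xs + sgnpow (int n) (juxt n f (left_end h) xs) = 0"
  proof (cases "length xs > n")
    case True
    then have "take (Suc n) xs \<noteq> []" "butlast (take (Suc n) xs) = take n xs" "last (take (Suc n) xs) = hd (drop n xs)"
        "drop (Suc n) xs = tl (drop n xs)" "drop n xs \<noteq> []"
      by (auto simp: butlast_take take_hd_drop[symmetric] drop_Suc tl_drop)
    then show ?thesis using True
      by (simp add: right_end_def juxt_def left_end_def mult.assoc) (simp add: sgnpow_def min_def)
  next
    case False
    then have "xs = [] \<or> f (butlast xs) = 0"
      by (cases xs) (auto intro!: f)
    then show ?thesis using False by (auto simp: right_end_def juxt_def left_end_def)
  qed
  have "juxt (Suc n) (delta f) h xs = juxt (Suc n) (left_end f) h xs - juxt (Suc n) (merging f) h xs + juxt (Suc n) (right_end f) h xs"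
    "juxt n f (delta h) xs = juxt n f (left_end h) xs - juxt n f (merging h) xs + juxt n f (right_end h) xs"
    by (simp_all add: juxt_def delta_eq algebra_simps)
  then show ?thesis
    using 1 2 3 4 unfolding delta_eq[of "juxt n f h"]
    by (simp add: sgnpow_def split: if_splits)
qed

section \<open>Multilinear functions of lists\<close>

context k_algebra
begin

text \<open>
  Additivity and homogeneity are combined in one equation, so that closure under each construction
  takes a single induction or case analysis.
\<close>
definition multilinear :: "('k \<Rightarrow> 'm \<Rightarrow> 'm) \<Rightarrow> ('a list \<Rightarrow> 'm::ab_group_add) \<Rightarrow> bool" where
  "multilinear sc f \<longleftrightarrow>
    (\<forall>us vs c a b. f (us @ (scale c a + b) # vs) = sc c (f (us @ a # vs)) + f (us @ b # vs))"

lemma multilinearD: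
  "multilinear sc f \<Longrightarrow> f (us @ (scale c a + b) # vs) = sc c (f (us @ a # vs)) + f (us @ b # vs)"
  by (simp add: multilinear_def)

lemma multilinear_Cons: "multilinear sc f \<Longrightarrow> multilinear sc (\<lambda>ys. f (x # ys))"
  unfolding multilinear_def by (metis append_Cons)

lemma multilinear_iff:
  assumes "vector_space sc"
  shows "multilinear sc f \<longleftrightarrow>
    (\<forall>us vs a b. f (us @ (a + b) # vs) = f (us @ a # vs) + f (us @ b # vs)) \<and>
    (\<forall>us vs c a. f (us @ scale c a # vs) = sc c (f (us @ a # vs)))"
proof -
  interpret M: vector_space sc by fact
  show ?thesis
  proof (intro iffI conjI allI)
    fix us vs a b assume "multilinear sc f"
    from multilinearD[OF this, of us 1 a b vs]
    show "f (us @ (a + b) # vs) = f (us @ a # vs) + f (us @ b # vs)" by simp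
  next
    fix us vs c a assume ml: "multilinear sc f"
    have "f (us @ 0 # vs) = 0"
      using multilinearD[OF ml, of us 1 0 0 vs] by simp
    then show "f (us @ scale c a # vs) = sc c (f (us @ a # vs))"
      using multilinearD[OF ml, of us c a 0 vs] by simp
  qed (simp add: multilinear_def)
qed

lemma multilinear_add:
  "vector_space sc \<Longrightarrow> multilinear sc f \<Longrightarrow> f (us @ (a + b) # vs) = f (us @ a # vs) + f (us @ b # vs)"
  by (simp add: multilinear_iff)

lemma multilinear_insertion:
  assumes f: "multilinear scale f" and g: "multilinear scale g"
  shows "multilinear scale (insertion m g f)"
  unfolding multilinear_def
proof (intro allI)
  fix us vs c a b
  show "insertion m g f (us @ (scale c a + b) # vs) = scale c (insertion m g f (us @ a # vs)) + insertion m g f (us @ b # vs)"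
    using f
  proof (induction us arbitrary: f)
    case Nil
    have "(\<lambda>ys. f ((scale c a + b) # ys)) = (\<lambda>ys. scale c (f (a # ys)) + f (b # ys))"
      using multilinearD[OF Nil, of "[]"] by auto
    then have 1: "insertion m g (\<lambda>ys. f ((scale c a + b) # ys)) vs =
        scale c (insertion m g (\<lambda>ys. f (a # ys)) vs) + insertion m g (\<lambda>ys. f (b # ys)) vs"
      by (simp add: insertion_add insertion_hom[of "scale c"] scale_right_distrib)
    show ?case
    proof (cases m)
      case 0
      then show ?thesis using 1 multilinearD[OF Nil, of "[g []]"]
        by (simp add: insertion.simps(2) scale_right_distrib scale_right_diff_distrib)
    next
      case (Suc l)
      have "f (g ((scale c a + b) # ws) # zs) = scale c (f (g (a # ws) # zs)) + f (g (b # ws) # zs)" for ws zs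
        using multilinearD[OF g, of "[]"] multilinearD[OF Nil, of "[]"] by simp
      then show ?thesis using 1 Suc
        by (auto simp: insertion.simps(2) scale_right_distrib sgnpow_def)
    qed
  next
    case (Cons u us)
    have IH: "insertion m g (\<lambda>ys. f (u # ys)) (us @ (scale c a + b) # vs)
        = scale c (insertion m g (\<lambda>ys. f (u # ys)) (us @ a # vs)) + insertion m g (\<lambda>ys. f (u # ys)) (us @ b # vs)"
      by (rule Cons.IH) (rule multilinear_Cons[OF Cons.prems])
    have H: "f (g (take m (u # us @ (scale c a + b) # vs)) # drop m (u # us @ (scale c a + b) # vs))
      = scale c (f (g (take m (u # us @ a # vs)) # drop m (u # us @ a # vs)))
        + f (g (take m (u # us @ b # vs)) # drop m (u # us @ b # vs))"
    proof (cases "m \<le> length (u # us)")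
      case True
      have "take m (u # us @ z # vs) = take m (u # us)" "drop m (u # us @ z # vs) = drop m (u # us) @ z # vs" for z
        using True take_append[of m "u # us" "z # vs"] drop_append[of m "u # us" "z # vs"] by simp_all
      then show ?thesis
        using multilinearD[OF Cons.prems, of "g (take m (u # us)) # drop m (u # us)"] by simp
    next
      case False
      then obtain l where l: "m = length (u # us) + Suc l"
        by (metis add_Suc_right less_iff_Suc_add not_le)
      have "take m (u # us @ z # vs) = (u # us) @ z # take l vs" "drop m (u # us @ z # vs) = drop l vs" for z
        using l take_append[of m "u # us" "z # vs"] drop_append[of m "u # us" "z # vs"] by simp_all
      then show ?thesis
        using multilinearD[OF g, of "u # us"] multilinearD[OF Cons.prems, of "[]"] by simp
    qed
    show ?case
      using IH H by (simp add: insertion.simps(2) scale_right_distrib sgnpow_def)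
  qed
qed

lemma multilinear_mult2: "multilinear scale mult2"
  unfolding multilinear_def
proof (intro allI)
  fix us vs :: "'a list" and c a b
  consider "us = []" "length vs = 1" | "length us = 1" "vs = []" | "length us + length vs \<noteq> 1"
    by (cases us; cases vs) auto
  then show "mult2 (us @ (scale c a + b) # vs) = scale c (mult2 (us @ a # vs)) + mult2 (us @ b # vs)"
    by cases (auto simp: mult2_def scale_mult_left scale_mult_right distrib_left distrib_right length_Suc_conv)
qed

lemma multilinear_juxt:
  assumes f: "multilinear scale f" and g: "multilinear scale g"
  shows "multilinear scale (juxt n f g)"
  unfolding multilinear_def
proof (intro allI)
  fix us vs c a b
  show "juxt n f g (us @ (scale c a + b) # vs) = scale c (juxt n f g (us @ a # vs)) + juxt n f g (us @ b # vs)"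
  proof (cases "n \<le> length us")
    case True
    then show ?thesis using multilinearD[OF g, of "drop n us"]
      by (simp add: juxt_def distrib_left scale_mult_right)
  next
    case False
    then obtain l where l: "n = length us + Suc l"
      by (metis add_Suc_right less_iff_Suc_add not_le)
    then show ?thesis using multilinearD[OF f, of us]
      by (simp add: juxt_def distrib_right scale_mult_left)
  qed
qed

lemma multilinear_left_end: "multilinear scale f \<Longrightarrow> multilinear scale (left_end f)"
  unfolding multilinear_def
proof (intro allI)
  fix us vs c a b assume f: "\<forall>us vs c a b. f (us @ (scale c a + b) # vs) = scale c (f (us @ a # vs)) + f (us @ b # vs)"
  show "left_end f (us @ (scale c a + b) # vs) = scale c (left_end f (us @ a # vs)) + left_end f (us @ b # vs)"
    using f by (cases us) (simp_all add: left_end_def distrib_left distrib_right scale_mult_left scale_mult_right)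
qed

lemma multilinear_right_end: "multilinear scale f \<Longrightarrow> multilinear scale (right_end f)"
  unfolding multilinear_def
proof (intro allI)
  fix us vs c a b assume f: "\<forall>us vs c a b. f (us @ (scale c a + b) # vs) = scale c (f (us @ a # vs)) + f (us @ b # vs)"
  show "right_end f (us @ (scale c a + b) # vs) = scale c (right_end f (us @ a # vs)) + right_end f (us @ b # vs)"
    using f by (cases vs rule: rev_cases)
      (simp_all add: right_end_def butlast_append distrib_left distrib_right scale_mult_left scale_mult_right
        scale_right_distrib sgnpow_def)
qed

lemma multilinear_delta: "multilinear scale f \<Longrightarrow> multilinear scale (delta f)"
  using multilinear_left_end[of f] multilinear_right_end[of f] multilinear_insertion[OF _ multilinear_mult2, of f 2]
  unfolding multilinear_def delta_eq by (simp add: scale_right_distrib scale_right_diff_distrib algebra_simps)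

end

section \<open>Cup product and bracket on Hochschild cohomology\<close>

context frobenius_algebra
begin
abbreviation C :: "int \<Rightarrow> ('a list \<Rightarrow> 'a) set" where "C \<equiv> cochains regular"

lemma C_iff: "f \<in> C n \<longleftrightarrow> (\<forall>xs. int (length xs) \<noteq> n \<longrightarrow> f xs = 0) \<and> multilinear scale f"
  unfolding cochains_def multilinear_iff[OF vector_space_axioms] by (auto simp: regular_def)

lemma C_length: "f \<in> C n \<Longrightarrow> int (length xs) \<noteq> n \<Longrightarrow> f xs = 0"
  by (simp add: C_iff)

lemma C_add_slot: "f \<in> C n \<Longrightarrow> f (us @ (a + b) # vs) = f (us @ a # vs) + f (us @ b # vs)"
  by (simp add: C_iff multilinear_add[OF vector_space_axioms])

lemma C_neg: "f \<in> C n \<Longrightarrow> n < 0 \<Longrightarrow> f = 0"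
  by (rule ext) (simp add: C_iff)

lemma C_zero [simp]: "0 \<in> C n"
  by (simp add: C_iff multilinear_def)

lemma C_add: "f \<in> C n \<Longrightarrow> g \<in> C n \<Longrightarrow> f + g \<in> C n"
  by (simp add: C_iff multilinear_def algebra_simps)

lemma C_scale: "f \<in> C n \<Longrightarrow> (\<lambda>xs. scale c (f xs)) \<in> C n"
  by (simp add: C_iff multilinear_def scale_right_distrib mult.commute)

lemma C_minus: "f \<in> C n \<Longrightarrow> - f \<in> C n"
  by (simp add: C_iff multilinear_def)

lemma C_diff: "f \<in> C n \<Longrightarrow> g \<in> C n \<Longrightarrow> f - g \<in> C n"
  using C_add[of f n "- g"] C_minus[of g n] by simp

lemma C_sgnpow: "f \<in> C n \<Longrightarrow> sgnpow e f \<in> C n"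
  by (simp add: sgnpow_def C_minus)

lemma coboundary_regular: "coboundary regular f = delta f"
proof
  fix xs
  have "merging f xs = (\<Sum>i<length xs - 1. sgnpow (int i) (f (take i xs @ (xs ! i * xs ! Suc i) # drop (i + 2) xs)))"
    unfolding insertion_eq_sum
  proof (intro sum.cong)
    fix i assume i: "i \<in> {..<length xs - 1}"
    then have "drop i xs = xs ! i # xs ! Suc i # drop (i + 2) xs"
      by (simp add: Cons_nth_drop_Suc)
    then have "mult2 (take 2 (drop i xs)) = xs ! i * xs ! Suc i"
      by (simp add: mult2_def)
    then show "sgnpow (int i * (int 2 - 1)) (f (take i xs @ mult2 (take 2 (drop i xs)) # drop (i + 2) xs)) =
      sgnpow (int i) (f (take i xs @ (xs ! i * xs ! Suc i) # drop (i + 2) xs))" by simp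
  qed simp
  moreover have "sgnpow (int i + 1) y = - sgnpow (int i) y" for i and y :: 'a
    by (simp add: sgnpow_def)
  ultimately show "coboundary regular f xs = delta f xs"
    by (simp add: coboundary_def delta_def regular_def sum_negf)
qed

lemma delta_closed: "f \<in> C n \<Longrightarrow> delta f \<in> C (n + 1)"
proof -
  assume f: "f \<in> C n"
  have "delta f xs = 0" if "int (length xs) \<noteq> n + 1" for xs
  proof (cases "n < 0")
    case True
    then show ?thesis using C_neg[OF f] by (simp add: delta_eq left_end_def right_end_def zero_fun_def)
  next
    case False
    then show ?thesis using that f by (intro delta_length[of "nat n"]) (auto simp: C_iff)
  qed
  then show ?thesis using f by (simp add: C_iff multilinear_delta)
qed

lemma delta_closed': "f \<in> C (n - 1) \<Longrightarrow> delta f \<in> C n"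
  using delta_closed[of f "n - 1"] by simp

lemma delta_add: "delta (f + g) = delta f + delta g"
  by (rule ext) (simp add: delta_eq left_end_def right_end_def insertion_add plus_fun_def sgnpow_add_right algebra_simps)

lemma delta_minus: "delta (- f) = - delta f"
  by (rule ext) (simp add: delta_eq left_end_def right_end_def insertion_minus fun_Compl_def sgnpow_minus)

lemma delta_diff: "delta (f - g) = delta f - delta g"
  using delta_add[of f "- g"] by (simp add: delta_minus)

lemma delta_zero [simp]: "delta 0 = 0"
  using delta_add[of 0 0] by simp

lemma delta_sgnpow: "delta (sgnpow e f) = sgnpow e (delta f)"
  by (simp add: sgnpow_def delta_minus)

lemma delta_scale: "delta (\<lambda>xs. scale c (f xs)) = (\<lambda>xs. scale c (delta f xs))"
proof
  fix xs show "delta (\<lambda>xs. scale c (f xs)) xs = scale c (delta f xs)"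
    using insertion_hom[of "scale c" 2 mult2 f xs]
    by (simp add: delta_eq left_end_def right_end_def scale_right_distrib scale_right_diff_distrib
        scale_mult_left scale_mult_right sgnpow_def)
qed

lemma delta_delta_zero:
  assumes f: "f \<in> C n"
  shows "delta (delta f) = 0"
proof (cases "n < 0")
  case True
  then show ?thesis using C_neg[OF f] by simp
next
  case False
  show ?thesis
    by (rule ext, unfold zero_fun_apply, rule delta_delta[of "nat n"]) (use f False in \<open>auto simp: C_iff C_add_slot[OF f]\<close>)
qed

lemma delta_range: "h \<in> C (n - 1) \<Longrightarrow> delta h \<in> C n \<and> delta (delta h) = 0"
  using delta_closed' delta_delta_zero by blast

abbreviation cupr :: "int \<Rightarrow> ('a list \<Rightarrow> 'a) \<Rightarrow> ('a list \<Rightarrow> 'a) \<Rightarrow> 'a list \<Rightarrow> 'a" where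
  "cupr \<equiv> cup_cochain (*)"

lemma cupr_eq: "cupr n f g = juxt (nat n) f g"
  by (rule ext) (simp add: cup_cochain_def juxt_def)

lemma cupr_diff: "cupr n (f - f') g = cupr n f g - cupr n f' g" "cupr n f (g - g') = cupr n f g - cupr n f g'"
  and cupr_zero [simp]: "cupr n 0 g = 0" "cupr n f 0 = 0"
  by (auto simp: cup_cochain_def fun_eq_iff algebra_simps)

lemma cupr_closed:
  assumes "f \<in> C n" "g \<in> C m"
  shows "cupr n f g \<in> C (n + m)"
proof -
  have "cupr n f g xs = 0" if "int (length xs) \<noteq> n + m" for xs
  proof (cases "int (length (take (nat n) xs)) = n")
    case True
    then have "int (length (drop (nat n) xs)) \<noteq> m" using that by auto
    then show ?thesis using assms by (simp add: cup_cochain_def C_length)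
  next
    case False
    then show ?thesis using C_length[OF assms(1) False] by (simp add: cup_cochain_def)
  qed
  then show ?thesis using assms by (auto simp: C_iff cupr_eq multilinear_juxt)
qed

lemma delta_cupr:
  assumes f: "f \<in> C n"
  shows "delta (cupr n f g) = cupr (n + 1) (delta f) g + sgnpow n (cupr n f (delta g))"
proof (cases "n < 0")
  case True
  then show ?thesis using C_neg[OF f] by simp
next
  case False
  then have "nat (n + 1) = Suc (nat n)" by simp
  moreover have "delta (juxt (nat n) f g) = juxt (Suc (nat n)) (delta f) g + sgnpow (int (nat n)) (juxt (nat n) f (delta g))"
    by (rule ext, unfold plus_fun_apply sgnpow_fun, rule delta_juxt) (use f False in \<open>auto simp: C_iff\<close>)
  ultimately show ?thesis using False by (simp add: cupr_eq)
qed

lemma circ_eq_insertion: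
  assumes f: "f \<in> C n" and g: "g \<in> C m"
  shows "circ n m f g = insertion (nat m) g f"
proof
  fix xs :: "'a list"
  have f0: "f (us @ 0 # vs) = 0" for us vs using C_add_slot[OF f, of us 0 0 vs] by simp
  consider "n < 0" | "m < 0" | "n \<ge> 0" "m \<ge> 0" "int (length xs) \<noteq> n + m - 1"
    | "n \<ge> 0" "m \<ge> 0" "int (length xs) = n + m - 1" by linarith
  then show "circ n m f g xs = insertion (nat m) g f xs"
  proof cases
    case 1
    then show ?thesis using C_neg[OF f] by (simp add: circ_def insertion_eq_sum)
  next
    case 2
    then show ?thesis using C_neg[OF g] by (simp add: circ_def insertion_eq_sum f0)
  next
    case 3
    then show ?thesis using f by (subst insertion_length[of "nat n"]) (auto simp: circ_def C_iff)
  next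
    case 4
    then have "length xs + 1 - nat m = nat n" by linarith
    then show ?thesis using 4
      by (simp add: circ_def insertion_eq_sum sum.atLeast1_atMost_eq)
  qed
qed

lemma circ_closed:
  assumes f: "f \<in> C n" and g: "g \<in> C m"
  shows "circ n m f g \<in> C (n + m - 1)"
proof -
  have "multilinear scale (circ n m f g)"
    unfolding circ_eq_insertion[OF f g] using f g by (simp add: C_iff multilinear_insertion)
  then show ?thesis by (simp add: C_iff) (simp add: circ_def)
qed

lemma circ_add_left: "circ n m (f + f') g = circ n m f g + circ n m f' g"
  by (rule ext) (simp add: circ_def sgnpow_add_right sum.distrib)

lemma circ_minus_left: "circ n m (- f) g = - circ n m f g"
  by (rule ext) (simp add: circ_def sgnpow_minus sum_negf)

lemma circ_add_right:
  assumes f: "f \<in> C n"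
  shows "circ n m f (g + g') = circ n m f g + circ n m f g'"
  by (rule ext) (simp add: circ_def C_add_slot[OF f] sgnpow_add_right sum.distrib)

lemma circ_zero_right: "f \<in> C n \<Longrightarrow> circ n m f 0 = 0"
  using circ_add_right[of f n m 0 0] by simp

lemma circ_diff_left: "circ n m (f - f') g = circ n m f g - circ n m f' g"
  using circ_add_left[of n m f "- f'"] by (simp add: circ_minus_left)

lemma circ_zero_left [simp]: "circ n m 0 g = 0"
  using circ_add_left[of n m 0 0] by simp

lemma circ_diff_right: "f \<in> C n \<Longrightarrow> circ n m f (g - g') = circ n m f g - circ n m f g'"
  using circ_add_right[of f n m "g - g'" g'] by simp

text \<open>
  \<open>insertion_delta\<close> for integer degrees. In negative degrees all cochains vanish.
\<close>
lemma circ_delta: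
  assumes f: "f \<in> C n" and g: "g \<in> C m"
  shows "circ (n + 1) m (delta f) g + sgnpow (m - 1) (circ n (m + 1) f (delta g))
     = sgnpow (m - 1) (delta (circ n m f g)) + cupr m g f - sgnpow (n * m) (cupr n f g)"
proof -
  consider "n < 0" | "m < 0" | "n \<ge> 0" "m \<ge> 0" by linarith
  then show ?thesis
  proof cases
    case 1
    then show ?thesis using C_neg[OF f] by simp
  next
    case 2
    then show ?thesis using C_neg[OF g] circ_zero_right[OF f] circ_zero_right[OF delta_closed[OF f]] by simp
  next
    case 3
    then have "nat (m + 1) = Suc (nat m)" by simp
    then show ?thesis
      using 3 insertion_delta[of "nat n" f "nat m" g] f g
      unfolding circ_eq_insertion[OF f g] circ_eq_insertion[OF delta_closed[OF f] g] circ_eq_insertion[OF f delta_closed[OF g]] cupr_eq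
      by (auto simp: fun_eq_iff sgnpow_fun C_iff C_add_slot[OF f])
  qed
qed

lemma delta_circ:
  assumes f: "f \<in> C n" and g: "g \<in> C m"
  shows "delta (circ n m f g) = circ n (m + 1) f (delta g)
     + sgnpow (m - 1) (circ (n + 1) m (delta f) g - cupr m g f + sgnpow (n * m) (cupr n f g))"
proof -
  have "sgnpow (m - 1) (circ (n + 1) m (delta f) g + sgnpow (m - 1) (circ n (m + 1) f (delta g)))
     = sgnpow (m - 1) (sgnpow (m - 1) (delta (circ n m f g)) + cupr m g f - sgnpow (n * m) (cupr n f g))"
    by (simp only: circ_delta[OF f g])
  then have "delta (circ n m f g) = sgnpow (m - 1) (circ (n + 1) m (delta f) g) + circ n (m + 1) f (delta g)
      - sgnpow (m - 1) (cupr m g f) + sgnpow (m - 1) (sgnpow (n * m) (cupr n f g))"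
    by (simp only: sgnpow_add_right sgnpow_diff sgnpow_twice) (simp add: algebra_simps)
  then show ?thesis by (simp add: sgnpow_add_right sgnpow_diff algebra_simps)
qed

definition gbracket :: "int \<Rightarrow> int \<Rightarrow> ('a list \<Rightarrow> 'a) \<Rightarrow> ('a list \<Rightarrow> 'a) \<Rightarrow> 'a list \<Rightarrow> 'a" where
  "gbracket n m f g = circ n m f g - sgnpow ((n - 1) * (m - 1)) (circ m n g f)"

lemma gbracket_closed:
  assumes "f \<in> C n" "g \<in> C m"
  shows "gbracket n m f g \<in> C (n + m - 1)"
  using circ_closed[OF assms] circ_closed[OF assms(2,1)]
  by (simp add: gbracket_def C_diff C_sgnpow add.commute)

text \<open>
  The cup product terms of \<open>delta_circ\<close> for \<open>f \<circ> g\<close> and \<open>g \<circ> f\<close> are the same up to sign, and they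
  cancel in the graded commutator. It follows that brackets of cocycles are cocycles and that the
  bracket of a cocycle and a coboundary is a coboundary.
\<close>
lemma delta_gbracket:
  assumes f: "f \<in> C n" and g: "g \<in> C m"
  shows "delta (gbracket n m f g) = gbracket n (m + 1) f (delta g) + sgnpow (m - 1) (gbracket (n + 1) m (delta f) g)"
  unfolding gbracket_def delta_diff delta_sgnpow delta_circ[OF f g] delta_circ[OF g f]
  by (cases "even n"; cases "even m") (simp_all add: sgnpow_def algebra_simps)

lemma gbracket_diff_left: "g \<in> C m \<Longrightarrow> gbracket n m (f - f') g = gbracket n m f g - gbracket n m f' g"
  by (simp add: gbracket_def circ_diff_left circ_diff_right sgnpow_diff)

lemma gbracket_diff_right: "f \<in> C n \<Longrightarrow> gbracket n m f (g - g') = gbracket n m f g - gbracket n m f g'"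
  by (simp add: gbracket_def circ_diff_left circ_diff_right sgnpow_diff)

lemma gbracket_zero: "g \<in> C m \<Longrightarrow> gbracket n m 0 g = 0" "f \<in> C n \<Longrightarrow> gbracket n m f 0 = 0"
  by (simp_all add: gbracket_def circ_zero_right)

abbreviation Zc :: "int \<Rightarrow> ('a list \<Rightarrow> 'a) set" where "Zc \<equiv> cocycles regular"
abbreviation Bc :: "int \<Rightarrow> ('a list \<Rightarrow> 'a) set" where "Bc n \<equiv> delta ` C (n - 1)"

lemma Zc_iff: "f \<in> Zc n \<longleftrightarrow> f \<in> C n \<and> delta f = 0"
  by (simp add: cocycles_def coboundary_regular)

lemma Bc_Zc: "f \<in> Bc n \<Longrightarrow> f \<in> Zc n"
  using delta_range by (auto simp: Zc_iff)

lemma Bc_zero: "0 \<in> Bc n"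
  by (metis C_zero delta_zero image_eqI)

lemma Bc_add: "f \<in> Bc n \<Longrightarrow> g \<in> Bc n \<Longrightarrow> f + g \<in> Bc n"
  by (auto simp flip: delta_add intro: C_add)

lemma Bc_minus: "f \<in> Bc n \<Longrightarrow> - f \<in> Bc n"
  by (auto simp flip: delta_minus intro: C_minus)

lemma Bc_diff: "f \<in> Bc n \<Longrightarrow> g \<in> Bc n \<Longrightarrow> f - g \<in> Bc n"
  using Bc_add[of f n "- g"] Bc_minus[of g n] by simp

lemma Bc_scale: "f \<in> Bc n \<Longrightarrow> (\<lambda>xs. scale c (f xs)) \<in> Bc n"
  by (auto simp flip: delta_scale intro: C_scale)

lemma Zc_closed:
  "f \<in> Zc n \<Longrightarrow> g \<in> Zc n \<Longrightarrow> f + g \<in> Zc n"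
  "f \<in> Zc n \<Longrightarrow> (\<lambda>xs. scale c (f xs)) \<in> Zc n"
  "0 \<in> Zc n" "f \<in> Zc n \<Longrightarrow> - f \<in> Zc n"
  by (auto simp: Zc_iff C_add delta_add C_scale delta_scale zero_fun_def[symmetric] C_minus delta_minus)

lemma cupr_Zc: "f \<in> Zc n \<Longrightarrow> g \<in> Zc m \<Longrightarrow> cupr n f g \<in> Zc (n + m)"
  by (simp add: Zc_iff cupr_closed delta_cupr[of f n])

lemma gbracket_Zc: "f \<in> Zc n \<Longrightarrow> g \<in> Zc m \<Longrightarrow> gbracket n m f g \<in> Zc (n + m - 1)"
  by (simp add: Zc_iff gbracket_closed delta_gbracket gbracket_zero)

lemma cupr_Bc_left: "f \<in> Bc n \<Longrightarrow> g \<in> Zc m \<Longrightarrow> cupr n f g \<in> Bc (n + m)"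
proof -
  assume f: "f \<in> Bc n" and g: "g \<in> Zc m"
  then obtain h where h: "h \<in> C (n - 1)" "f = delta h" by auto
  then have "cupr n f g = delta (cupr (n - 1) h g)"
    using delta_cupr[OF h(1), of g] g by (simp add: Zc_iff)
  moreover have "cupr (n - 1) h g \<in> C (n + m - 1)"
    using cupr_closed[OF h(1), of g m] g by (simp add: Zc_iff algebra_simps)
  ultimately show ?thesis by auto
qed

lemma cupr_Bc_right: "f \<in> Zc n \<Longrightarrow> g \<in> Bc m \<Longrightarrow> cupr n f g \<in> Bc (n + m)"
proof -
  assume f: "f \<in> Zc n" and g: "g \<in> Bc m"
  then obtain h where h: "h \<in> C (m - 1)" "g = delta h" by auto
  then have "cupr n f g = delta (sgnpow n (cupr n f h))"
    using delta_cupr[of f n h] f by (simp add: Zc_iff delta_sgnpow sgnpow_twice)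
  moreover have "sgnpow n (cupr n f h) \<in> C (n + m - 1)"
    using cupr_closed[OF _ h(1), of f n] f by (simp add: Zc_iff algebra_simps C_sgnpow)
  ultimately show ?thesis by auto
qed

lemma gbracket_Bc_right: "f \<in> Zc n \<Longrightarrow> g \<in> Bc m \<Longrightarrow> gbracket n m f g \<in> Bc (n + m - 1)"
proof -
  assume f: "f \<in> Zc n" and g: "g \<in> Bc m"
  then obtain h where h: "h \<in> C (m - 1)" "g = delta h" by auto
  then have "gbracket n m f g = delta (gbracket n (m - 1) f h)"
    using delta_gbracket[of f n h "m - 1"] f by (simp add: Zc_iff gbracket_zero)
  moreover have "gbracket n (m - 1) f h \<in> C (n + m - 1 - 1)"
    using gbracket_closed[of f n h "m - 1"] f h by (simp add: Zc_iff algebra_simps)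
  ultimately show ?thesis by auto
qed

lemma gbracket_Bc_left: "f \<in> Bc n \<Longrightarrow> g \<in> Zc m \<Longrightarrow> gbracket n m f g \<in> Bc (n + m - 1)"
proof -
  assume f: "f \<in> Bc n" and g: "g \<in> Zc m"
  then obtain h where h: "h \<in> C (n - 1)" "f = delta h" by auto
  then have "gbracket n m f g = delta (sgnpow (m - 1) (gbracket (n - 1) m h g))"
    using delta_gbracket[of h "n - 1" g m] g
    by (simp add: Zc_iff gbracket_zero delta_sgnpow sgnpow_twice)
  moreover have "sgnpow (m - 1) (gbracket (n - 1) m h g) \<in> C (n + m - 1 - 1)"
    using gbracket_closed[of h "n - 1" g m] g h by (simp add: Zc_iff algebra_simps C_sgnpow)
  ultimately show ?thesis by auto
qed

lemma cupr_cong: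
  assumes "f \<in> Zc n" "f' \<in> Zc n" "f - f' \<in> Bc n" "g \<in> Zc m" "g' \<in> Zc m" "g - g' \<in> Bc m"
  shows "cupr n f g - cupr n f' g' \<in> Bc (n + m)"
proof -
  have "cupr n f g - cupr n f' g' = cupr n (f - f') g + cupr n f' (g - g')"
    by (simp add: cupr_diff)
  then show ?thesis
    using cupr_Bc_left[OF assms(3,4)] cupr_Bc_right[OF assms(2,6)] by (simp add: Bc_add)
qed

lemma gbracket_cong:
  assumes "f \<in> Zc n" "f' \<in> Zc n" "f - f' \<in> Bc n" "g \<in> Zc m" "g' \<in> Zc m" "g - g' \<in> Bc m"
  shows "gbracket n m f g - gbracket n m f' g' \<in> Bc (n + m - 1)"
proof -
  have "gbracket n m f g - gbracket n m f' g' = gbracket n m (f - f') g + gbracket n m f' (g - g')"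
    using assms by (simp add: gbracket_diff_left gbracket_diff_right Zc_iff)
  then show ?thesis
    using Bc_add[OF gbracket_Bc_left[OF assms(3,4)] gbracket_Bc_right[OF assms(2,6)]] by simp
qed

abbreviation cl :: "int \<Rightarrow> ('a list \<Rightarrow> 'a) \<Rightarrow> ('a list \<Rightarrow> 'a) set" where "cl \<equiv> coh_class regular"

lemma cl_eq: "cl n f = {g \<in> C n. g - f \<in> Bc n}"
  by (simp add: coh_class_def coboundary_regular[abs_def] cong: image_cong)

lemma cl_cong:
  assumes "f - f' \<in> Bc n" shows "cl n f = cl n f'"
proof -
  have "g - f \<in> Bc n \<longleftrightarrow> g - f' \<in> Bc n" for g
    using Bc_add[of "g - f" n "f - f'"] Bc_diff[of "g - f'" n "f - f'"] assms by auto
  then show ?thesis by (simp add: cl_eq)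
qed

lemma cl_self: "f \<in> C n \<Longrightarrow> f \<in> cl n f"
  by (simp add: cl_eq Bc_zero)

lemma cl_cohomology: "f \<in> Zc n \<Longrightarrow> cl n f \<in> cohomology regular n"
  by (simp add: cohomology_def)

lemma cohomologyD:
  assumes "U \<in> cohomology regular n" "f \<in> U"
  shows "f \<in> Zc n" "U = cl n f"
proof -
  obtain g where g: "g \<in> Zc n" "U = cl n g" using assms(1) by (auto simp: cohomology_def)
  then have fg: "f \<in> C n" "f - g \<in> Bc n" using assms(2) by (auto simp: cl_eq)
  have "f = g + (f - g)" by simp
  then show "f \<in> Zc n" using Zc_closed(1)[OF g(1) Bc_Zc[OF fg(2)]] by metis
  show "U = cl n f" using cl_cong[OF fg(2)] g by simp
qed

lemma rep_in: "U \<in> cohomology regular n \<Longrightarrow> rep U \<in> U"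
proof -
  assume "U \<in> cohomology regular n"
  then obtain g where "U = cl n g" "g \<in> C n" by (auto simp: cohomology_def Zc_iff)
  then have "g \<in> U" by (simp add: cl_self)
  then show ?thesis unfolding rep_def by (rule someI[of "\<lambda>x. x \<in> U"])
qed

lemma rep_Zc: "U \<in> cohomology regular n \<Longrightarrow> rep U \<in> Zc n"
  using cohomologyD(1) rep_in by blast

lemma cl_rep: "U \<in> cohomology regular n \<Longrightarrow> U = cl n (rep U)"
  using cohomologyD(2) rep_in by blast

lemma cohomology_diff:
  assumes "U \<in> cohomology regular n" "f \<in> U" "g \<in> U"
  shows "f - g \<in> Bc n"
  using cohomologyD(2)[OF assms(1,3)] assms(2) by (simp add: cl_eq)

end

section \<open>The Nakayama automorphism and the isomorphism Z\<close>

lemma sum_fun_apply: "(\<Sum>i\<in>A. f i) x = (\<Sum>i\<in>A. f i x :: 'm::ab_group_add)"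
  by (induction A rule: infinite_finite_induct) auto

context frobenius_algebra
begin

lemma vector_space_field: "vector_space ((*) :: 'k \<Rightarrow> 'k \<Rightarrow> 'k)"
  by unfold_locales (auto simp: algebra_simps)

lemma linear_functional_iff: "Vector_Spaces.linear scale (*) \<phi> \<longleftrightarrow>
   (\<forall>x y. \<phi> (x + y) = \<phi> x + \<phi> y) \<and> (\<forall>c x. \<phi> (scale c x) = c * \<phi> x)"
  using vector_space_axioms vector_space_field by (simp add: Vector_Spaces.linear_iff)

lemma form_bilinear [simp]:
  "form (a + a') b = form a b + form a' b" "form a (b + b') = form a b + form a b'"
  "form (scale c a) b = c * form a b" "form a (scale c b) = c * form a b"
  using form_linear_left[of b] form_linear_right[of a] unfolding linear_functional_iff by auto

lemma form_zero_left [simp]: "form 0 b = 0"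
  using form_bilinear(3)[of 0 0 b] by (simp del: form_bilinear)

lemma form_minus_left [simp]: "form (- a) b = - form a b"
  using form_bilinear(1)[of "- a" a b] by (simp add: eq_neg_iff_add_eq_0 del: form_bilinear)

lemma finite_basis: obtains B where "finite B" "independent B" "span B = UNIV"
proof -
  obtain B0 where B0: "finite B0" "span B0 = UNIV" using finite_dim by blast
  obtain B where B: "B \<subseteq> B0" "independent B" "B0 \<subseteq> span B"
    by (rule maximal_independent_subset)
  have "span B0 \<subseteq> span B" by (rule span_minimal) (use B in auto)
  then show ?thesis using that[of B] B B0 finite_subset[OF B(1) B0(1)] by auto
qed

text \<open>
  A form that is non-degenerate on the left represents every functional. For a finite basis \<open>B\<close> the
  map \<open>a \<mapsto> (\<Sum>b\<in>B. \<beta> a b \<cdot> b)\<close> is an injective endomorphism of a finite-dimensional space, hence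
  surjective, and its values record the functionals \<open>\<beta> a\<close> on the basis.
\<close>
lemma functional_representable:
  fixes \<beta> :: "'a \<Rightarrow> 'a \<Rightarrow> 'k"
  assumes l: "\<And>b. Vector_Spaces.linear scale (*) (\<lambda>a. \<beta> a b)"
    and r: "\<And>a. Vector_Spaces.linear scale (*) (\<beta> a)"
    and nd: "\<And>a. (\<And>b. \<beta> a b = 0) \<Longrightarrow> a = 0"
    and \<phi>: "Vector_Spaces.linear scale (*) \<phi>"
  shows "\<exists>a. \<beta> a = \<phi>"
proof -
  obtain B where B: "finite B" "independent B" "span B = UNIV" by (rule finite_basis)
  interpret F: finite_dimensional_vector_space scale B
    by unfold_locales (use B in auto)
  interpret FP: finite_dimensional_vector_space_pair scale B scale B
    by unfold_locales
  have agree: "\<psi> = \<chi>" if "Vector_Spaces.linear scale (*) \<psi>" "Vector_Spaces.linear scale (*) \<chi>"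
    "\<And>b. b \<in> B \<Longrightarrow> \<psi> b = \<chi> b" for \<psi> \<chi> :: "'a \<Rightarrow> 'k"
  proof
    interpret VP: vector_space_pair scale "(*) :: 'k \<Rightarrow> 'k \<Rightarrow> 'k"
      by (intro vector_space_pair.intro vector_space_axioms vector_space_field)
    fix x show "\<psi> x = \<chi> x"
      by (rule VP.linear_eq_on[OF that(1,2), of x B]) (use that(3) B in auto)
  qed
  define e where "e a = (\<Sum>b\<in>B. scale (\<beta> a b) b)" for a
  have lin: "Vector_Spaces.linear scale scale e"
    unfolding Vector_Spaces.linear_iff using vector_space_axioms l
    by (simp add: e_def linear_functional_iff scale_left_distrib sum.distrib scale_sum_right)
  have coef: "\<forall>b\<in>B. u b = v b" if "(\<Sum>b\<in>B. scale (u b) b) = (\<Sum>b\<in>B. scale (v b) b)" for u v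
  proof -
    have "(\<Sum>b\<in>B. scale (u b - v b) b) = 0"
      using that by (simp add: scale_left_diff_distrib sum_subtractf)
    then show ?thesis using independentD[OF B(2,1), of "\<lambda>b. u b - v b"] by auto
  qed
  have "inj e"
  proof (rule injI)
    fix a a' assume "e a = e a'"
    then have "\<beta> a = \<beta> a'" by (intro agree r) (use coef in \<open>auto simp: e_def\<close>)
    moreover have "\<beta> (a - a') b = \<beta> a b - \<beta> a' b" for b
      using l[of b] unfolding linear_functional_iff by (metis add_diff_cancel diff_add_cancel)
    ultimately have "a - a' = 0" by (intro nd) simp
    then show "a = a'" by simp
  qed
  then have "surj e" by (intro FP.linear_injective_imp_surjective lin) auto
  then obtain a where "e a = (\<Sum>b\<in>B. scale (\<phi> b) b)" by (metis surjD)
  then have "\<beta> a = \<phi>" by (intro agree r \<phi>) (use coef in \<open>auto simp: e_def\<close>)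
  then show ?thesis by blast
qed

lemma nakayama: "form a b = form b (nakayama a)"
proof -
  have "\<exists>c. (\<lambda>b. form b c) = form a"
    by (rule functional_representable[of "\<lambda>c b. form b c"])
       (auto intro: form_linear_left form_linear_right nondegenerate_right)
  then obtain c where c: "\<forall>b. form a b = form b c" by metis
  have "c' = c" if "\<forall>b. form a b = form b c'" for c'
  proof -
    have "form b (c' - c) = 0" for b
      using that c form_bilinear(2)[of b "c' - c" c] by simp
    then have "c' - c = 0" by (rule nondegenerate_right)
    then show ?thesis by simp
  qed
  with c have "\<exists>!c. \<forall>b. form a b = form b c" by blast
  from theI'[OF this] show ?thesis unfolding nakayama_def by blast
qed

lemma nakayama_eqI: "(\<And>b. form a b = form b c) \<Longrightarrow> nakayama a = c"
proof -
  assume "\<And>b. form a b = form b c"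
  then have "form b (nakayama a - c) = 0" for b
    using nakayama[of a b] form_bilinear(2)[of b "nakayama a - c" c] by simp
  then have "nakayama a - c = 0" by (rule nondegenerate_right)
  then show ?thesis by simp
qed

lemma nakayama_add [simp]: "nakayama (a + b) = nakayama a + nakayama b"
  and nakayama_scale [simp]: "nakayama (scale c a) = scale c (nakayama a)"
  and nakayama_mult [simp]: "nakayama (a * b) = nakayama a * nakayama b"
proof -
  show "nakayama (a + b) = nakayama a + nakayama b" "nakayama (scale c a) = scale c (nakayama a)"
    by (rule nakayama_eqI, simp add: nakayama[symmetric])+
  have "form (a * b) x = form x (nakayama a * nakayama b)" for x
    by (metis form_assoc nakayama)
  then show "nakayama (a * b) = nakayama a * nakayama b" by (rule nakayama_eqI)
qed

lemma inj_Z: "inj Z"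
proof (rule injI)
  fix a b assume "Z a = Z b"
  then have "form (a - b) c = 0" for c
    using form_bilinear(1)[of "a - b" b c] by (simp add: Z_def fun_eq_iff)
  then have "a - b = 0" by (rule nondegenerate_left)
  then show "a = b" by simp
qed

lemma Zinv_Z [simp]: "Zinv (Z a) = a"
  by (simp add: Zinv_def inj_Z)

lemma Z_surj: "Vector_Spaces.linear scale (*) \<phi> \<Longrightarrow> \<exists>a. Z a = \<phi>"
  unfolding Z_def by (rule functional_representable) (auto intro: form_linear_left form_linear_right nondegenerate_left)

lemma Z_add: "Z (a + b) = Z a + Z b"
  and Z_zero [simp]: "Z 0 = 0"
  and Z_scale: "Z (scale c a) = (\<lambda>x. c * Z a x)"
  and Z_minus: "Z (- a) = - Z a"
  by (auto simp: Z_def)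

lemma Z_diff: "Z (a - b) = Z a - Z b"
  using Z_add[of a "- b"] by (simp add: Z_minus)

lemma Z_sgnpow: "Z (sgnpow e a) = sgnpow e (Z a)"
  by (simp add: sgnpow_def Z_minus)

lemma Z_sum: "Z (\<Sum>i\<in>A. f i) = (\<Sum>i\<in>A. Z (f i))"
  by (induction A rule: infinite_finite_induct) (auto simp: Z_add)

lemma Z_comp_eq_iff [simp]: "Z \<circ> f = Z \<circ> g \<longleftrightarrow> f = g"
proof
  assume eq: "Z \<circ> f = Z \<circ> g"
  show "f = g"
  proof
    fix x
    have "Z (f x) = Z (g x)" using eq by (metis comp_apply)
    then show "f x = g x" by (rule injD[OF inj_Z])
  qed
qed simp

lemma
  fixes f g :: "'a list \<Rightarrow> 'a"
  shows Z_comp_add: "Z \<circ> (f + g) = (Z \<circ> f) + (Z \<circ> g)" and Z_comp_diff: "Z \<circ> (f - g) = (Z \<circ> f) - (Z \<circ> g)"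
  and Z_comp_sgnpow: "Z \<circ> sgnpow e f = sgnpow e (Z \<circ> f)" and Z_comp_zero: "Z \<circ> (0 :: 'a list \<Rightarrow> 'a) = 0"
  by (auto simp: fun_eq_iff Z_add Z_diff Z_sgnpow sgnpow_fun)

abbreviation CD :: "int \<Rightarrow> ('a list \<Rightarrow> 'a \<Rightarrow> 'k) set" where "CD \<equiv> cochains twisted_dual"

lemma CD_iff_Z: "F \<in> CD n \<longleftrightarrow> (\<exists>f\<in>C n. F = Z \<circ> f)"
proof
  assume F: "F \<in> CD n"
  then have "\<exists>a. Z a = F xs" for xs
    by (intro Z_surj) (simp add: cochains_def twisted_dual_def)
  then obtain f where f: "\<And>xs. Z (f xs) = F xs" by metis
  have "f \<in> C n"
    using F unfolding cochains_def
    by (simp add: twisted_dual_def regular_def f[symmetric] flip: Z_add Z_scale) (metis inj_Z injD Z_zero)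
  moreover have "F = Z \<circ> f" using f by auto
  ultimately show "\<exists>f\<in>C n. F = Z \<circ> f" by blast
next
  assume "\<exists>f\<in>C n. F = Z \<circ> f"
  then obtain f where "f \<in> C n" "F = Z \<circ> f" by blast
  then show "F \<in> CD n"
    unfolding cochains_def by (auto simp: twisted_dual_def regular_def linear_functional_iff Z_add Z_scale) (simp_all add: Z_def)
qed

text \<open>
  \<open>Z\<close> is a map of bimodules: \<open>\<langle>a b, c\<rangle> = \<langle>b, c N(a)\<rangle>\<close>, which accounts for the twist in the left
  action, and \<open>\<langle>b a, c\<rangle> = \<langle>b, a c\<rangle>\<close>.
\<close>
lemma coboundary_Z: "coboundary twisted_dual (Z \<circ> f) = Z \<circ> delta f"
proof
  fix xs
  have 1: "Z (a * b) = (\<lambda>c. Z b (c * nakayama a))" for a b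
    by (rule ext) (simp add: Z_def, metis form_assoc nakayama)
  have 2: "Z (b * a) = (\<lambda>c. Z b (a * c))" for a b
    by (rule ext) (simp add: Z_def form_assoc)
  show "coboundary twisted_dual (Z \<circ> f) xs = (Z \<circ> delta f) xs"
    unfolding coboundary_regular[symmetric]
    by (simp add: coboundary_def twisted_dual_def regular_def Z_add Z_sum Z_sgnpow 1[symmetric] 2[symmetric])
qed

lemma CD_eq: "CD n = (\<lambda>f. Z \<circ> f) ` C n"
  by (auto simp: CD_iff_Z)

lemma Z_comp_mem_image: "Z \<circ> f \<in> (\<lambda>g. Z \<circ> g) ` A \<longleftrightarrow> f \<in> A"
  by auto

lemma coh_class_Z: "coh_class twisted_dual n (Z \<circ> f) = (\<lambda>g. Z \<circ> g) ` cl n f"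
proof -
  have "coboundary twisted_dual ` CD (n - 1) = (\<lambda>g. Z \<circ> g) ` Bc n"
    unfolding CD_eq by (simp add: image_image coboundary_Z)
  moreover have "G \<in> coh_class twisted_dual n (Z \<circ> f) \<longleftrightarrow>
      G \<in> CD n \<and> G - (Z \<circ> f) \<in> coboundary twisted_dual ` CD (n - 1)" for G
    by (simp add: coh_class_def)
  ultimately have "G \<in> coh_class twisted_dual n (Z \<circ> f) \<longleftrightarrow> G \<in> (\<lambda>g. Z \<circ> g) ` cl n f" for G
    by (auto simp: CD_eq cl_eq Z_comp_mem_image simp flip: Z_comp_diff)
  then show ?thesis by blast
qed

lemma cocycles_twisted_dual_iff: "F \<in> cocycles twisted_dual n \<longleftrightarrow> (\<exists>f\<in>Zc n. F = Z \<circ> f)"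
  by (auto simp: cocycles_def[of twisted_dual] CD_iff_Z coboundary_Z Zc_iff simp flip: Z_comp_zero)

lemma cohomology_Z: "cohomology twisted_dual n = (\<lambda>U. (\<lambda>g. Z \<circ> g) ` U) ` cohomology regular n"
proof -
  have "cocycles twisted_dual n = (\<lambda>g. Z \<circ> g) ` Zc n"
    by (auto simp: cocycles_twisted_dual_iff)
  then show ?thesis by (simp add: cohomology_def image_image coh_class_Z)
qed

lemma Z_star_eq: "U \<in> cohomology regular n \<Longrightarrow> Z_star n U = (\<lambda>g. Z \<circ> g) ` U"
  unfolding Z_star_def coh_class_Z using cl_rep by simp

lemma Z_star_cl: "f \<in> Zc n \<Longrightarrow> Z_star n (cl n f) = coh_class twisted_dual n (Z \<circ> f)"
  by (simp add: Z_star_eq cl_cohomology coh_class_Z)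

text \<open>
  The representative chosen in the image class need not be the image of the one chosen in \<open>U\<close>. In
  each compatibility statement below, \<open>f\<close> and \<open>rep U\<close> have to be compared through a coboundary.
\<close>
lemma rep_Z_star:
  assumes "U \<in> cohomology regular n"
  obtains f where "f \<in> U" "rep (Z_star n U) = Z \<circ> f"
proof -
  have "rep (Z_star n U) \<in> Z_star n U"
    unfolding rep_def by (rule someI[of "\<lambda>x. x \<in> Z_star n U" "Z \<circ> rep U"]) (use Z_star_eq[OF assms] rep_in[OF assms] in auto)
  then show ?thesis using that unfolding Z_star_eq[OF assms] by auto
qed

lemma bij_Z_star: "bij_betw (Z_star n) (cohomology regular n) (cohomology twisted_dual n)"
proof -
  have "inj (\<lambda>g :: 'a list \<Rightarrow> 'a. Z \<circ> g)" by (rule injI) simp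
  then have "inj_on (Z_star n) (cohomology regular n)"
    by (intro inj_onI) (simp add: Z_star_eq inj_image_eq_iff)
  moreover have "Z_star n ` cohomology regular n = cohomology twisted_dual n"
    unfolding cohomology_Z by (rule image_cong) (auto simp: Z_star_eq)
  ultimately show ?thesis by (simp add: bij_betw_def)
qed

lemma coh_add_in: "U \<in> cohomology regular n \<Longrightarrow> V \<in> cohomology regular n \<Longrightarrow> coh_add regular n U V \<in> cohomology regular n"
  by (simp add: coh_add_def cl_cohomology Zc_closed rep_Zc)

lemma coh_scale_in: "U \<in> cohomology regular n \<Longrightarrow> coh_scale regular n c U \<in> cohomology regular n"
proof -
  assume "U \<in> cohomology regular n"
  then have "cl n (\<lambda>xs. scale c (rep U xs)) \<in> cohomology regular n"
    by (intro cl_cohomology Zc_closed(2) rep_Zc)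
  moreover have "bscale regular = scale" by (simp add: regular_def)
  ultimately show ?thesis by (simp add: coh_scale_def)
qed

lemma Z_star_add:
  assumes U: "U \<in> cohomology regular n" and V: "V \<in> cohomology regular n"
  shows "Z_star n (coh_add regular n U V) = coh_add twisted_dual n (Z_star n U) (Z_star n V)"
proof -
  obtain f g where f: "f \<in> U" "rep (Z_star n U) = Z \<circ> f" and g: "g \<in> V" "rep (Z_star n V) = Z \<circ> g"
    using rep_Z_star U V by metis
  have "(rep U + rep V) - (f + g) = (rep U - f) + (rep V - g)" by simp
  then have "(rep U + rep V) - (f + g) \<in> Bc n"
    using Bc_add[OF cohomology_diff[OF U rep_in[OF U] f(1)] cohomology_diff[OF V rep_in[OF V] g(1)]] by metis
  then have "cl n (rep U + rep V) = cl n (f + g)" by (rule cl_cong)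
  moreover have "f + g \<in> Zc n" by (intro Zc_closed(1) cohomologyD(1)[OF U f(1)] cohomologyD(1)[OF V g(1)])
  ultimately show ?thesis by (simp add: coh_add_def f g Z_star_cl Z_comp_add)
qed

lemma Z_star_scale:
  assumes U: "U \<in> cohomology regular n"
  shows "Z_star n (coh_scale regular n c U) = coh_scale twisted_dual n c (Z_star n U)"
proof -
  obtain f where f: "f \<in> U" "rep (Z_star n U) = Z \<circ> f"
    using rep_Z_star U by metis
  have "(\<lambda>xs. scale c (rep U xs)) - (\<lambda>xs. scale c (f xs)) = (\<lambda>xs. scale c ((rep U - f) xs))"
    by (auto simp: scale_right_diff_distrib)
  then have "(\<lambda>xs. scale c (rep U xs)) - (\<lambda>xs. scale c (f xs)) \<in> Bc n"
    using Bc_scale[OF cohomology_diff[OF U rep_in[OF U] f(1)], of c] by simp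
  then have "cl n (\<lambda>xs. scale c (rep U xs)) = cl n (\<lambda>xs. scale c (f xs))" by (rule cl_cong)
  moreover have "(\<lambda>xs. scale c (f xs)) \<in> Zc n" using cohomologyD(1)[OF U f(1)] by (rule Zc_closed)
  moreover have "Z \<circ> (\<lambda>xs. scale c (f xs)) = (\<lambda>xs. bscale twisted_dual c ((Z \<circ> f) xs))"
    by (auto simp: twisted_dual_def Z_scale)
  moreover have "(\<lambda>xs. bscale regular c (rep U xs)) = (\<lambda>xs. scale c (rep U xs))"
    by (simp add: regular_def)
  ultimately show ?thesis by (simp add: coh_scale_def f Z_star_cl)
qed

lemma Z_star_cup:
  assumes U: "U \<in> cohomology regular n" and V: "V \<in> cohomology regular m"
  shows "Z_star (n + m) (cl (n + m) (cupr n (rep U) (rep V)))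
    = coh_class twisted_dual (n + m) (cup_cochain dual_mult n (rep (Z_star n U)) (rep (Z_star m V)))"
proof -
  obtain f g where f: "f \<in> U" "rep (Z_star n U) = Z \<circ> f" and g: "g \<in> V" "rep (Z_star m V) = Z \<circ> g"
    using rep_Z_star U V by metis
  note fg = cohomologyD(1)[OF U f(1)] cohomologyD(1)[OF V g(1)]
  have "cl (n + m) (cupr n (rep U) (rep V)) = cl (n + m) (cupr n f g)"
    by (intro cl_cong cupr_cong rep_Zc[OF U] rep_Zc[OF V] fg cohomology_diff[OF U] cohomology_diff[OF V] rep_in[OF U] rep_in[OF V] f(1) g(1))
  moreover have "cup_cochain dual_mult n (Z \<circ> f) (Z \<circ> g) = Z \<circ> cupr n f g"
    by (auto simp: cup_cochain_def dual_mult_def)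
  ultimately show ?thesis by (simp add: f g Z_star_cl cupr_Zc fg)
qed

lemma circ_Z: "circ n m (Z \<circ> f) g = Z \<circ> circ n m f g"
  by (rule ext) (simp add: circ_def Z_sum Z_sgnpow)

lemma Z_star_bracket:
  assumes U: "U \<in> cohomology regular n" and V: "V \<in> cohomology regular m"
  shows "Z_star (n + m - 1) (cl (n + m - 1) (gbracket n m (rep U) (rep V)))
    = coh_class twisted_dual (n + m - 1) (circ n m (rep (Z_star n U)) (Zinv \<circ> rep (Z_star m V))
        - sgnpow ((n - 1) * (m - 1)) (circ m n (rep (Z_star m V)) (Zinv \<circ> rep (Z_star n U))))"
proof -
  obtain f g where f: "f \<in> U" "rep (Z_star n U) = Z \<circ> f" and g: "g \<in> V" "rep (Z_star m V) = Z \<circ> g"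
    using rep_Z_star U V by metis
  note fg = cohomologyD(1)[OF U f(1)] cohomologyD(1)[OF V g(1)]
  have "cl (n + m - 1) (gbracket n m (rep U) (rep V)) = cl (n + m - 1) (gbracket n m f g)"
    by (intro cl_cong gbracket_cong rep_Zc[OF U] rep_Zc[OF V] fg cohomology_diff[OF U] cohomology_diff[OF V] rep_in[OF U] rep_in[OF V] f(1) g(1))
  moreover have "Zinv \<circ> (Z \<circ> h) = h" for h :: "'a list \<Rightarrow> 'a" by auto
  ultimately show ?thesis
    by (simp add: f g Z_star_cl gbracket_Zc fg circ_Z) (simp add: gbracket_def Z_comp_diff Z_comp_sgnpow)
qed

end

section \<open>Pairing chains with cochains\<close>

lemma lookup_fscale [simp]: "Poly_Mapping.lookup (fscale c z) g = c * Poly_Mapping.lookup z g"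
  by (simp add: fscale_def Poly_Mapping.map.rep_eq when_def)

lemma vector_space_fscale: "vector_space (fscale :: 'k::field \<Rightarrow> ('g \<Rightarrow>\<^sub>0 'k) \<Rightarrow> ('g \<Rightarrow>\<^sub>0 'k))"
  by unfold_locales (auto intro!: poly_mapping_eqI simp: lookup_add algebra_simps)

lemma keys_fscale: "Poly_Mapping.keys (fscale c z) \<subseteq> Poly_Mapping.keys z"
  by (auto simp: in_keys_iff)

context frobenius_algebra
begin

lemma pair_chain_superset:
  assumes "finite A" "Poly_Mapping.keys z \<subseteq> A"
  shows "pair_chain F z = (\<Sum>g\<in>A. Poly_Mapping.lookup z g * F (snd g) (fst g))"
  unfolding pair_chain_def case_prod_unfold
  using assms by (intro sum.mono_neutral_cong_left) (auto simp: in_keys_iff)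

lemma pair_add: "pair_chain F (z + w) = pair_chain F z + pair_chain F w"
proof -
  let ?A = "Poly_Mapping.keys z \<union> Poly_Mapping.keys w"
  have "Poly_Mapping.keys (z + w) \<subseteq> ?A" by (rule keys_add)
  then show ?thesis
    by (simp add: pair_chain_superset[of ?A] lookup_add distrib_right sum.distrib)
qed

lemma pair_fscale: "pair_chain F (fscale c z) = c * pair_chain F z"
  by (simp add: pair_chain_superset[of "Poly_Mapping.keys z"] keys_fscale sum_distrib_left mult.assoc)

lemma pair_zero [simp]: "pair_chain F 0 = 0"
  by (simp add: pair_chain_def)

lemma pair_minus: "pair_chain F (- z) = - pair_chain F z"
  using pair_add[of F z "- z"] by (simp add: eq_neg_iff_add_eq_0 add.commute)

lemma pair_diff: "pair_chain F (z - w) = pair_chain F z - pair_chain F w"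
  using pair_add[of F z "- w"] by (simp add: pair_minus)

lemma pair_sum: "pair_chain F (\<Sum>i\<in>A. z i) = (\<Sum>i\<in>A. pair_chain F (z i))"
  by (induction A rule: infinite_finite_induct) (auto simp: pair_add)

lemma pair_sgnpow: "pair_chain F (sgnpow e z) = sgnpow e (pair_chain F z)"
  by (simp add: sgnpow_def pair_minus)

lemma pair_gen [simp]: "pair_chain F (gen x xs) = F xs x"
  by (simp add: pair_chain_def)

lemma pair_lin_ext: "pair_chain F (lin_ext G z) = pair_chain (\<lambda>xs x. pair_chain F (G (x, xs))) z"
  by (simp add: lin_ext_def pair_sum pair_fscale pair_chain_def[of _ z] case_prod_unfold)

lemma pair_cong:
  assumes "z \<in> chains M n" "\<And>xs x. int (length xs) = n \<Longrightarrow> F xs x = G xs x"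
  shows "pair_chain F z = pair_chain G z"
  unfolding pair_chain_def using assms by (intro sum.cong) (auto simp: chains_def)

lemma pair_fun:
  "pair_chain (\<lambda>xs x. F xs x + G xs x) z = pair_chain F z + pair_chain G z"
  "pair_chain (\<lambda>xs x. c * F xs x) z = c * pair_chain F z"
  "pair_chain (\<lambda>xs x. 0) z = 0"
  by (simp_all add: pair_chain_def case_prod_unfold distrib_left sum.distrib sum_distrib_left mult_ac)

lemma pair_fun_add: "pair_chain (F + G) z = pair_chain F z + pair_chain G z"
  using pair_fun(1)[of F G z] by (simp add: plus_fun_def)

lemma pair_fun_zero [simp]: "pair_chain 0 z = 0"
  using pair_fun(3)[of z] by (simp add: zero_fun_def)

lemma pair_fun_minus: "pair_chain (- F) z = - pair_chain F z"
  using pair_fun_add[of "- F" F z] by (simp add: eq_neg_iff_add_eq_0)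

lemma pair_fun_diff: "pair_chain (F - G) z = pair_chain F z - pair_chain G z"
  using pair_fun_add[of F "- G" z] by (simp add: pair_fun_minus)

text \<open>
  The Hochschild boundary with coefficients in the twisted bimodule and the coboundary with
  coefficients in its dual are transposes of each other, without any sign.
\<close>
lemma pair_bdry_gen: "pair_chain F (bdry_gen twisted (x, xs)) = coboundary twisted_dual F xs x"
  by (simp add: bdry_gen_def coboundary_def twisted_def twisted_dual_def pair_add pair_sum pair_sgnpow
      sum_fun_apply sgnpow_fun)

abbreviation bdry :: "('k, 'a, 'a) fchain \<Rightarrow> ('k, 'a, 'a) fchain" where
  "bdry \<equiv> lin_ext (bdry_gen twisted)"

lemma pair_bdry: "pair_chain F (bdry z) = pair_chain (coboundary twisted_dual F) z"
  by (simp add: pair_lin_ext pair_bdry_gen)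

lemma CD_linear:
  assumes "F \<in> CD n"
  shows "F xs (x + y) = F xs x + F xs y" "F xs (scale c x) = c * F xs x"
    "F (us @ (a + b) # vs) x = F (us @ a # vs) x + F (us @ b # vs) x"
    "F (us @ scale c a # vs) x = c * F (us @ a # vs) x"
    "int (length xs) \<noteq> n \<Longrightarrow> F xs = 0"
  using assms by (simp_all add: cochains_def twisted_dual_def linear_functional_iff)

lemma CD_I:
  assumes "\<And>xs x y. F xs (x + y) = F xs x + F xs y" "\<And>xs c x. F xs (scale c x) = c * F xs x"
    "\<And>us vs a b x. F (us @ (a + b) # vs) x = F (us @ a # vs) x + F (us @ b # vs) x"
    "\<And>us vs c a x. F (us @ scale c a # vs) x = c * F (us @ a # vs) x"
    "\<And>xs x. int (length xs) \<noteq> n \<Longrightarrow> F xs x = 0"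
  shows "F \<in> CD n"
  using assms by (auto simp: cochains_def twisted_dual_def linear_functional_iff fun_eq_iff)

lemma pair_tensor_null:
  assumes F: "F \<in> CD n" and r: "r \<in> tensor_null twisted m"
  shows "pair_chain F r = 0"
proof -
  interpret V: vector_space "fscale :: 'k \<Rightarrow> ('k, 'a, 'a) fchain \<Rightarrow> _" by (rule vector_space_fscale)
  have "V.subspace {z. pair_chain F z = 0}"
    by (auto simp: V.subspace_def pair_add pair_fscale)
  moreover have "tensor_relations twisted \<inter> chains twisted m \<subseteq> {z. pair_chain F z = 0}"
    by (auto simp: tensor_relations_def pair_diff pair_fscale twisted_def CD_linear[OF F])
  ultimately show ?thesis
    using V.span_minimal r unfolding tensor_null_def by blast
qed

lemma tensor_relations_twisted:
  "gen (x + y) xs - gen x xs - gen y xs \<in> tensor_relations twisted"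
  "gen (scale c x) xs - fscale c (gen x xs) \<in> tensor_relations twisted"
  "gen x (us @ (a + b) # vs) - gen x (us @ a # vs) - gen x (us @ b # vs) \<in> tensor_relations twisted"
  "gen x (us @ scale c a # vs) - fscale c (gen x (us @ a # vs)) \<in> tensor_relations twisted"
proof -
  have [simp]: "bcarrier twisted = UNIV" by (simp add: twisted_def)
  have bscale_twisted: "bscale twisted = scale" by (simp add: twisted_def)
  show "gen (x + y) xs - gen x xs - gen y xs \<in> tensor_relations twisted"
    unfolding tensor_relations_def by (rule UnI1, rule UnI1, rule UnI1, rule CollectI, intro exI conjI, rule refl) simp_all
  show "gen (scale c x) xs - fscale c (gen x xs) \<in> tensor_relations twisted"
    unfolding tensor_relations_def by (rule UnI1, rule UnI1, rule UnI2, rule CollectI, intro exI conjI, subst bscale_twisted, rule refl) simp_all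
  show "gen x (us @ (a + b) # vs) - gen x (us @ a # vs) - gen x (us @ b # vs) \<in> tensor_relations twisted"
    unfolding tensor_relations_def by (rule UnI1, rule UnI2, rule CollectI, intro exI conjI, rule refl) simp_all
  show "gen x (us @ scale c a # vs) - fscale c (gen x (us @ a # vs)) \<in> tensor_relations twisted"
    unfolding tensor_relations_def by (rule UnI2, rule CollectI, intro exI conjI, rule refl) simp_all
qed

text \<open>
  A chain vanishes in the tensor product if every multilinear functional kills it. Otherwise some
  linear functional on formal chains kills all relations and not the chain, and restricted to
  generators it is a cochain. This turns identities modulo relations, here and below, into
  identities between cochains.
\<close>
lemma tensor_null_I:
  assumes z: "z \<in> chains twisted n" and all: "\<And>F. F \<in> CD n \<Longrightarrow> pair_chain F z = 0"
  shows "z \<in> tensor_null twisted n"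
proof (rule ccontr)
  interpret V: vector_space "fscale :: 'k \<Rightarrow> ('k, 'a, 'a) fchain \<Rightarrow> _" by (rule vector_space_fscale)
  interpret VP: vector_space_pair "fscale :: 'k \<Rightarrow> ('k, 'a, 'a) fchain \<Rightarrow> _" "(*) :: 'k \<Rightarrow> 'k \<Rightarrow> 'k"
    by (intro vector_space_pair.intro vector_space_fscale vector_space_field)
  let ?R = "tensor_relations twisted \<inter> chains twisted n"
  assume "z \<notin> tensor_null twisted n"
  then have nz: "z \<notin> V.span ?R" by (simp add: tensor_null_def)
  obtain B where B: "B \<subseteq> ?R" "V.independent B" "?R \<subseteq> V.span B"
    by (rule V.maximal_independent_subset)
  have zB: "z \<notin> V.span B" using nz V.span_mono[OF B(1)] by auto
  then have ind: "V.independent (insert z B)" by (rule V.independent_insertI) (rule B)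
  obtain \<psi> where lin: "Vector_Spaces.linear fscale (*) \<psi>" and \<psi>: "\<forall>x\<in>insert z B. \<psi> x = (if x = z then 1 else 0)"
    using VP.linear_independent_extend[OF ind, of "\<lambda>x. if x = z then 1 else 0"] by metis
  have lz: "\<psi> z = 1" using \<psi> by simp
  have ladd: "\<psi> (x + y) = \<psi> x + \<psi> y" and lsc: "\<psi> (fscale c x) = c * \<psi> x" for x y c
    using lin unfolding Vector_Spaces.linear_iff by auto
  have ldiff: "\<psi> (x - y) = \<psi> x - \<psi> y" for x y
    using ladd[of "x - y" y] by simp
  have l0: "\<psi> 0 = 0" using ldiff[of 0 0] by simp
  have "V.subspace {x. \<psi> x = 0}"
    by (auto simp: V.subspace_def ladd lsc l0)
  moreover have "B \<subseteq> {x. \<psi> x = 0}"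
  proof
    fix x assume "x \<in> B"
    then show "x \<in> {x. \<psi> x = 0}" using \<psi> zB V.span_base[of x B] by (cases "x = z") auto
  qed
  ultimately have "V.span B \<subseteq> {x. \<psi> x = 0}" by (intro V.span_minimal)
  then have lR: "\<psi> r = 0" if "r \<in> ?R" for r using that B(3) by blast
  have gc: "gen x xs \<in> chains twisted n" if "int (length xs) = n" for x xs
    using that by (simp add: chains_def twisted_def)
  have chd: "u - w \<in> chains twisted n" if "u \<in> chains twisted n" "w \<in> chains twisted n" for u w
  proof -
    have "Poly_Mapping.keys (u - w) \<subseteq> Poly_Mapping.keys u \<union> Poly_Mapping.keys w"
      using keys_add[of u "- w"] by simp
    then show ?thesis using that unfolding chains_def by blast
  qed
  have chs: "fscale c u \<in> chains twisted n" if "u \<in> chains twisted n" for c u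
    using that keys_fscale[of c u] unfolding chains_def by blast
  define F where "F xs x = (if int (length xs) = n then \<psi> (gen x xs) else 0)" for xs x
  have "F \<in> CD n"
  proof (rule CD_I)
    fix xs x y
    show "F xs (x + y) = F xs x + F xs y"
    proof (cases "int (length xs) = n")
      case True
      have "gen (x + y) xs - gen x xs - gen y xs \<in> ?R"
        by (rule IntI[OF tensor_relations_twisted(1) chd[OF chd[OF gc gc] gc]]) (rule True)+
      from lR[OF this] show ?thesis using True by (simp add: F_def ldiff diff_eq_eq add.commute)
    qed (simp add: F_def)
    fix c
    show "F xs (scale c x) = c * F xs x"
    proof (cases "int (length xs) = n")
      case True
      have "gen (scale c x) xs - fscale c (gen x xs) \<in> ?R"
        by (rule IntI[OF tensor_relations_twisted(2) chd[OF gc chs[OF gc]]]) (rule True)+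
      from lR[OF this] show ?thesis using True by (simp add: F_def ldiff lsc diff_eq_eq)
    qed (simp add: F_def)
    fix us vs a b
    show "F (us @ (a + b) # vs) x = F (us @ a # vs) x + F (us @ b # vs) x"
    proof (cases "int (length (us @ a # vs)) = n")
      case True
      then have "gen x (us @ (a + b) # vs) - gen x (us @ a # vs) - gen x (us @ b # vs) \<in> ?R"
        by (intro IntI[OF tensor_relations_twisted(3) chd[OF chd[OF gc gc] gc]]) simp_all
      from lR[OF this] show ?thesis using True by (simp add: F_def ldiff diff_eq_eq add.commute)
    qed (simp add: F_def)
    show "F (us @ scale c a # vs) x = c * F (us @ a # vs) x"
    proof (cases "int (length (us @ a # vs)) = n")
      case True
      then have "gen x (us @ scale c a # vs) - fscale c (gen x (us @ a # vs)) \<in> ?R"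
        by (intro IntI[OF tensor_relations_twisted(4) chd[OF gc chs[OF gc]]]) simp_all
      from lR[OF this] show ?thesis using True by (simp add: F_def ldiff lsc diff_eq_eq)
    qed (simp add: F_def)
  qed (simp add: F_def)
  then have "pair_chain F z = 0" by (rule all)
  moreover have "pair_chain F z = pair_chain (\<lambda>xs x. \<psi> (gen x xs)) z"
    by (rule pair_cong[OF z]) (simp add: F_def)
  moreover have "pair_chain (\<lambda>xs x. \<psi> (gen x xs)) z = \<psi> z"
  proof -
    have "\<psi> (\<Sum>g\<in>A. h g) = (\<Sum>g\<in>A. \<psi> (h g))" for h and A :: "('a \<times> 'a list) set"
      by (induction A rule: infinite_finite_induct) (auto simp: l0 ladd)
    moreover have "\<psi> z = \<psi> (\<Sum>g\<in>Poly_Mapping.keys z. fscale (Poly_Mapping.lookup z g) (gen (fst g) (snd g)))"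
      by (rule arg_cong[where f = \<psi>], rule poly_mapping_eqI) (simp add: lookup_sum lookup_single when_def mult_delta_right in_keys_iff)
    ultimately have "\<psi> z = (\<Sum>g\<in>Poly_Mapping.keys z. \<psi> (fscale (Poly_Mapping.lookup z g) (gen (fst g) (snd g))))"
      by simp
    then show ?thesis by (simp add: pair_chain_def lsc case_prod_unfold)
  qed
  ultimately show False using lz by simp
qed

lemma pair_boundaries:
  assumes F: "F \<in> cocycles twisted_dual n" and z: "z \<in> boundaries twisted n"
  shows "pair_chain F z = 0"
proof -
  obtain w r where "z = bdry w + r" "r \<in> tensor_null twisted n"
    using z by (auto simp: boundaries_def)
  then show ?thesis
    using F pair_tensor_null[of F n r n] by (simp add: pair_add pair_bdry cocycles_def)
qed

lemma pair_coboundary: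
  assumes H: "H \<in> CD (n - 1)" and z: "z \<in> cycles twisted n"
  shows "pair_chain (coboundary twisted_dual H) z = 0"
  using pair_tensor_null[OF H, of "bdry z" "n - 1"] z by (simp add: pair_bdry cycles_def)

lemma pair_hom_class:
  assumes F: "F \<in> cocycles twisted_dual n" and w: "w \<in> hom_class twisted n z"
  shows "pair_chain F w = pair_chain F z"
  using pair_boundaries[OF F, of "w - z"] w by (simp add: hom_class_def pair_diff)

end

section \<open>The dual of the Connes operator\<close>

definition merge_at :: "nat \<Rightarrow> 'a::times list \<Rightarrow> 'a list" where
  "merge_at i w = take i w @ (w ! i * w ! Suc i) # drop (i + 2) w"

lemma merge_at_append: "length us = i \<Longrightarrow> merge_at i (us @ a # b # vs) = us @ (a * b) # vs"
  by (auto simp: merge_at_def nth_append)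

context frobenius_algebra
begin

text \<open>
  The summands of the Connes operator are the windows of length \<open>n + 1\<close> in the list
  \<open>xs @ x # map nakayama xs\<close>. The window that starts at \<open>x\<close>, with \<open>s = n\<close>, is the summand
  with \<open>i = 0\<close>; for \<open>i > 0\<close> one has \<open>s = i - 1\<close>.
\<close>
definition window :: "nat \<Rightarrow> 'a list \<Rightarrow> 'a \<Rightarrow> 'a list" where
  "window s xs x = drop s xs @ x # map nakayama (take s xs)"

lemma length_window [simp]: "length (window s xs x) = Suc (length xs)"
  by (simp add: window_def)

text \<open>
  The transpose of the Connes operator (\<open>pair_connes_gen\<close>). The sign of the summand \<open>s = n\<close> is
  \<open>(-1)\<^bsup>(n + 1) n\<^esup> = 1\<close>, in accordance with the index \<open>0\<close> in \<open>connes_gen\<close>.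
\<close>
definition connes_star :: "('a list \<Rightarrow> 'a \<Rightarrow> 'k) \<Rightarrow> 'a list \<Rightarrow> 'a \<Rightarrow> 'k" where
  "connes_star F xs x =
    (\<Sum>s\<le>length xs. sgnpow ((int s + 1) * int (length xs)) (F (window s xs x) 1))"

definition twist :: "('a list \<Rightarrow> 'a \<Rightarrow> 'k) \<Rightarrow> 'a list \<Rightarrow> 'a \<Rightarrow> 'k" where
  "twist F xs x = F (map nakayama xs) (nakayama x)"

lemma pair_connes_gen: "pair_chain F (connes_gen (x, xs)) = connes_star F xs x"
proof -
  let ?n = "length xs"
  have "pair_chain F (connes_gen (x, xs)) = (\<Sum>i\<in>{0..?n}. sgnpow (int i * int ?n)
      (if i = 0 then F (window ?n xs x) 1 else F (window (i - 1) xs x) 1))"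
    unfolding connes_gen_def by (auto simp: pair_sum pair_sgnpow window_def intro!: sum.cong)
  also have "\<dots> = F (window ?n xs x) 1 + (\<Sum>s<?n. sgnpow (int (Suc s) * int ?n) (F (window s xs x) 1))"
    by (simp add: sum.atLeast_Suc_atMost sum.atLeast1_atMost_eq)
  also have "\<dots> = connes_star F xs x"
    unfolding connes_star_def lessThan_Suc_atMost[symmetric] sum.lessThan_Suc
    by (simp add: add.commute) (simp add: sgnpow_def)
  finally show ?thesis .
qed

text \<open>
  In the list \<open>ys @ y # map nakayama ys\<close> that belongs to a face \<open>(ys, y)\<close>, a product of two
  neighbouring entries of \<open>xs\<close> occurs twice, once plainly and once under the automorphism, and a
  window contains exactly one of the two. So each window of a face of \<open>(xs, x)\<close> is a merge inside a
  window of \<open>(xs, x)\<close> itself. This lemma and the next treat the two faces that multiply into \<open>x\<close>,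
  where the product occurs only once.
\<close>
lemma window_merge_first:
  assumes "s \<le> length ys"
  shows "window s ys (x * nakayama y) = merge_at (length ys - s) (window (Suc s) (y # ys) x)"
  using merge_at_append[of "drop s ys" "length ys - s" x "nakayama y" "map nakayama (take s ys)"]
  by (simp add: window_def)

lemma window_merge_last:
  assumes "s \<le> length ys"
  shows "window s ys (y * x) = merge_at (length ys - s) (window s (ys @ [y]) x)"
  using merge_at_append[of "drop s ys" "length ys - s" y x "map nakayama (take s ys)"] assms
  by (simp add: window_def)

lemma window_merge_middle:
  "s \<le> length us \<Longrightarrow> window s (us @ (a * b) # vs) x = merge_at (length us - s) (window s (us @ a # b # vs) x)"
  "t \<le> length vs \<Longrightarrow> window (length us + Suc t) (us @ (a * b) # vs) x
     = merge_at (length us + length vs + 1 - t) (window (length us + Suc (Suc t)) (us @ a # b # vs) x)"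
proof -
  show "s \<le> length us \<Longrightarrow> window s (us @ (a * b) # vs) x = merge_at (length us - s) (window s (us @ a # b # vs) x)"
    using merge_at_append[of "drop s us" "length us - s" a b "vs @ x # map nakayama (take s us)"]
    by (simp add: window_def)
  show "t \<le> length vs \<Longrightarrow> window (length us + Suc t) (us @ (a * b) # vs) x
     = merge_at (length us + length vs + 1 - t) (window (length us + Suc (Suc t)) (us @ a # b # vs) x)"
    using merge_at_append[of "drop t vs @ x # map nakayama us" "length us + length vs + 1 - t"
        "nakayama a" "nakayama b" "map nakayama (take t vs)"]
    by (simp add: window_def)
qed

text \<open>
  The \<open>q\<close>-th term of the Hochschild boundary of \<open>x \<otimes> xs\<close>, up to sign.
\<close>
definition face :: "nat \<Rightarrow> 'a list \<Rightarrow> 'a \<Rightarrow> 'a list \<times> 'a" where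
  "face q xs x = (if q = 0 then (tl xs, x * nakayama (hd xs))
     else if q = length xs then (butlast xs, last xs * x) else (merge_at (q - 1) xs, x))"

lemma coboundary_face:
  assumes "xs \<noteq> []"
  shows "coboundary twisted_dual G xs x = (\<Sum>q\<le>length xs. sgnpow (int q) (case face q xs x of (ys, y) \<Rightarrow> G ys y))"
proof -
  obtain m where m: "length xs = Suc m" using assms by (cases xs) auto
  have "(\<Sum>q\<le>length xs. sgnpow (int q) (case face q xs x of (ys, y) \<Rightarrow> G ys y))
    = G (tl xs) (x * nakayama (hd xs)) + (\<Sum>q<m. sgnpow (int q + 1) (G (merge_at q xs) x))
      + sgnpow (int (Suc m)) (G (butlast xs) (last xs * x))"
    unfolding m lessThan_Suc_atMost[symmetric] sum.lessThan_Suc[of _ "Suc m"] sum.lessThan_Suc_shift[of _ m]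
    using m by (simp add: face_def add.commute)
  then show ?thesis
    using assms m by (simp add: coboundary_def twisted_dual_def sum_fun_apply sgnpow_fun merge_at_def)
qed

lemma face_window:
  assumes xs: "xs \<noteq> []" and q: "q \<le> length xs" and s: "s < length xs"
  shows "(case face q xs x of (ys, y) \<Rightarrow> window s ys y) =
    (if s < q then merge_at (q - 1 - s) (window s xs x)
     else merge_at (q + length xs - 1 - s) (window (Suc s) xs x))"
proof -
  consider "q = 0" | "q = length xs" "q \<noteq> 0" | "0 < q" "q < length xs" using q by linarith
  then show ?thesis
  proof cases
    case 1
    obtain y ys where "xs = y # ys" using xs by (cases xs) auto
    then show ?thesis using 1 s window_merge_first[of s ys x y] by (simp add: face_def)
  next
    case 2
    obtain y ys where "xs = ys @ [y]" using xs by (cases xs rule: rev_cases) auto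
    then show ?thesis using 2 s window_merge_last[of s ys y x] by (simp add: face_def)
  next
    case 3
    define us vs where "us = take (q - 1) xs" and "vs = drop (q + 1) xs"
    have xs_eq: "xs = us @ xs ! (q - 1) # xs ! q # vs"
      using 3 id_take_nth_drop[of "q - 1" xs] Cons_nth_drop_Suc[of q xs] by (simp add: us_def vs_def)
    have len: "length us = q - 1" using 3 by (simp add: us_def)
    obtain a b where ab: "xs = us @ a # b # vs" using xs_eq by blast
    have f: "face q xs x = (us @ (a * b) # vs, x)"
      using 3 len merge_at_append[of us "q - 1" a b vs] unfolding ab by (simp add: face_def)
    show ?thesis
    proof (cases "s < q")
      case True
      then show ?thesis using f window_merge_middle(1)[of s us a b vs x] len 3 unfolding ab by simp
    next
      case False
      then obtain t where t: "s = length us + Suc t" using len 3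
        by (metis Suc_diff_1 add_Suc_shift le_add_diff_inverse not_less)
      then have "t \<le> length vs" using s ab by simp
      moreover have "q + length xs - 1 - s = length us + length vs + 1 - t"
        using t len 3 ab by simp
      ultimately show ?thesis using f False window_merge_middle(2)[of t vs us a b x] t ab by simp
    qed
  qed
qed

lemma length_face: "xs \<noteq> [] \<Longrightarrow> q \<le> length xs \<Longrightarrow> length (fst (face q xs x)) = length xs - 1"
  by (auto simp: face_def merge_at_def)

text \<open>
  The cyclic identity \<open>N b = b' N\<close> behind the Connes operator. Pairs of a face and a window of it
  correspond bijectively to pairs of a window and a merge inside it (\<open>face_window\<close>), and
  corresponding terms have opposite signs.
\<close>
lemma connes_star_merges:
  "coboundary twisted_dual (connes_star F) xs x =
    - (\<Sum>s\<le>length xs. sgnpow ((int s + 1) * int (length xs))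
         (\<Sum>i<length xs. sgnpow (int i + 1) (F (merge_at i (window s xs x)) 1)))"
proof (cases "xs = []")
  case True
  then show ?thesis by (simp add: coboundary_def)
next
  case False
  define n where "n = length xs"
  have n: "n > 0" using False by (simp add: n_def)
  have sd: "sgnpow e (\<Sum>i\<in>A. h i :: 'k) = (\<Sum>i\<in>A. sgnpow e (h i))" for e h and A :: "nat set"
    by (simp add: sgnpow_def sum_negf)
  have "coboundary twisted_dual (connes_star F) xs x =
      (\<Sum>q\<le>n. \<Sum>s<n. sgnpow (int q + (int s + 1) * (int n - 1))
         (F (case face q xs x of (ys, y) \<Rightarrow> window s ys y) 1))"
    unfolding coboundary_face[OF False] n_def[symmetric]
  proof (intro sum.cong refl)
    fix q assume "q \<in> {..n}"
    then have len: "length (fst (face q xs x)) = n - 1" using length_face[OF False, of q x] by (simp add: n_def)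
    obtain ys y where f: "face q xs x = (ys, y)" by fastforce
    have st: "{..n - Suc 0} = {..<n}" using n by auto
    show "sgnpow (int q) (case face q xs x of (ys, y) \<Rightarrow> connes_star F ys y) =
      (\<Sum>s<n. sgnpow (int q + (int s + 1) * (int n - 1)) (F (case face q xs x of (ys, y) \<Rightarrow> window s ys y) 1))"
      using len n by (simp add: f connes_star_def sd sgnpow_sgnpow st of_nat_diff)
  qed
  also have "\<dots> = (\<Sum>(q, s)\<in>{..n} \<times> {..<n}. sgnpow (int q + (int s + 1) * (int n - 1))
         (F (case face q xs x of (ys, y) \<Rightarrow> window s ys y) 1))"
    by (simp add: sum.cartesian_product)
  also have "\<dots> = (\<Sum>(s, i)\<in>{..n} \<times> {..<n}. - sgnpow ((int s + 1) * int n + int i + 1) (F (merge_at i (window s xs x)) 1))"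
  \<comment> \<open>A window of the \<open>q\<close>-th face contains the first copy of the product if \<open>s < q\<close> and the second otherwise.\<close>
  proof (rule sum.reindex_bij_witness[where
        j = "\<lambda>(q, s). if s < q then (s, q - 1 - s) else (Suc s, q + n - 1 - s)"
        and i = "\<lambda>(s, i). if s + i < n then (Suc (s + i), s) else (s + i - n, s - 1)"], goal_cases)
    case (1 p)
    then show ?case by (auto split: if_splits)
  next
    case (2 p)
    then show ?case by (auto split: if_splits)
  next
    case (3 p)
    then show ?case by (auto split: if_splits)
  next
    case (4 p)
    then show ?case by (auto split: if_splits)
  next
    case (5 p)
    then obtain q s where p: "p = (q, s)" "q \<le> n" "s < n" by auto
    have w: "(case face q xs x of (ys, y) \<Rightarrow> window s ys y) =
      (if s < q then merge_at (q - 1 - s) (window s xs x)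
       else merge_at (q + n - 1 - s) (window (Suc s) xs x))"
      unfolding n_def by (rule face_window) (use p False in \<open>auto simp: n_def\<close>)
    have neg: "- sgnpow e y = sgnpow (e + 1) (y :: 'k)" for e y by (simp add: sgnpow_def)
    show ?case
    proof (cases "s < q")
      case True
      have "sgnpow ((int s + 1) * int n + int (q - 1 - s) + 1 + 1) y = sgnpow (int q + (int s + 1) * (int n - 1)) y" for y :: 'k
        using True by (intro sgnpow_cong_even) (auto simp: of_nat_diff algebra_simps)
      then show ?thesis using True by (simp only: p w neg prod.case if_True)
    next
      case F: False
      have "sgnpow ((int (Suc s) + 1) * int n + int (q + n - 1 - s) + 1 + 1) y = sgnpow (int q + (int s + 1) * (int n - 1)) y" for y :: 'k
        using F p by (intro sgnpow_cong_even) (auto simp: of_nat_diff algebra_simps)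
      then show ?thesis using F by (simp only: p w neg prod.case if_False)
    qed
  qed
  also have "\<dots> = - (\<Sum>s\<le>n. sgnpow ((int s + 1) * int n)
         (\<Sum>i<n. sgnpow (int i + 1) (F (merge_at i (window s xs x)) 1)))"
    by (simp add: sd sgnpow_sgnpow sum_negf add.assoc flip: sum.cartesian_product)
  finally show ?thesis by (simp add: n_def)
qed

text \<open>
  The transpose of \<open>b B + B b = T - 1\<close>. The merges inside the windows cancel by
  \<open>connes_star_merges\<close>. The outer terms telescope: moving the first entry of a window into the
  coefficient gives the same as moving the last entry of the next window there. Only the outer terms
  of the first and the last window remain.
\<close>
lemma connes_star_homotopy:
  "coboundary twisted_dual (connes_star F) + connes_star (coboundary twisted_dual F) = twist F - F"
proof (intro ext)
  fix xs :: "'a list" and x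
  define n where "n = length xs"
  define P where "P s = F (tl (window s xs x)) (nakayama (hd (window s xs x)))" for s
  define Q where "Q s = F (butlast (window s xs x)) (last (window s xs x))" for s
  define M where "M s = (\<Sum>i<n. sgnpow (int i + 1) (F (merge_at i (window s xs x)) 1))" for s
  have w0: "window s xs x \<noteq> []" for s by (simp add: window_def)
  have cb: "coboundary twisted_dual F (window s xs x) 1 = P s + M s + sgnpow (int n + 1) (Q s)" for s
    using w0 by (simp add: coboundary_def twisted_dual_def P_def Q_def M_def n_def sum_fun_apply sgnpow_fun
        merge_at_def add.commute)
  have PQ: "P s = Q (Suc s)" if "s < n" for s
  proof -
    have d: "drop s xs = xs ! s # drop (Suc s) xs" and t: "take (Suc s) xs = take s xs @ [xs ! s]"
      using that by (simp_all add: n_def Cons_nth_drop_Suc take_Suc_conv_app_nth)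
    show ?thesis
      unfolding P_def Q_def window_def d t by (simp add: butlast_append)
  qed
  have Pn: "P n = twist F xs x" and Q0: "Q 0 = F xs x"
    by (simp_all add: P_def Q_def window_def twist_def n_def butlast_append)
  have tele: "(\<Sum>s\<le>k. sgnpow ((int s + 1) * int n) (P s + sgnpow (int n + 1) (Q s)))
     = sgnpow ((int k + 1) * int n) (P k) - Q 0" if "k \<le> n" for k
    using that
  proof (induction k)
    case 0
    then show ?case by (simp add: sgnpow_add_right sgnpow_sgnpow) (simp add: sgnpow_def)
  next
    case (Suc k)
    then have "Q (Suc k) = P k" using PQ[of k] by simp
    with Suc show ?case
      by (simp add: sgnpow_add_right sgnpow_sgnpow) (auto simp: sgnpow_def algebra_simps)
  qed
  have "connes_star (coboundary twisted_dual F) xs x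
      = (\<Sum>s\<le>n. sgnpow ((int s + 1) * int n) (P s + sgnpow (int n + 1) (Q s)))
        + (\<Sum>s\<le>n. sgnpow ((int s + 1) * int n) (M s))"
    by (simp add: connes_star_def cb n_def[symmetric] sgnpow_add_right sum.distrib)
  also have "\<dots> = twist F xs x - F xs x + (\<Sum>s\<le>n. sgnpow ((int s + 1) * int n) (M s))"
    using tele[of n] Pn Q0 by (simp add: sgnpow_def)
  finally show "(coboundary twisted_dual (connes_star F) + connes_star (coboundary twisted_dual F)) xs x = (twist F - F) xs x"
    unfolding plus_fun_apply connes_star_merges by (simp add: n_def M_def)
qed

lemma window_slot:
  "\<exists>P Q h. (h = id \<or> h = nakayama) \<and> (\<forall>z. window s (us @ z # vs) x = P @ h z # Q)"
proof (cases "s \<le> length us")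
  case True
  then have "window s (us @ z # vs) x = drop s us @ id z # (vs @ x # map nakayama (take s us))" for z
    by (simp add: window_def)
  then show ?thesis by blast
next
  case False
  then obtain t where "s = length us + Suc t" by (metis add_Suc_right less_iff_Suc_add not_le)
  then have "window s (us @ z # vs) x
      = (drop t vs @ x # map nakayama us) @ nakayama z # map nakayama (take t vs)" for z
    by (simp add: window_def)
  then show ?thesis by blast
qed

lemma connes_star_CD:
  assumes F: "F \<in> CD n"
  shows "connes_star F \<in> CD (n - 1)"
proof (rule CD_I)
  note lin = CD_linear[OF F]
  fix xs x y
  show "connes_star F xs (x + y) = connes_star F xs x + connes_star F xs y"
    by (simp add: connes_star_def window_def lin sgnpow_add_right sum.distrib)
  fix c
  show "connes_star F xs (scale c x) = c * connes_star F xs x"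
    by (simp add: connes_star_def window_def lin sum_distrib_left)
  fix us vs a b
  have "F (window s (us @ (a + b) # vs) x) 1 = F (window s (us @ a # vs) x) 1 + F (window s (us @ b # vs) x) 1" for s
  proof -
    obtain P Q h where h: "h = id \<or> h = nakayama" "\<And>z. window s (us @ z # vs) x = P @ h z # Q"
      using window_slot[of s us vs x] by metis
    from h(1) have "h (a + b) = h a + h b" by auto
    then show ?thesis by (simp add: h(2) lin)
  qed
  then show "connes_star F (us @ (a + b) # vs) x = connes_star F (us @ a # vs) x + connes_star F (us @ b # vs) x"
    by (simp add: connes_star_def sgnpow_add_right sum.distrib)
  have "F (window s (us @ scale c a # vs) x) 1 = c * F (window s (us @ a # vs) x) 1" for s
  proof -
    obtain P Q h where h: "h = id \<or> h = nakayama" "\<And>z. window s (us @ z # vs) x = P @ h z # Q"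
      using window_slot[of s us vs x] by metis
    from h(1) have "h (scale c a) = scale c (h a)" by auto
    then show ?thesis by (simp add: h(2) lin)
  qed
  then show "connes_star F (us @ scale c a # vs) x = c * connes_star F (us @ a # vs) x"
    by (simp add: connes_star_def sum_distrib_left distrib_left)
next
  fix xs :: "'a list" and x assume "int (length xs) \<noteq> n - 1"
  then have "F (window s xs x) = 0" for s by (intro CD_linear(5)[OF F]) simp
  then show "connes_star F xs x = 0" by (simp add: connes_star_def)
qed

lemma twist_CD: "F \<in> CD n \<Longrightarrow> twist F \<in> CD n"
  by (rule CD_I) (simp_all add: twist_def CD_linear)

lemma coboundary_twist: "coboundary twisted_dual (twist F) = twist (coboundary twisted_dual F)"
proof (intro ext)
  fix xs x show "coboundary twisted_dual (twist F) xs x = twist (coboundary twisted_dual F) xs x"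
    by (auto simp: coboundary_def twisted_dual_def twist_def sum_fun_apply sgnpow_fun
        map_tl hd_map last_map map_butlast take_map drop_map intro!: sum.cong)
qed

lemma CD_module:
  "F \<in> CD n \<Longrightarrow> G \<in> CD n \<Longrightarrow> F + G \<in> CD n" "F \<in> CD n \<Longrightarrow> - F \<in> CD n" "0 \<in> CD n"
  "F \<in> CD n \<Longrightarrow> (\<lambda>xs x. c * F xs x) \<in> CD n"
  by (auto intro!: CD_I simp: CD_linear algebra_simps)

lemma coboundary_add: "coboundary twisted_dual (F + G) = coboundary twisted_dual F + coboundary twisted_dual G"
  by (rule ext) (auto simp: coboundary_def twisted_dual_def sgnpow_add_right sgnpow_fun sum.distrib fun_eq_iff)

lemma coboundary_smult:
  "coboundary twisted_dual (\<lambda>xs x. c * F xs x) = (\<lambda>xs x. c * coboundary twisted_dual F xs x)"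
proof (intro ext)
  fix xs x
  show "coboundary twisted_dual (\<lambda>xs x. c * F xs x) xs x = c * coboundary twisted_dual F xs x"
    by (simp add: coboundary_def twisted_dual_def sum_fun_apply sgnpow_fun sum_distrib_left distrib_left)
qed

lemma connes_star_zero [simp]: "connes_star 0 = 0"
  by (intro ext) (simp add: connes_star_def)

lemma twist_diff: "twist (F - G) = twist F - twist G"
  by (intro ext) (simp add: twist_def)

lemma pair_twist_chain: "pair_chain F (twist_chain z) = pair_chain (twist F) z"
  by (simp add: twist_chain_def pair_lin_ext twist_def[abs_def])

lemma pair_connes: "pair_chain F (lin_ext connes_gen z) = pair_chain (connes_star F) z"
  by (simp add: pair_lin_ext pair_connes_gen[abs_def])

lemma chains_module:
  "z \<in> chains M n \<Longrightarrow> w \<in> chains M n \<Longrightarrow> z + w \<in> chains M n" "z \<in> chains M n \<Longrightarrow> fscale c z \<in> chains M n"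
  "0 \<in> chains M n" "z \<in> chains M n \<Longrightarrow> - z \<in> chains M n"
  using keys_add[of z w] keys_fscale[of c z] unfolding chains_def by (auto simp: in_keys_iff lookup_add)

lemma chains_diff: "z \<in> chains M n \<Longrightarrow> w \<in> chains M n \<Longrightarrow> z - w \<in> chains M n"
  using chains_module(1)[of z M n "- w"] chains_module(4)[of w M n] by simp

lemma chains_sum: "(\<And>i. i \<in> I \<Longrightarrow> z i \<in> chains M n) \<Longrightarrow> (\<Sum>i\<in>I. z i) \<in> chains M n"
  by (induction I rule: infinite_finite_induct) (auto intro: chains_module)

lemma chains_sgnpow: "z \<in> chains M n \<Longrightarrow> sgnpow e z \<in> chains M n"
  by (simp add: sgnpow_def chains_module)

lemma chains_gen: "int (length xs) = n \<Longrightarrow> gen x xs \<in> chains twisted n"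
  by (simp add: chains_def twisted_def)

lemma lin_ext_chains:
  assumes "z \<in> chains M n" "\<And>x xs. int (length xs) = n \<Longrightarrow> G (x, xs) \<in> chains M' m"
  shows "lin_ext G z \<in> chains M' m"
  unfolding lin_ext_def
proof (intro chains_sum chains_module)
  fix g assume g: "g \<in> Poly_Mapping.keys z"
  obtain x xs where "g = (x, xs)" by fastforce
  moreover from this have "int (length xs) = n" using assms(1) g by (auto simp: chains_def)
  ultimately show "G g \<in> chains M' m" using assms(2) by simp
qed

lemma bdry_chains: "z \<in> chains twisted n \<Longrightarrow> bdry z \<in> chains twisted (n - 1)"
proof (rule lin_ext_chains)
  fix x :: 'a and xs :: "'a list" assume "int (length xs) = n"
  then show "bdry_gen twisted (x, xs) \<in> chains twisted (n - 1)"
    by (auto simp: bdry_gen_def of_nat_diff Suc_le_eq intro!: chains_module chains_sum chains_sgnpow chains_gen)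
qed

lemma twist_chains: "z \<in> chains twisted n \<Longrightarrow> twist_chain z \<in> chains twisted n"
  unfolding twist_chain_def by (rule lin_ext_chains) (auto intro: chains_gen)

lemma connes_chains: "z \<in> chains twisted n \<Longrightarrow> lin_ext connes_gen z \<in> chains twisted (n + 1)"
proof (rule lin_ext_chains)
  fix x :: 'a and xs :: "'a list" assume "int (length xs) = n"
  then show "connes_gen (x, xs) \<in> chains twisted (n + 1)"
    by (auto simp: connes_gen_def intro!: chains_sum chains_sgnpow chains_gen)
qed

end

section \<open>Splitting off the part invariant under the Nakayama automorphism\<close>

lemma interpolation:
  fixes f :: "'x::field \<Rightarrow> 'x"
  assumes "finite S"
  shows "\<exists>p. \<forall>s\<in>S. poly p s = f s"
  using assms
proof (induction S)
  case empty
  then show ?case by simp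
next
  case (insert t S)
  then obtain p where p: "\<forall>s\<in>S. poly p s = f s" by blast
  define w where "w = (\<Prod>s\<in>S. [:- s, 1:])"
  have w0: "poly w s = 0" if "s \<in> S" for s
    using that insert by (simp add: w_def poly_prod)
  have wt: "poly w t \<noteq> 0"
    using insert by (auto simp: w_def poly_prod)
  define q where "q = p + Polynomial.smult ((f t - poly p t) / poly w t) w"
  have "\<forall>s\<in>insert t S. poly q s = f s"
    using p w0 wt by (auto simp: q_def)
  then show ?case by blast
qed

text \<open>
  Sequences of this form are what the iterates of a diagonalizable map with eigenvalues in \<open>\<Lambda>\<close>
  produce in coordinates. The set \<open>\<Lambda>\<close> is kept explicit because one polynomial has to serve all
  cochains of a degree.
\<close>
definition exp_sum :: "'x::field set \<Rightarrow> (nat \<Rightarrow> 'x) \<Rightarrow> bool" where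
  "exp_sum \<Lambda> u \<longleftrightarrow> (\<exists>c. \<forall>j. u j = (\<Sum>\<sigma>\<in>\<Lambda>. c \<sigma> * \<sigma> ^ j))"

lemma exp_sum_family:
  assumes "finite I"
  shows "exp_sum (l ` I) (\<lambda>j. \<Sum>s\<in>I. c s * l s ^ j)"
proof -
  have "(\<Sum>s\<in>I. c s * l s ^ j) = (\<Sum>\<sigma>\<in>l ` I. (\<Sum>s\<in>{s \<in> I. l s = \<sigma>}. c s) * \<sigma> ^ j)" for j
    by (subst sum.image_gen[OF assms, of _ l]) (auto simp: sum_distrib_right intro!: sum.cong)
  then show ?thesis unfolding exp_sum_def by (intro exI allI)
qed

lemma exp_sum_sum:
  assumes "\<And>i. i \<in> I \<Longrightarrow> exp_sum \<Lambda> (u i)"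
  shows "exp_sum \<Lambda> (\<lambda>j. \<Sum>i\<in>I. u i j)"
proof -
  obtain c where c: "\<And>i j. i \<in> I \<Longrightarrow> u i j = (\<Sum>\<sigma>\<in>\<Lambda>. c i \<sigma> * \<sigma> ^ j)"
    using assms unfolding exp_sum_def by metis
  have "(\<Sum>i\<in>I. u i j) = (\<Sum>\<sigma>\<in>\<Lambda>. (\<Sum>i\<in>I. c i \<sigma>) * \<sigma> ^ j)" for j
    unfolding sum_distrib_right by (subst sum.swap) (simp add: c)
  then show ?thesis unfolding exp_sum_def by (intro exI allI)
qed

lemma exp_sum_mult:
  assumes fin: "finite \<Lambda>" "finite \<Lambda>'" and u: "exp_sum \<Lambda> u" and v: "exp_sum \<Lambda>' v"
  shows "exp_sum ((\<lambda>(s, t). s * t) ` (\<Lambda> \<times> \<Lambda>')) (\<lambda>j. u j * v j)"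
proof -
  obtain c d where c: "\<And>j. u j = (\<Sum>\<sigma>\<in>\<Lambda>. c \<sigma> * \<sigma> ^ j)" and d: "\<And>j. v j = (\<Sum>\<sigma>\<in>\<Lambda>'. d \<sigma> * \<sigma> ^ j)"
    using u v unfolding exp_sum_def by metis
  have "u j * v j = (\<Sum>p\<in>\<Lambda> \<times> \<Lambda>'. (case p of (s, t) \<Rightarrow> c s * d t) * (case p of (s, t) \<Rightarrow> s * t) ^ j)" for j
    unfolding c d sum_product sum.cartesian_product
    by (intro sum.cong) (auto simp: power_mult_distrib)
  then show ?thesis
    using exp_sum_family[of "\<Lambda> \<times> \<Lambda>'" "\<lambda>(s, t). s * t" "\<lambda>(s, t). c s * d t"] fin by simp
qed

text \<open>
  With \<open>E\<close> the shift of sequences, this is \<open>(E - 1)\<^sup>2 p(E) u = (E - 1) u\<close>: on the summand of \<open>\<sigma>\<close> the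
  shift acts as \<open>\<sigma>\<close>, and \<open>(\<sigma> - 1)\<^sup>2 p(\<sigma>) = \<sigma> - 1\<close> by the choice of \<open>p\<close>, for \<open>\<sigma> = 1\<close> since both
  sides vanish. Here it is essential that \<open>1\<close> occurs without a factor polynomial in \<open>j\<close>.
\<close>
lemma exp_sum_recurrence:
  fixes u :: "nat \<Rightarrow> 'x::field"
  assumes u: "exp_sum \<Lambda> u" and p: "\<And>\<sigma>. \<sigma> \<in> \<Lambda> \<Longrightarrow> \<sigma> \<noteq> 1 \<Longrightarrow> poly p \<sigma> = 1 / (\<sigma> - 1)"
  shows "(\<Sum>j\<le>degree p. coeff p j * (u (j + 2) - 2 * u (j + 1) + u j)) = u 1 - u 0"
proof -
  obtain c where c: "\<And>j. u j = (\<Sum>\<sigma>\<in>\<Lambda>. c \<sigma> * \<sigma> ^ j)" using u unfolding exp_sum_def by metis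
  have "u (j + 2) - 2 * u (j + 1) + u j = (\<Sum>\<sigma>\<in>\<Lambda>. c \<sigma> * (\<sigma> - 1)\<^sup>2 * \<sigma> ^ j)" for j
    unfolding c sum_distrib_left sum_subtractf[symmetric] sum.distrib[symmetric]
    by (intro sum.cong) (auto simp: power2_eq_square algebra_simps)
  then have "(\<Sum>j\<le>degree p. coeff p j * (u (j + 2) - 2 * u (j + 1) + u j))
      = (\<Sum>j\<le>degree p. \<Sum>\<sigma>\<in>\<Lambda>. c \<sigma> * (\<sigma> - 1)\<^sup>2 * (coeff p j * \<sigma> ^ j))"
    by (simp add: sum_distrib_left mult_ac)
  also have "\<dots> = (\<Sum>\<sigma>\<in>\<Lambda>. c \<sigma> * (\<sigma> - 1)\<^sup>2 * poly p \<sigma>)"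
    by (subst sum.swap) (simp add: poly_altdef sum_distrib_left)
  also have "\<dots> = (\<Sum>\<sigma>\<in>\<Lambda>. c \<sigma> * \<sigma> ^ 1 - c \<sigma> * \<sigma> ^ 0)"
  proof (intro sum.cong refl)
    fix \<sigma> assume s: "\<sigma> \<in> \<Lambda>"
    show "c \<sigma> * (\<sigma> - 1)\<^sup>2 * poly p \<sigma> = c \<sigma> * \<sigma> ^ 1 - c \<sigma> * \<sigma> ^ 0"
    proof (cases "\<sigma> = 1")
      case False
      then have "(\<sigma> - 1)\<^sup>2 * poly p \<sigma> = \<sigma> - 1"
        using p[OF s False] by (simp add: power2_eq_square)
      then show ?thesis by (simp add: mult.assoc right_diff_distrib)
    qed simp
  qed
  also have "\<dots> = u 1 - u 0"
    unfolding c by (simp add: sum_subtractf)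
  finally show ?thesis .
qed

text \<open>
  Applied to coefficients, a retraction that is linear over \<open>k\<close> turns a linear relation over the
  closure between elements of \<open>k\<close> into one over \<open>k\<close>.
\<close>
lemma alg_closure_retraction:
  "\<exists>\<rho> :: 'k::field alg_closure \<Rightarrow> 'k.
    (\<forall>x y. \<rho> (x + y) = \<rho> x + \<rho> y) \<and> (\<forall>c x. \<rho> (x * to_ac c) = \<rho> x * c) \<and> \<rho> 1 = 1"
proof -
  interpret K: vector_space "\<lambda>c (x :: 'k alg_closure). to_ac c * x"
    by unfold_locales (auto simp: algebra_simps)
  interpret k: vector_space "(*) :: 'k \<Rightarrow> 'k \<Rightarrow> 'k"
    by unfold_locales (auto simp: algebra_simps)
  interpret P: vector_space_pair "\<lambda>c (x :: 'k alg_closure). to_ac c * x" "(*) :: 'k \<Rightarrow> 'k \<Rightarrow> 'k" ..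
  have "K.independent {1}" by (simp add: K.independent_insert)
  from P.linear_independent_extend[OF this, of "\<lambda>_. 1"]
  obtain \<rho> where lin: "Vector_Spaces.linear (\<lambda>c (x :: 'k alg_closure). to_ac c * x) (*) \<rho>" and "\<rho> 1 = 1" by auto
  then show ?thesis
    unfolding Vector_Spaces.linear_iff by (intro exI[of _ \<rho>]) (auto simp: mult.commute)
qed

context frobenius_algebra
begin

text \<open>
  In an eigenbasis over the closure each iteration of \<open>N\<close> multiplies a coordinate by its eigenvalue.
  The coordinates in the given basis are fixed linear combinations of these.
\<close>
lemma nakayama_coordinates_exp_sum:
  assumes nakayama_semisimple
  obtains es and \<Lambda> :: "'k alg_closure set" where "distinct es" "independent (set es)" "span (set es) = UNIV"
    "finite \<Lambda>" "\<And>x b. b \<in> set es \<Longrightarrow> exp_sum \<Lambda> (\<lambda>j. to_ac (representation (set es) ((nakayama ^^ j) x) b))"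
proof -
  obtain es D where es: "distinct es" "independent (set es)" "span (set es) = UNIV"
    and D: "diagonal_mat D" "similar_mat (map_mat to_ac (matrix_wrt es nakayama)) D"
    using assms unfolding nakayama_semisimple_def by blast
  define d where "d = length es"
  define A where "A = map_mat to_ac (matrix_wrt es nakayama)"
  have dimA: "dim_row A = d" by (simp add: A_def matrix_wrt_def d_def)
  obtain P Q where "similar_mat_wit A D P Q" using D(2) unfolding similar_mat_def A_def by blast
  then have car: "A \<in> carrier_mat d d" "D \<in> carrier_mat d d" "P \<in> carrier_mat d d" "Q \<in> carrier_mat d d"
    and PQ: "P * Q = 1\<^sub>m d" and QP: "Q * P = 1\<^sub>m d" and APDQ: "A = P * D * Q"
    unfolding similar_mat_wit_def Let_def dimA by auto
  define R where "R x b = representation (set es) x b" for x b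
  have Rlin: "R (\<Sum>l<d. scale (t l) (w l)) b = (\<Sum>l<d. t l * R (w l) b)" for t w b
    unfolding R_def using representation_sum[OF es(2), of "{..<d}" "\<lambda>l. scale (t l) (w l)"] es(3)
    by (simp add: representation_scale[OF es(2)])
  have expand: "(\<Sum>l<d. scale (R x (es ! l)) (es ! l)) = x" for x
  proof -
    have "(\<Sum>l<d. scale (R x (es ! l)) (es ! l)) = (\<Sum>b\<in>set es. scale (R x b) b)"
      using bij_betw_nth[OF es(1), of "{..<d}" "set es"] unfolding d_def
      by (intro sum.reindex_bij_betw) simp
    also have "\<dots> = x" unfolding R_def by (rule sum_representation_eq[OF es(2)]) (use es(3) in auto)
    finally show ?thesis .
  qed
  define V where "V x = vec d (\<lambda>i. to_ac (R x (es ! i)))" for x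
  have V_carrier: "V x \<in> carrier_vec d" for x by (simp add: V_def)
  have nak_sum: "nakayama (\<Sum>l<m. w l) = (\<Sum>l<m. nakayama (w l))" for w and m :: nat
  proof (induction m)
    case 0
    have "nakayama 0 = 0" using nakayama_add[of 0 0] by simp
    then show ?case by simp
  qed simp
  have step: "V (nakayama x) = A *\<^sub>v V x" for x
  proof (rule eq_vecI)
    show "dim_vec (V (nakayama x)) = dim_vec (A *\<^sub>v V x)" using car by (simp add: V_def)
    fix i assume "i < dim_vec (A *\<^sub>v V x)"
    then have i: "i < d" using car by simp
    have "nakayama x = (\<Sum>l<d. scale (R x (es ! l)) (nakayama (es ! l)))"
      using arg_cong[OF expand[of x], of nakayama] by (simp add: nak_sum)
    then have "R (nakayama x) (es ! i) = (\<Sum>l<d. R x (es ! l) * R (nakayama (es ! l)) (es ! i))"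
      by (simp only: Rlin)
    then have "V (nakayama x) $ i = (\<Sum>l<d. to_ac (R (nakayama (es ! l)) (es ! i)) * to_ac (R x (es ! l)))"
      using i by (simp add: V_def to_ac_sum mult.commute)
    also have "\<dots> = (A *\<^sub>v V x) $ i"
      using i by (simp add: A_def matrix_wrt_def d_def V_def scalar_prod_def R_def atLeast0LessThan)
    finally show "V (nakayama x) $ i = (A *\<^sub>v V x) $ i" .
  qed
  \<comment> \<open>\<open>V\<close> are the coordinates in the given basis, \<open>W\<close> those in an eigenbasis over the closure.\<close>
  define W where "W x = Q *\<^sub>v V x" for x
  have W_carrier: "W x \<in> carrier_vec d" for x unfolding W_def using car V_carrier by simp
  have stepW: "W (nakayama x) = D *\<^sub>v W x" for x
  proof -
    have "W (nakayama x) = Q *\<^sub>v (P *\<^sub>v (D *\<^sub>v (Q *\<^sub>v V x)))"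
      unfolding W_def step APDQ using car V_carrier[of x] by (simp add: assoc_mult_mat_vec[of _ d d _ d])
    also have "\<dots> = (Q * P) *\<^sub>v (D *\<^sub>v (Q *\<^sub>v V x))"
      using car V_carrier[of x] by (intro assoc_mult_mat_vec[symmetric, of _ d d _ d]) auto
    also have "\<dots> = D *\<^sub>v W x" unfolding QP W_def using car V_carrier[of x] by simp
    finally show ?thesis .
  qed
  have diag: "(D *\<^sub>v w) $ s = D $$ (s, s) * w $ s" if "s < d" "w \<in> carrier_vec d" for s and w :: "'k alg_closure vec"
  proof -
    have "(D *\<^sub>v w) $ s = (\<Sum>i\<in>{0..<d}. D $$ (s, i) * w $ i)"
      using that car by (simp add: scalar_prod_def)
    also have "\<dots> = (\<Sum>i\<in>{0..<d}. if i = s then D $$ (s, s) * w $ s else 0)"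
      using D(1) that car by (intro sum.cong) (auto simp: diagonal_mat_def)
    finally show ?thesis using that by simp
  qed
  have Wpow: "W ((nakayama ^^ j) x) $ s = D $$ (s, s) ^ j * W x $ s" if "s < d" for j x s
    by (induction j) (simp_all add: stepW diag[OF that W_carrier] mult.assoc)
  have VW: "V x = P *\<^sub>v W x" for x
  proof -
    have "P *\<^sub>v W x = (P * Q) *\<^sub>v V x"
      unfolding W_def using car V_carrier[of x] by (intro assoc_mult_mat_vec[symmetric, of _ d d _ d]) auto
    then show ?thesis unfolding PQ using V_carrier[of x] by simp
  qed
  define \<Lambda> where "\<Lambda> = (\<lambda>s. D $$ (s, s)) ` {..<d}"
  have "exp_sum \<Lambda> (\<lambda>j. to_ac (representation (set es) ((nakayama ^^ j) x) b))" if b: "b \<in> set es" for x b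
  proof -
    obtain i where i: "i < d" "es ! i = b"
      using b unfolding in_set_conv_nth d_def by blast
    have "to_ac (R ((nakayama ^^ j) x) b) = (\<Sum>s<d. P $$ (i, s) * W x $ s * D $$ (s, s) ^ j)" for j
    proof -
      have "to_ac (R ((nakayama ^^ j) x) b) = V ((nakayama ^^ j) x) $ i" using i by (simp add: V_def)
      also have "\<dots> = (\<Sum>s<d. P $$ (i, s) * W ((nakayama ^^ j) x) $ s)"
        unfolding VW using i car W_carrier[of "(nakayama ^^ j) x"]
        by (auto simp: scalar_prod_def atLeast0LessThan intro!: sum.cong)
      finally show ?thesis by (simp add: Wpow mult_ac)
    qed
    then show ?thesis
      unfolding \<Lambda>_def R_def[symmetric] using exp_sum_family[of "{..<d}" "\<lambda>s. D $$ (s, s)" "\<lambda>s. P $$ (i, s) * W x $ s"] by simp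
  qed
  moreover have "finite \<Lambda>" by (simp add: \<Lambda>_def)
  ultimately show ?thesis using that es by blast
qed

text \<open>
  Expanding one argument after the other in a basis of \<open>A\<close> writes the sequence as a sum of products
  of coordinate sequences, so that \<open>\<Lambda>\<close> consists of products of as many eigenvalues as there are
  arguments. This expresses that \<open>N \<otimes> \<dots> \<otimes> N\<close> is diagonalizable with \<open>N\<close>.
\<close>
lemma multilinear_exp_sum:
  assumes nakayama_semisimple
  shows "\<exists>\<Lambda> :: 'k alg_closure set. finite \<Lambda> \<and> (\<forall>\<Phi> xs ys. multilinear (*) \<Phi> \<longrightarrow> length xs = k \<longrightarrow>
    exp_sum \<Lambda> (\<lambda>j. to_ac (\<Phi> (map (nakayama ^^ j) xs @ ys))))"
proof (induction k)
  case 0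
  have "exp_sum {1 :: 'k alg_closure} (\<lambda>j. y)" for y unfolding exp_sum_def by (intro exI[of _ "\<lambda>_. y"]) simp
  then show ?case by (intro exI[of _ "{1}"]) simp
next
  case (Suc k)
  then obtain \<Lambda> :: "'k alg_closure set" where \<Lambda>: "finite \<Lambda>"
    and IH: "\<And>\<Phi> xs ys. multilinear (*) \<Phi> \<Longrightarrow> length xs = k \<Longrightarrow> exp_sum \<Lambda> (\<lambda>j. to_ac (\<Phi> (map (nakayama ^^ j) xs @ ys)))"
    by blast
  obtain es and \<Lambda>0 :: "'k alg_closure set" where es: "distinct es" "independent (set es)" "span (set es) = UNIV"
    and \<Lambda>0: "finite \<Lambda>0" "\<And>x b. b \<in> set es \<Longrightarrow> exp_sum \<Lambda>0 (\<lambda>j. to_ac (representation (set es) ((nakayama ^^ j) x) b))"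
    by (rule nakayama_coordinates_exp_sum[OF assms]) blast
  let ?R = "representation (set es)"
  have "exp_sum ((\<lambda>(s, t). s * t) ` (\<Lambda>0 \<times> \<Lambda>)) (\<lambda>j. to_ac (\<Phi> (map (nakayama ^^ j) xs @ ys)))"
    if \<Phi>: "multilinear (*) \<Phi>" and len: "length xs = Suc k" for \<Phi> :: "'a list \<Rightarrow> 'k" and xs ys
  proof -
    obtain ws x where xs: "xs = ws @ [x]" and ws: "length ws = k"
      using len by (cases xs rule: rev_cases) auto
    have lin: "\<Phi> (us @ (\<Sum>b\<in>B. scale (t b) b) # ys) = (\<Sum>b\<in>B. t b * \<Phi> (us @ b # ys))" for us t and B :: "'a set"
    proof -
      have z: "\<Phi> (us @ 0 # ys) = 0" using multilinearD[OF \<Phi>, of us "- 1" 0 0 ys] by simp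
      show ?thesis
        by (induction B rule: infinite_finite_induct) (simp_all add: z multilinearD[OF \<Phi>])
    qed
    have "\<Phi> (map (nakayama ^^ j) xs @ ys) =
       (\<Sum>b\<in>set es. ?R ((nakayama ^^ j) x) b * \<Phi> (map (nakayama ^^ j) ws @ b # ys))" for j
    proof -
      have "(nakayama ^^ j) x = (\<Sum>b\<in>set es. scale (?R ((nakayama ^^ j) x) b) b)"
        by (rule sum_representation_eq[OF es(2), symmetric]) (use es(3) in auto)
      then show ?thesis unfolding lin[symmetric] xs by simp
    qed
    then have "(\<lambda>j. to_ac (\<Phi> (map (nakayama ^^ j) xs @ ys))) =
       (\<lambda>j. \<Sum>b\<in>set es. to_ac (?R ((nakayama ^^ j) x) b) * to_ac (\<Phi> (map (nakayama ^^ j) ws @ b # ys)))"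
      by (simp add: to_ac_sum)
    moreover have "exp_sum ((\<lambda>(s, t). s * t) ` (\<Lambda>0 \<times> \<Lambda>))
       (\<lambda>j. \<Sum>b\<in>set es. to_ac (?R ((nakayama ^^ j) x) b) * to_ac (\<Phi> (map (nakayama ^^ j) ws @ b # ys)))"
      by (intro exp_sum_sum exp_sum_mult \<Lambda>0 \<Lambda> IH \<Phi> ws)
    ultimately show ?thesis by simp
  qed
  then show ?case using \<Lambda> \<Lambda>0 by (intro exI[of _ "(\<lambda>(s, t). s * t) ` (\<Lambda>0 \<times> \<Lambda>)"]) simp
qed

text \<open>
  The polynomial \<open>r(T)\<close> in the twist \<open>T\<close>, with coefficients \<open>r 0, \<dots>, r d\<close>, acting on cochains.
\<close>
definition avg :: "(nat \<Rightarrow> 'k) \<Rightarrow> nat \<Rightarrow> ('a list \<Rightarrow> 'a \<Rightarrow> 'k) \<Rightarrow> 'a list \<Rightarrow> 'a \<Rightarrow> 'k" where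
  "avg r d F xs x = (\<Sum>j\<le>d. r j * (twist ^^ j) F xs x)"

definition avg_chain :: "(nat \<Rightarrow> 'k) \<Rightarrow> nat \<Rightarrow> ('k, 'a, 'a) fchain \<Rightarrow> ('k, 'a, 'a) fchain" where
  "avg_chain r d z = (\<Sum>j\<le>d. fscale (r j) ((twist_chain ^^ j) z))"

lemma twist_power: "(twist ^^ j) F xs x = F (map (nakayama ^^ j) xs) ((nakayama ^^ j) x)"
  by (induction j arbitrary: xs x) (simp_all add: twist_def funpow_swap1[of nakayama] comp_def)

text \<open>
  The operator \<open>1 - (T - 1) r(T)\<close> takes values in the invariants of \<open>T\<close>. The polynomial \<open>r\<close>
  interpolates \<open>1 / (\<sigma> - 1)\<close> at the eigenvalues \<open>\<sigma> \<noteq> 1\<close> of \<open>T\<close>, which gives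
  \<open>(T - 1)\<^sup>2 r(T) = T - 1\<close> over the algebraic closure; a retraction of the closure onto \<open>k\<close> carries the
  coefficients of \<open>r\<close> down to \<open>k\<close>.
\<close>
lemma twist_splitting:
  assumes nakayama_semisimple
  obtains r d where "\<And>F. F \<in> CD n \<Longrightarrow> twist (F - (twist (avg r d F) - avg r d F)) = F - (twist (avg r d F) - avg r d F)"
proof (cases "n < 0")
  case True
  have "F = 0" if "F \<in> CD n" for F
    by (rule ext) (use that True CD_linear(5)[OF that] in auto)
  moreover have "avg r d 0 = 0" for r d by (intro ext) (simp add: avg_def twist_power)
  moreover have "twist 0 = 0" by (intro ext) (simp add: twist_def)
  ultimately show ?thesis using that by (metis diff_self)
next
  case False
  obtain \<Lambda> :: "'k alg_closure set" where \<Lambda>: "finite \<Lambda>"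
    and ex: "\<And>\<Phi> xs ys. multilinear (*) \<Phi> \<Longrightarrow> length xs = Suc (nat n) \<Longrightarrow>
      exp_sum \<Lambda> (\<lambda>j. to_ac (\<Phi> (map (nakayama ^^ j) xs @ ys)))"
    using multilinear_exp_sum[OF assms, of "Suc (nat n)"] by blast
  obtain p where p: "\<forall>\<sigma>\<in>\<Lambda>. poly p \<sigma> = 1 / (\<sigma> - 1)"
    using interpolation[OF \<Lambda>, of "\<lambda>\<sigma>. 1 / (\<sigma> - 1)"] by blast
  obtain \<rho> :: "'k alg_closure \<Rightarrow> 'k" where \<rho>: "\<And>x y. \<rho> (x + y) = \<rho> x + \<rho> y" "\<And>c x. \<rho> (x * to_ac c) = \<rho> x * c" "\<rho> 1 = 1"
    using alg_closure_retraction by blast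
  \<comment> \<open>\<open>\<rho>\<close> brings the coefficients of \<open>p\<close> down to \<open>k\<close>.\<close>
  have \<rho>0: "\<rho> 0 = 0" using \<rho>(2)[of 0 0] by simp
  have \<rho>sum: "\<rho> (\<Sum>i\<in>I. h i) = (\<Sum>i\<in>I. \<rho> (h i))" for h and I :: "nat set"
    by (induction I rule: infinite_finite_induct) (simp_all add: \<rho>0 \<rho>)
  have \<rho>ac: "\<rho> (to_ac c) = c" for c using \<rho>(2)[of 1 c] \<rho>(3) by simp
  define r where "r j = \<rho> (coeff p j)" for j
  define d where "d = degree p"
  have key: "(\<Sum>j\<le>d. r j * ((twist ^^ (j + 2)) F xs x - 2 * (twist ^^ (j + 1)) F xs x + (twist ^^ j) F xs x))
      = twist F xs x - F xs x" if F: "F \<in> CD n" for F xs x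
  proof (cases "int (length xs) = n")
    case True
    define \<Phi> where "\<Phi> ys = (case ys of [] \<Rightarrow> 0 | y # zs \<Rightarrow> F zs y)" for ys
    have "multilinear (*) \<Phi>"
      unfolding multilinear_def
    proof (intro allI)
      fix us vs c a b
      show "\<Phi> (us @ (scale c a + b) # vs) = c * \<Phi> (us @ a # vs) + \<Phi> (us @ b # vs)"
        by (cases us) (simp_all add: \<Phi>_def CD_linear[OF F])
    qed
    from ex[OF this, of "x # xs" "[]"] True
    have "exp_sum \<Lambda> (\<lambda>j. to_ac ((twist ^^ j) F xs x))"
      by (simp add: \<Phi>_def twist_power nat_int_comparison)
    from exp_sum_recurrence[OF this, of p] p
    have "(\<Sum>j\<le>d. coeff p j * to_ac ((twist ^^ (j + 2)) F xs x - 2 * (twist ^^ (j + 1)) F xs x + (twist ^^ j) F xs x))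
       = to_ac ((twist ^^ 1) F xs x - (twist ^^ 0) F xs x)"
      by (simp add: d_def)
    then have "\<rho> (\<Sum>j\<le>d. coeff p j * to_ac ((twist ^^ (j + 2)) F xs x - 2 * (twist ^^ (j + 1)) F xs x + (twist ^^ j) F xs x))
       = (twist ^^ 1) F xs x - (twist ^^ 0) F xs x"
      by (simp only: \<rho>ac)
    then show ?thesis unfolding \<rho>sum \<rho>(2) r_def by simp
  next
    case False
    then have "F (map g xs) = 0" for g using CD_linear(5)[OF F, of "map g xs"] by simp
    then show ?thesis using CD_linear(5)[OF F False] by (simp add: twist_power twist_def)
  qed
  have "twist (F - (twist (avg r d F) - avg r d F)) = F - (twist (avg r d F) - avg r d F)" if "F \<in> CD n" for F
  proof (intro ext)
    fix xs x
    have tw: "twist (avg r d F) xs x = (\<Sum>j\<le>d. r j * (twist ^^ (j + 1)) F xs x)"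
      "twist (twist (avg r d F)) xs x = (\<Sum>j\<le>d. r j * (twist ^^ (j + 2)) F xs x)"
      by (simp_all add: twist_def[of "avg r d F"] twist_def[of "twist (avg r d F)"] avg_def)
         (simp_all add: twist_power twist_def funpow_swap1 comp_def)
    have "twist (twist (avg r d F)) xs x - 2 * twist (avg r d F) xs x + avg r d F xs x = twist F xs x - F xs x"
      using key[OF that, of xs x] unfolding tw avg_def
      by (simp add: distrib_left right_diff_distrib sum.distrib sum_subtractf sum_distrib_left mult.left_commute)
    then show "twist (F - (twist (avg r d F) - avg r d F)) xs x = (F - (twist (avg r d F) - avg r d F)) xs x"
      by (simp only: twist_diff minus_apply) (simp add: algebra_simps)
  qed
  then show ?thesis by (rule that)
qed

lemma CD_diff: "F \<in> CD n \<Longrightarrow> G \<in> CD n \<Longrightarrow> F - G \<in> CD n"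
  using CD_module(1)[of F n "- G"] CD_module(2)[of G n] by simp

lemma twist_power_CD: "F \<in> CD n \<Longrightarrow> (twist ^^ j) F \<in> CD n"
  by (induction j) (simp_all add: twist_CD)

lemma avg_CD: "F \<in> CD n \<Longrightarrow> avg r d F \<in> CD n"
proof -
  assume F: "F \<in> CD n"
  have "(\<lambda>xs x. \<Sum>j\<in>J. r j * (twist ^^ j) F xs x) \<in> CD n" for J
  proof (induction J rule: infinite_finite_induct)
    case (insert i J)
    then have "(\<lambda>xs x. r i * (twist ^^ i) F xs x) + (\<lambda>xs x. \<Sum>j\<in>J. r j * (twist ^^ j) F xs x) \<in> CD n"
      by (intro CD_module twist_power_CD F)
    then show ?case using insert by (simp add: plus_fun_def)
  qed (use CD_module(3) in \<open>simp_all add: zero_fun_def\<close>)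
  then show ?thesis unfolding avg_def[abs_def] .
qed

lemma coboundary_avg: "coboundary twisted_dual (avg r d F) = avg r d (coboundary twisted_dual F)"
proof -
  have tp: "coboundary twisted_dual ((twist ^^ j) F) = (twist ^^ j) (coboundary twisted_dual F)" for j
    by (induction j) (simp_all add: coboundary_twist)
  have "coboundary twisted_dual (\<lambda>xs x. \<Sum>j\<in>J. r j * (twist ^^ j) F xs x)
      = (\<lambda>xs x. \<Sum>j\<in>J. r j * (twist ^^ j) (coboundary twisted_dual F) xs x)" for J
  proof (induction J rule: infinite_finite_induct)
    case (insert i J)
    have eq: "(\<lambda>xs x. \<Sum>j\<in>insert i J. r j * (twist ^^ j) G xs x)
        = (\<lambda>xs x. r i * (twist ^^ i) G xs x) + (\<lambda>xs x. \<Sum>j\<in>J. r j * (twist ^^ j) G xs x)" for G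
      using insert by (simp add: plus_fun_def)
    show ?case unfolding eq coboundary_add coboundary_smult tp insert.IH by (rule refl)
  qed (simp_all add: coboundary_def twisted_dual_def fun_eq_iff sum_fun_apply sgnpow_fun)
  then show ?thesis unfolding avg_def[abs_def] .
qed

lemma avg_zero [simp]: "avg r d 0 = 0"
  by (intro ext) (simp add: avg_def twist_power)

lemma pair_twist_chain_power: "pair_chain F ((twist_chain ^^ j) z) = pair_chain ((twist ^^ j) F) z"
  by (induction j arbitrary: F) (simp_all add: pair_twist_chain funpow_swap1[of twist])

lemma pair_avg_chain: "pair_chain F (avg_chain r d z) = pair_chain (avg r d F) z"
proof -
  have "pair_chain (\<lambda>xs x. \<Sum>j\<in>J. r j * (twist ^^ j) F xs x) z = (\<Sum>j\<in>J. r j * pair_chain ((twist ^^ j) F) z)" for J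
    by (induction J rule: infinite_finite_induct) (simp_all add: pair_fun)
  then show ?thesis
    unfolding avg_chain_def avg_def[abs_def] by (simp add: pair_sum pair_fscale pair_twist_chain_power)
qed

lemma avg_chain_chains: "z \<in> chains twisted n \<Longrightarrow> avg_chain r d z \<in> chains twisted n"
proof -
  assume z: "z \<in> chains twisted n"
  have "(twist_chain ^^ j) z \<in> chains twisted n" for j
    by (induction j) (simp_all add: z twist_chains)
  then show ?thesis unfolding avg_chain_def by (intro chains_sum chains_module)
qed

section \<open>Closure of Hochschild cohomology under the BV-operator\<close>

text \<open>
  On a cocycle \<open>F\<close> the homotopy formula reduces to \<open>d (F \<circ> B) = F \<circ> T - F\<close>, so \<open>F \<circ> B\<close> is again a
  cocycle as soon as \<open>F\<close> is invariant under \<open>T\<close>.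
\<close>
lemma delta_connes_star:
  assumes F: "coboundary twisted_dual F = 0"
  shows "coboundary twisted_dual (connes_star F) = twist F - F"
  using connes_star_homotopy[of F] by (simp add: F)

lemma coboundary_zero [simp]: "coboundary twisted_dual 0 = 0"
  using coboundary_add[of 0 0] by simp

text \<open>
  The homotopy formula on chains, \<open>b B z = (T - 1) z - B b z\<close>, where both terms on the right vanish
  in the tensor product. Equality there is tested by pairing with cochains.
\<close>
lemma connes_cycle:
  assumes z: "z \<in> cycles twisted n" and inv: "twist_chain z - z \<in> tensor_null twisted n"
  shows "lin_ext connes_gen z \<in> cycles twisted (n + 1)"
proof -
  have zc: "z \<in> chains twisted n" using z by (simp add: cycles_def)
  have "bdry (lin_ext connes_gen z) \<in> tensor_null twisted n"
  proof (rule tensor_null_I)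
    show "bdry (lin_ext connes_gen z) \<in> chains twisted n"
      using bdry_chains[OF connes_chains[OF zc]] by simp
    fix F assume F: "F \<in> CD n"
    have "pair_chain F (bdry (lin_ext connes_gen z)) = pair_chain (connes_star (coboundary twisted_dual F)) z"
      by (simp add: pair_bdry pair_connes)
    also have "connes_star (coboundary twisted_dual F) = twist F - F - coboundary twisted_dual (connes_star F)"
      using connes_star_homotopy[of F] by (simp add: eq_diff_eq add.commute)
    also have "pair_chain \<dots> z = pair_chain F (twist_chain z - z) - pair_chain (coboundary twisted_dual (connes_star F)) z"
      by (simp add: pair_fun_diff pair_diff pair_twist_chain)
    also have "\<dots> = 0"
      using pair_tensor_null[OF F inv] pair_coboundary[OF connes_star_CD[OF F] z] by simp
    finally show "pair_chain F (bdry (lin_ext connes_gen z)) = 0" .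
  qed
  then show ?thesis using connes_chains[OF zc] by (simp add: cycles_def)
qed

lemma tensor_null_zero: "0 \<in> tensor_null twisted n"
  by (rule tensor_null_I) (simp_all add: chains_module)

text \<open>
  With \<open>y = r(T) z\<close>, the chain \<open>z' = z - (T - 1) y\<close> is the invariant part of \<open>z\<close>. As \<open>y\<close> is a cycle
  together with \<open>z\<close>, the homotopy formula gives \<open>(T - 1) y = b B y\<close>, so \<open>z'\<close> is homologous to \<open>z\<close>.
\<close>
lemma invariant_cycle_exists:
  assumes nakayama_semisimple and V: "V \<in> homology twisted n"
  shows "\<exists>z. z \<in> V \<and> z \<in> cycles twisted n \<and> twist_chain z - z \<in> tensor_null twisted n"
proof -
  obtain z where z: "z \<in> cycles twisted n" and V_eq: "V = hom_class twisted n z"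
    using V by (auto simp: homology_def)
  have zc: "z \<in> chains twisted n"
    using z by (auto simp: cycles_def)
  obtain r d where split: "\<And>F. F \<in> CD n \<Longrightarrow>
      twist (F - (twist (avg r d F) - avg r d F)) = F - (twist (avg r d F) - avg r d F)"
    using twist_splitting[OF assms(1), of n] by blast
  define y where "y = avg_chain r d z"
  have yc: "y \<in> chains twisted n" unfolding y_def by (rule avg_chain_chains) (rule zc)
  define z' where "z' = z - (twist_chain y - y)"
  have z'c: "z' \<in> chains twisted n" unfolding z'_def by (intro chains_diff twist_chains zc yc)
  have pz': "pair_chain F z' = pair_chain (F - (avg r d (twist F) - avg r d F)) z" for F
    by (simp add: z'_def y_def pair_diff pair_fun_diff pair_twist_chain pair_avg_chain)
  have avg_twist: "avg r d (twist F) = twist (avg r d F)" for F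
    by (intro ext) (simp add: avg_def twist_power, simp add: twist_def funpow_swap1 avg_def twist_power comp_def)
  have inv: "twist_chain z' - z' \<in> tensor_null twisted n"
  proof (rule tensor_null_I)
    show "twist_chain z' - z' \<in> chains twisted n" by (intro chains_diff twist_chains z'c)
    fix F assume F: "F \<in> CD n"
    have "pair_chain F (twist_chain z' - z') =
       pair_chain (twist (F - (twist (avg r d F) - avg r d F)) - (F - (twist (avg r d F) - avg r d F))) z"
      unfolding pair_diff pair_twist_chain pz' avg_twist twist_diff pair_fun_diff by simp
    then show "pair_chain F (twist_chain z' - z') = 0" using split[OF F] by simp
  qed
  have bd: "z' - z - bdry (- lin_ext connes_gen y) \<in> tensor_null twisted n"
  proof (rule tensor_null_I)
    have "lin_ext connes_gen y \<in> chains twisted (n + 1)" by (rule connes_chains[OF yc])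
    then have "bdry (- lin_ext connes_gen y) \<in> chains twisted n"
      using bdry_chains[OF chains_module(4)] by fastforce
    then show "z' - z - bdry (- lin_ext connes_gen y) \<in> chains twisted n" by (intro chains_diff z'c zc)
    fix F assume F: "F \<in> CD n"
    have "pair_chain F (z' - z - bdry (- lin_ext connes_gen y)) =
       - pair_chain (twist F - F) y + pair_chain (connes_star (coboundary twisted_dual F)) y"
      by (simp add: pair_diff z'_def pair_bdry pair_minus pair_connes pair_twist_chain pair_fun_diff)
    also have "twist F - F = coboundary twisted_dual (connes_star F) + connes_star (coboundary twisted_dual F)"
      by (simp add: connes_star_homotopy)
    also have "- pair_chain \<dots> y + pair_chain (connes_star (coboundary twisted_dual F)) y
        = - pair_chain (coboundary twisted_dual (connes_star F)) y"
      by (simp add: pair_fun_add)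
    also have "\<dots> = - pair_chain (coboundary twisted_dual (avg r d (connes_star F))) z"
      by (simp add: y_def pair_avg_chain coboundary_avg)
    also have "\<dots> = 0"
      using pair_coboundary[OF avg_CD[OF connes_star_CD[OF F]] z] by simp
    finally show "pair_chain F (z' - z - bdry (- lin_ext connes_gen y)) = 0" .
  qed
  have "z' - z = bdry (- lin_ext connes_gen y) + (z' - z - bdry (- lin_ext connes_gen y))" by simp
  moreover have "- lin_ext connes_gen y \<in> chains twisted (n + 1)" by (intro chains_module connes_chains yc)
  ultimately have "z' - z \<in> boundaries twisted n" using bd unfolding boundaries_def by blast
  then have z'V: "z' \<in> V" using z'c by (simp add: V_eq hom_class_def)
  moreover have "bdry z' \<in> tensor_null twisted (n - 1)"
  proof (rule tensor_null_I)
    show "bdry z' \<in> chains twisted (n - 1)" by (rule bdry_chains[OF z'c])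
    fix F assume F: "F \<in> CD (n - 1)"
    have "pair_chain F (bdry z') = pair_chain (coboundary twisted_dual F) z'" by (rule pair_bdry)
    also have "\<dots> = pair_chain (coboundary twisted_dual F) z"
    proof (rule pair_hom_class)
      show "z' \<in> hom_class twisted n z" using z'V V_eq by simp
      obtain f where f: "f \<in> C (n - 1)" "F = Z \<circ> f" using F CD_iff_Z by auto
      then have "delta f \<in> Zc n" by (intro Bc_Zc) auto
      then show "coboundary twisted_dual F \<in> cocycles twisted_dual n"
        unfolding cocycles_twisted_dual_iff f(2) coboundary_Z by blast
    qed
    also have "\<dots> = 0" by (rule pair_coboundary[OF F z])
    finally show "pair_chain F (bdry z') = 0" .
  qed
  ultimately show ?thesis using inv z'c by (auto simp: cycles_def)
qed

text \<open>
  A cocycle takes the same value on all cycles of a class, so the chosen representatives of homology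
  classes may be replaced by more convenient ones.
\<close>
lemma rep_homology:
  assumes "V \<in> homology twisted n"
  shows "rep V \<in> V" "F \<in> cocycles twisted_dual n \<Longrightarrow> z \<in> V \<Longrightarrow> pair_chain F (rep V) = pair_chain F z"
proof -
  obtain z0 where z0: "z0 \<in> cycles twisted n" "V = hom_class twisted n z0"
    using assms by (auto simp: homology_def)
  have "z0 - z0 = bdry 0 + 0" by (simp add: lin_ext_def)
  then have "z0 - z0 \<in> boundaries twisted n"
    unfolding boundaries_def using chains_module(3) tensor_null_zero by blast
  then have "z0 \<in> V" using z0 by (simp add: hom_class_def cycles_def)
  then show rV: "rep V \<in> V" unfolding rep_def by (rule someI[of "\<lambda>x. x \<in> V"])
  show "F \<in> cocycles twisted_dual n \<Longrightarrow> z \<in> V \<Longrightarrow> pair_chain F (rep V) = pair_chain F z"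
    using pair_hom_class[of F n "rep V" z0] pair_hom_class[of F n z z0] rV z0(2) by simp
qed

lemma pair_rep_cycle:
  assumes "V \<in> homology twisted n"
  obtains z where "z \<in> cycles twisted n" "\<And>F. F \<in> cocycles twisted_dual n \<Longrightarrow> pair_chain F (rep V) = pair_chain F z"
proof -
  obtain z0 where z0: "z0 \<in> cycles twisted n" "V = hom_class twisted n z0"
    using assms by (auto simp: homology_def)
  show ?thesis
    by (rule that[OF z0(1)]) (use pair_hom_class rep_homology(1)[OF assms] z0(2) in auto)
qed

lemma del_inv_cl:
  assumes U: "U \<in> cohomology regular n" and f: "f \<in> U" and V: "V \<in> homology twisted n"
  shows "del_inv n U V = sgnpow n (pair_chain (Z \<circ> f) (rep V))"
proof -
  obtain z where z: "z \<in> cycles twisted n"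
    and zV: "\<And>F. F \<in> cocycles twisted_dual n \<Longrightarrow> pair_chain F (rep V) = pair_chain F z"
    using pair_rep_cycle[OF V] by blast
  have cc: "Z \<circ> g \<in> cocycles twisted_dual n" if "g \<in> U" for g
    using cohomologyD(1)[OF U that] cocycles_twisted_dual_iff by blast
  obtain h where h: "h \<in> C (n - 1)" "rep U - f = delta h"
    using cohomology_diff[OF U rep_in[OF U] f] by auto
  have "(Z \<circ> rep U) - (Z \<circ> f) = coboundary twisted_dual (Z \<circ> h)"
    by (simp add: coboundary_Z h(2)[symmetric] Z_comp_diff)
  then have "pair_chain (Z \<circ> rep U) z - pair_chain (Z \<circ> f) z = 0"
    using pair_coboundary[OF _ z, of "Z \<circ> h"] h(1) CD_iff_Z by (simp add: pair_fun_diff[symmetric])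
  moreover have "(\<lambda>xs x. form (rep U xs) x) = Z \<circ> rep U" by (auto simp: Z_def)
  ultimately show ?thesis
    using V zV[OF cc[OF rep_in[OF U]]] zV[OF cc[OF f]] by (simp add: del_inv_def)
qed

text \<open>
  The two BV-operators are the same composite applied to \<open>del_inv n U\<close> and to \<open>C_bar n (Z_star n U)\<close>.
  These functionals agree because the representatives from which they are computed differ by a
  coboundary, which pairs to zero with every cycle.
\<close>
lemma C_bar_Z_star:
  assumes U: "U \<in> cohomology regular n"
  shows "C_bar n (Z_star n U) = del_inv n U"
proof
  fix V
  obtain f where f: "f \<in> U" "rep (Z_star n U) = Z \<circ> f" using rep_Z_star[OF U] by blast
  show "C_bar n (Z_star n U) V = del_inv n U V"
    using del_inv_cl[OF U f(1), of V] by (cases "V \<in> homology twisted n") (simp_all add: C_bar_def del_inv_def f(2))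
qed

text \<open>
  Replace \<open>F = Z \<circ> rep U\<close> by the cohomologous invariant cocycle \<open>F' = F - (R \<circ> T - R)\<close> with
  \<open>R = F \<circ> r(T)\<close>. Then \<open>F' \<circ> B\<close> is a cocycle, and it represents the functional \<open>V \<mapsto> F (B V)\<close>: the
  Connes operator on homology is evaluated on an invariant cycle \<open>z\<close>, for which \<open>B z\<close> is a cycle
  and cannot tell \<open>F\<close> from \<open>F'\<close>.
\<close>
lemma bv_operator_closed:
  assumes ss: nakayama_semisimple and U: "U \<in> cohomology regular n"
  shows "del (n - 1) (connes_dual (n - 1) (del_inv n U)) \<in> cohomology regular (n - 1)"
proof -
  define F where "F = Z \<circ> rep U"
  have Fco: "F \<in> cocycles twisted_dual n" unfolding F_def cocycles_twisted_dual_iff using rep_Zc[OF U] by blast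
  then have F: "F \<in> CD n" "coboundary twisted_dual F = 0" by (auto simp: cocycles_def)
  obtain r d where split: "\<And>F. F \<in> CD n \<Longrightarrow>
      twist (F - (twist (avg r d F) - avg r d F)) = F - (twist (avg r d F) - avg r d F)"
    using twist_splitting[OF ss, of n] by blast
  define R where "R = avg r d F"
  have R: "R \<in> CD n" "coboundary twisted_dual R = 0"
    by (simp_all add: R_def avg_CD F coboundary_avg)
  have TR: "coboundary twisted_dual (connes_star R) = twist R - R" by (rule delta_connes_star[OF R(2)])
  define F' where "F' = F - coboundary twisted_dual (connes_star R)"
  have F'_eq: "F' = F - (twist R - R)" by (simp add: F'_def TR)
  have "twist F' = F'" unfolding F'_eq R_def by (rule split[OF F(1)])
  moreover have F'_CD: "F' \<in> CD n"
    unfolding F'_eq by (intro CD_diff F(1) twist_CD R(1))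
  moreover have F'_co: "coboundary twisted_dual F' = 0"
  proof -
    have "coboundary twisted_dual (F' + twist R) = coboundary twisted_dual (F + R)" by (simp add: F'_eq)
    then show ?thesis unfolding coboundary_add coboundary_twist by (simp add: F R twist_def[abs_def] zero_fun_def)
  qed
  ultimately have G_co: "coboundary twisted_dual (connes_star F') = 0"
    using delta_connes_star[of F'] by simp
  have G_CD: "connes_star F' \<in> CD (n - 1)" by (rule connes_star_CD[OF F'_CD])
  then obtain g where g: "g \<in> C (n - 1)" "connes_star F' = Z \<circ> g" using CD_iff_Z by auto
  have gZ: "g \<in> Zc (n - 1)"
  proof -
    have "Z \<circ> delta g = Z \<circ> 0" using G_co g(2) by (simp add: coboundary_Z Z_comp_zero)
    then show ?thesis using g(1) by (simp add: Zc_iff)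
  qed
  \<comment> \<open>The sign comes from \<open>del_inv\<close>: it is \<open>(-1)\<^sup>n\<close> in the degree of \<open>U\<close> and \<open>(-1)\<^bsup>n - 1\<^esup>\<close> in that of \<open>W\<close>.\<close>
  define W where "W = cl (n - 1) (- g)"
  have mg: "- g \<in> Zc (n - 1)" using gZ by (rule Zc_closed)
  have W: "W \<in> cohomology regular (n - 1)" unfolding W_def by (rule cl_cohomology[OF mg])
  have gW: "- g \<in> W" unfolding W_def using mg by (intro cl_self) (simp add: Zc_iff)
  have "connes_dual (n - 1) (del_inv n U) = del_inv (n - 1) W"
  proof
    fix V
    show "connes_dual (n - 1) (del_inv n U) V = del_inv (n - 1) W V"
    proof (cases "V \<in> homology twisted (n - 1)")
      case False
      then show ?thesis by (simp add: connes_dual_def del_inv_def)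
    next
      case V: True
      define z where "z = (SOME z. z \<in> V \<and> z \<in> cycles twisted (n - 1) \<and> twist_chain z - z \<in> tensor_null twisted (n - 1))"
      have z: "z \<in> V" "z \<in> cycles twisted (n - 1)" "twist_chain z - z \<in> tensor_null twisted (n - 1)"
        using someI_ex[OF invariant_cycle_exists[OF ss V]] unfolding z_def by blast+
      have Bz: "lin_ext connes_gen z \<in> cycles twisted n"
        using connes_cycle[OF z(2,3)] by simp
      have cV: "connes (n - 1) V = hom_class twisted n (lin_ext connes_gen z)"
        by (simp add: connes_def z_def)
      then have cVh: "connes (n - 1) V \<in> homology twisted n" using Bz by (auto simp: homology_def)
      have "pair_chain F (rep (connes (n - 1) V)) = pair_chain F (lin_ext connes_gen z)"
        using pair_hom_class[OF Fco] rep_homology(1)[OF cVh] cV by simp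
      also have "\<dots> = pair_chain F' (lin_ext connes_gen z)"
        using pair_coboundary[OF connes_star_CD[OF R(1)] Bz] by (simp add: F'_def pair_fun_diff)
      also have "\<dots> = pair_chain (Z \<circ> g) z" by (simp add: pair_connes g(2))
      also have "\<dots> = pair_chain (Z \<circ> g) (rep V)"
      proof (rule rep_homology(2)[OF V _ z(1), symmetric])
        show "Z \<circ> g \<in> cocycles twisted_dual (n - 1)" using gZ cocycles_twisted_dual_iff by blast
      qed
      finally have "connes_dual (n - 1) (del_inv n U) V = sgnpow n (pair_chain (Z \<circ> g) (rep V))"
        using V del_inv_cl[OF U rep_in[OF U] cVh] by (simp add: connes_dual_def F_def)
      moreover have "Z \<circ> - g = - (Z \<circ> g)" by (auto simp: Z_minus)
      moreover have "sgnpow (n - 1) (- y) = sgnpow n (y :: 'k)" for y by (simp add: sgnpow_def)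
      ultimately show ?thesis using del_inv_cl[OF W gW V] by (simp add: pair_fun_minus)
    qed
  qed
  then show ?thesis unfolding del_def using W by (simp add: inv_into_into)
qed

section \<open>The isomorphism of BV-structures\<close>

lemma Z_star_zero: "Z_star n (coh_zero regular n) = coh_zero twisted_dual n"
  unfolding coh_zero_def using Z_star_cl[OF Zc_closed(3)] by (simp add: Z_comp_zero)

lemma bv_isomorphism_Z_star: "bv_isomorphism Z_star HH_bv H_dual_bv"
  unfolding bv_isomorphism_def HH_bv_def H_dual_bv_def
  by (auto simp: bij_Z_star Z_star_add Z_star_scale Z_star_cup Z_star_bracket C_bar_Z_star simp flip: gbracket_def)

lemma bv_algebra_HH_iff:
  assumes nakayama_semisimple
  shows "bv_algebra HH_bv \<longleftrightarrow> bv_algebra H_dual_bv"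
proof (rule bv_algebra_iff_isomorphic[OF bv_isomorphism_Z_star])
  show "Z_star n (gzero HH_bv n) = gzero H_dual_bv n" for n
    by (simp add: HH_bv_def H_dual_bv_def Z_star_zero)
  show "gzero HH_bv n \<in> gr HH_bv n" for n
    using cl_cohomology[OF Zc_closed(3)] by (simp add: HH_bv_def coh_zero_def)
  show "gadd HH_bv n U V \<in> gr HH_bv n" if "U \<in> gr HH_bv n" "V \<in> gr HH_bv n" for n U V
    using that by (simp add: HH_bv_def coh_add_in)
  show "gscale HH_bv n c U \<in> gr HH_bv n" if "U \<in> gr HH_bv n" for n c U
    using that by (simp add: HH_bv_def coh_scale_in)
  show "cup HH_bv n m U V \<in> gr HH_bv (n + m)" if "U \<in> gr HH_bv n" "V \<in> gr HH_bv m" for n m U V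
    using that by (simp add: HH_bv_def cl_cohomology cupr_Zc rep_Zc)
  show "bracket HH_bv n m U V \<in> gr HH_bv (n + m - 1)" if "U \<in> gr HH_bv n" "V \<in> gr HH_bv m" for n m U V
    using that by (simp add: HH_bv_def cl_cohomology gbracket_Zc rep_Zc flip: gbracket_def)
  show "bvop HH_bv n U \<in> gr HH_bv (n - 1)" if "U \<in> gr HH_bv n" for n U
    using that by (simp add: HH_bv_def bv_operator_closed[OF assms])
qed

end

theorem theorem4p3:
  fixes scale :: "'k::field \<Rightarrow> 'a::{ring,monoid_mult} \<Rightarrow> 'a"
    and form :: "'a \<Rightarrow> 'a \<Rightarrow> 'k"
  assumes "frobenius_algebra scale form"
    and "frobenius_algebra.nakayama_semisimple scale form"
  shows "bv_isomorphic (frobenius_algebra.HH_bv scale form)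
           (frobenius_algebra.H_dual_bv scale form) \<and>
         (bv_algebra (frobenius_algebra.HH_bv scale form) \<longleftrightarrow>
          bv_algebra (frobenius_algebra.H_dual_bv scale form))"
proof -
  interpret frobenius_algebra scale form by fact
  show ?thesis
    using bv_isomorphism_Z_star bv_algebra_HH_iff[OF assms(2)] unfolding bv_isomorphic_def by blast
qed

end
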